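(* Let $n,n'\in N^+$ with $\{n',n\}=c>0$, and let $b,b'\in(1/\delta_0)\mathbb{Z}$, where $c/2\in(1/\delta_0)\mathbb{Z}$. Then, in $G$, $$\begin{aligned} [n']_{c/2,b'}\,[n]_{c/2,b} =&\ \Bigl(\overrightarrow{\prod_{p\ge0}}\,[(p+1)n+pn']_{c/2,\,(p+1)b+pb'}\Bigr)\\ &\times\Bigl(\prod_{p\ge0}[2^p(n+n')]_{2^{p-1}c,\,2^p(b+b')-2^{p-1}c}\,[2^p(n+n')]_{2^{p-1}c,\,2^p(b+b')+2^{p-1}c}\Bigr)\\ &\times\Bigl(\overleftarrow{\prod_{p\ge0}}\,[pn+(p+1)n']_{c/2,\,pb+(p+1)b'}\Bigr). \end{aligned}$$ In particular, when $r=2$, $(\delta_1,\delta_2)=(2,2)$ and $\{e_2,e_1\}=1$, taking $n=e_1$, $n'=e_2$, $c=1$, $b=b'=0$ gives $$\begin{aligned} [e_2]_{\frac12,0}[e_1]_{\frac12,0} =&\ \Bigl(\overrightarrow{\prod_{p\ge0}}[(p+1)e_1+pe_2]_{\frac12,0}\Bigr) \Bigl(\prod_{j\ge0}[2^j(e_1+e_2)]_{2^{j-1},-2^{j-1}}[2^j(e_1+e_2)]_{2^{j-1},2^{j-1}}\Bigr)\\ &\times\Bigl(\overleftarrow{\prod_{p\ge0}}[pe_1+(p+1)e_2]_{\frac12,0}\Bigr). \end{aligned}$$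
   Context: Fixed data: $N$ is a lattice of finite rank $r$ with basis $(e_1,\dots,e_r)$; $\{\cdot,\cdot\}:N\times N\to\mathbb{Q}$ is a skew-symmetric bilinear form; $\delta_1,\dots,\delta_r$ are positive integers such that $N^\circ=\bigoplus_i\mathbb{Z}\,\delta_ie_i$ satisfies $\{N^\circ,N\}\subset\mathbb{Z}$. Let $\delta_0=\mathrm{lcm}(\delta_1,\dots,\delta_r)$; then $\{\cdot,\cdot\}$ takes values in $(1/\delta_0)\mathbb{Z}$. Let $N^+=\{\sum_i a_ie_i\mid a_i\in\mathbb{Z}_{\ge0},\ \sum_i a_i>0\}$ and $\deg(\sum_i a_ie_i)=\sum_i a_i$. Let $q$ be an indeterminate, $[\alpha]_q=\frac{q^\alpha-q^{-\alpha}}{q-q^{-1}}$ for $\alpha\in(1/\delta_0)\mathbb{Z}$. Let $\mathfrak{g}=\bigoplus_{n\in N^+}\mathbb{Q}(q^{1/\delta_0})X_n$ be the Lie algebra over $\mathbb{Q}(q^{1/\delta_0})$ with $[X_n,X_{n'}]=[\{n,n'\}]_q X_{n+n'}$, $\widehat{\mathfrak{g}}$ its completion with respect to $\deg$, and $G=\exp(\widehat{\mathfrak{g}})$ with the Baker–Campbell–Hausdorff product. Let $G^{>\ell}$ be the normal subgroup of elements $\exp(\sum_{\deg n>\ell}c_nX_n)$; infinite products in $G$ are understood as limits with respect to the quotients $G/G^{>\ell}$ (in each of which only finitely many factors are nontrivial). Quantum dilogarithm elements, for $n\in N^+$, $a\in(1/\delta_0)\mathbb{Z}_{>0}$, $b\in(1/\delta_0)\mathbb{Z}$: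 $$[n]_{a,b}:=\Psi_{a,b}[n]=\exp\Bigl(\sum_{j=1}^\infty\frac{(-1)^{j+1}}{j\,[ja]_q}q^{jb}X_{jn}\Bigr)\in G.$$ $\overrightarrow{\prod}$ (resp. $\overleftarrow{\prod}$) denotes the ordered product with the index $p$ increasing from left to right (resp. from right to left). *)

theory Defs
  imports
    "HOL-Analysis.Finite_Cartesian_Product"
    "HOL-Algebra.Coset"
    "HOL-Computational_Algebra.Fraction_Field"
    "HOL-Computational_Algebra.Polynomial"
    "HOL-Library.Numeral_Type"
begin

text \<open>
  The lattice \<open>N\<close> with its basis is \<open>int ^ 'r\<close> with the basis vectors \<open>e\<^sub>i = axis i 1\<close>;
  the rank is \<open>CARD('r)\<close>.
\<close>

definition sublattice :: "('r::finite \<Rightarrow> nat) \<Rightarrow> (int ^ 'r) set" where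
  "sublattice d = {\<Sum>i\<in>UNIV. (a i * int (d i)) *s axis i 1 | a. True}"

locale fixed_data =
  fixes B :: "int ^ 'r::finite \<Rightarrow> int ^ 'r \<Rightarrow> rat"
    and d :: "'r \<Rightarrow> nat"
  assumes add_left: "B (x + y) z = B x z + B y z"
    and add_right: "B x (y + z) = B x y + B x z"
    and skew: "B x y = - B y x"
    and d_pos: "d i > 0"
    and integral: "x \<in> sublattice d \<Longrightarrow> B x y \<in> \<int>"

definition delta0 :: "('r::finite \<Rightarrow> nat) \<Rightarrow> nat" where
  "delta0 d = Lcm (range d)"

definition fracs :: "('r::finite \<Rightarrow> nat) \<Rightarrow> rat set" where
  "fracs d = {of_int k / of_nat (delta0 d) | k. True}"

definition Nplus :: "(int ^ 'r::finite) set" where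
  "Nplus = {n. (\<forall>i. 0 \<le> n $ i) \<and> 0 < (\<Sum>i\<in>UNIV. n $ i)}"

definition deg :: "int ^ 'r::finite \<Rightarrow> nat" where
  "deg n = nat (\<Sum>i\<in>UNIV. n $ i)"

text \<open>
  The field \<open>\<rat>(q\<^sup>1\<^sup>/\<^sup>\<delta>\<^sup>0)\<close> is the field of rational functions in the indeterminate \<open>t = q\<^sup>1\<^sup>/\<^sup>\<delta>\<^sup>0\<close>,
  so that \<open>q\<^sup>\<alpha>\<close> is the integer power \<open>t\<^sup>\<delta>\<^sup>0\<^sup>\<alpha>\<close> for \<open>\<alpha> \<in> (1/\<delta>\<^sub>0)\<int>\<close>. The floor only turns the
  integral rational \<open>\<delta>\<^sub>0 \<alpha>\<close> into an element of type \<open>int\<close>.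
\<close>

type_synonym ratfun = "rat poly fract"

definition tvar :: ratfun where
  "tvar = Fract [:0, 1:] 1"

definition qpow :: "('r::finite \<Rightarrow> nat) \<Rightarrow> rat \<Rightarrow> ratfun" where
  "qpow d \<alpha> = tvar powi \<lfloor>of_nat (delta0 d) * \<alpha>\<rfloor>"

definition qnum :: "('r::finite \<Rightarrow> nat) \<Rightarrow> rat \<Rightarrow> ratfun" where
  "qnum d \<alpha> = (qpow d \<alpha> - qpow d (- \<alpha>)) / (qpow d 1 - qpow d (- 1))"

text \<open>
  There are finitely many elements of \<open>N\<^sup>+\<close> of each degree, so the completion of the Lie algebra
  with respect to the degree consists of all formal sums \<open>\<Sum>\<^sub>n x\<^sub>n X\<^sub>n\<close> over \<open>N\<^sup>+\<close>. Such a sum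
  is represented by its coefficient function \<open>x\<close>, extended by \<open>0\<close> outside \<open>N\<^sup>+\<close>.
\<close>

type_synonym 'r series = "int ^ 'r \<Rightarrow> ratfun"

definition ghat :: "'r::finite series set" where
  "ghat = {x. \<forall>n. n \<notin> Nplus \<longrightarrow> x n = 0}"

definition lie ::
    "(int ^ 'r::finite \<Rightarrow> int ^ 'r \<Rightarrow> rat) \<Rightarrow> ('r \<Rightarrow> nat) \<Rightarrow> 'r series \<Rightarrow> 'r series \<Rightarrow> 'r series" where
  "lie B d x y = (\<lambda>n. \<Sum>(m, m') \<in> {(m, m'). m \<in> Nplus \<and> m' \<in> Nplus \<and> m + m' = n}.
     x m * y m' * qnum d (B m m'))"

text \<open>
  The Baker--Campbell--Hausdorff series in Dynkin's form:
  the sum over \<open>k \<ge> 1\<close> and over all \<open>(r\<^sub>1, s\<^sub>1), \<dots>, (r\<^sub>k, s\<^sub>k)\<close> with \<open>r\<^sub>i + s\<^sub>i > 0\<close> of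
  \<open>(-1)\<^sup>k\<^sup>-\<^sup>1 / k\<close> times \<open>1 / ((\<Sum>\<^sub>i (r\<^sub>i + s\<^sub>i)) \<Prod>\<^sub>i r\<^sub>i! s\<^sub>i!)\<close> times the right-nested bracket
  \<open>[x, [x, \<dots> [y, \<dots>]]]\<close> of the word \<open>x\<close> (\<open>r\<^sub>1\<close> times), \<open>y\<close> (\<open>s\<^sub>1\<close> times), \<open>\<dots>\<close>,
  \<open>x\<close> (\<open>r\<^sub>k\<close> times), \<open>y\<close> (\<open>s\<^sub>k\<close> times).
\<close>

fun nested ::
    "(int ^ 'r::finite \<Rightarrow> int ^ 'r \<Rightarrow> rat) \<Rightarrow> ('r \<Rightarrow> nat) \<Rightarrow> 'r series list \<Rightarrow> 'r series" where
  "nested B d [] = (\<lambda>_. 0)"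
| "nested B d [x] = x"
| "nested B d (x # y # ws) = lie B d x (nested B d (y # ws))"

definition dynkin_word :: "'a \<Rightarrow> 'a \<Rightarrow> (nat \<times> nat) list \<Rightarrow> 'a list" where
  "dynkin_word x y ps = concat (map (\<lambda>(r, s). replicate r x @ replicate s y) ps)"

definition dynkin_index :: "nat \<Rightarrow> (nat \<times> nat) list set" where
  "dynkin_index m = {ps. ps \<noteq> [] \<and> (\<forall>(r, s) \<in> set ps. r + s > 0) \<and> (\<Sum>(r, s)\<leftarrow>ps. r + s) = m}"

definition dynkin_coeff :: "(nat \<times> nat) list \<Rightarrow> ratfun" where
  "dynkin_coeff ps = (-1) ^ (length ps - 1) / of_nat (length ps)
     / of_nat ((\<Sum>(r, s)\<leftarrow>ps. r + s) * (\<Prod>(r, s)\<leftarrow>ps. fact r * fact s))"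

text \<open>
  A bracket of \<open>m\<close> elements has no component of degree less than \<open>m\<close>; hence only the terms
  with \<open>m \<le> deg n\<close> contribute to the coefficient of \<open>X\<^sub>n\<close>.
\<close>

definition bch ::
    "(int ^ 'r::finite \<Rightarrow> int ^ 'r \<Rightarrow> rat) \<Rightarrow> ('r \<Rightarrow> nat) \<Rightarrow> 'r series \<Rightarrow> 'r series \<Rightarrow> 'r series" where
  "bch B d x y = (\<lambda>n. \<Sum>m = 1..deg n. \<Sum>ps \<in> dynkin_index m.
     dynkin_coeff ps * nested B d (dynkin_word x y ps) n)"

text \<open>The group element \<open>exp x\<close> is represented by \<open>x\<close> itself.\<close>

definition qgroup ::
    "(int ^ 'r::finite \<Rightarrow> int ^ 'r \<Rightarrow> rat) \<Rightarrow> ('r \<Rightarrow> nat) \<Rightarrow> 'r series monoid" where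
  "qgroup B d = \<lparr>carrier = ghat, monoid.mult = bch B d, one = (\<lambda>_. 0)\<rparr>"

definition qgroup_gt :: "nat \<Rightarrow> 'r::finite series set" where
  "qgroup_gt l = {x \<in> ghat. \<forall>n. x n \<noteq> 0 \<longrightarrow> deg n > l}"

definition has_limit ::
    "(int ^ 'r::finite \<Rightarrow> int ^ 'r \<Rightarrow> rat) \<Rightarrow> ('r \<Rightarrow> nat) \<Rightarrow> (nat \<Rightarrow> 'r series) \<Rightarrow> 'r series \<Rightarrow> bool" where
  "has_limit B d s g \<longleftrightarrow> g \<in> carrier (qgroup B d) \<and>
     (\<forall>l. \<forall>\<^sub>F k in sequentially. qgroup_gt l #>\<^bsub>qgroup B d\<^esub> s k = qgroup_gt l #>\<^bsub>qgroup B d\<^esub> g)"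

definition list_prod :: "('a, 'b) monoid_scheme \<Rightarrow> 'a list \<Rightarrow> 'a" where
  "list_prod G gs = foldr (\<otimes>\<^bsub>G\<^esub>) gs \<one>\<^bsub>G\<^esub>"

text \<open>Infinite products \<open>f 0 \<cdot> f 1 \<cdot> f 2 \<cdots>\<close> and \<open>\<cdots> f 2 \<cdot> f 1 \<cdot> f 0\<close>.\<close>

definition has_prod_right ::
    "(int ^ 'r::finite \<Rightarrow> int ^ 'r \<Rightarrow> rat) \<Rightarrow> ('r \<Rightarrow> nat) \<Rightarrow> (nat \<Rightarrow> 'r series) \<Rightarrow> 'r series \<Rightarrow> bool" where
  "has_prod_right B d f g \<longleftrightarrow> has_limit B d (\<lambda>k. list_prod (qgroup B d) (map f [0..<k])) g"

definition has_prod_left ::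
    "(int ^ 'r::finite \<Rightarrow> int ^ 'r \<Rightarrow> rat) \<Rightarrow> ('r \<Rightarrow> nat) \<Rightarrow> (nat \<Rightarrow> 'r series) \<Rightarrow> 'r series \<Rightarrow> bool" where
  "has_prod_left B d f g \<longleftrightarrow> has_limit B d (\<lambda>k. list_prod (qgroup B d) (map f (rev [0..<k]))) g"

text \<open>For \<open>n \<in> N\<^sup>+\<close> there is at most one \<open>j\<close> with \<open>j n = m\<close>, so the sum has at most one term.\<close>

definition qdilog :: "('r::finite \<Rightarrow> nat) \<Rightarrow> int ^ 'r \<Rightarrow> rat \<Rightarrow> rat \<Rightarrow> 'r series" where
  "qdilog d n a b = (\<lambda>m. \<Sum>j | j \<ge> 1 \<and> int j *s n = m.
     (-1) ^ (j + 1) / (of_nat j * qnum d (of_nat j * a)) * qpow d (of_nat j * b))"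

lemma finite_dynkin_index: "finite (dynkin_index m)"
proof (rule finite_subset)
  show "dynkin_index m \<subseteq> {ps. set ps \<subseteq> {..m} \<times> {..m} \<and> length ps \<le> m}"
  proof
    fix ps assume "ps \<in> dynkin_index m"
    then have *: "\<forall>(r, s) \<in> set ps. r + s > 0" and sum: "(\<Sum>(r, s)\<leftarrow>ps. r + s) = m"
      by (auto simp: dynkin_index_def)
    from * have "length ps \<le> (\<Sum>(r, s)\<leftarrow>ps. r + s)"
      by (induction ps) (auto simp: Suc_le_eq intro: add_less_le_mono)
    moreover have "r \<le> m \<and> s \<le> m" if "(r, s) \<in> set ps" for r s
      using member_le_sum_list[of "r + s" "map (\<lambda>(r, s). r + s) ps"] that sum by force
    ultimately show "ps \<in> {ps. set ps \<subseteq> {..m} \<times> {..m} \<and> length ps \<le> m}"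
      using sum by auto
  qed
  show "finite {ps. set ps \<subseteq> {..m} \<times> {..m} \<and> length ps \<le> m}"
    by (rule finite_lists_length_le) auto
qed

lemma dynkin_index_1: "dynkin_index 1 = {[(1, 0)], [(0, 1)]}"
proof -
  have "ps \<in> {[(1, 0)], [(0, 1)]}" if "ps \<in> dynkin_index 1" for ps
  proof -
    from that obtain r s qs where ps: "ps = (r, s) # qs" and rs: "r + s > 0"
      and sum: "r + s + (\<Sum>(r, s)\<leftarrow>qs. r + s) = 1" and qs: "\<forall>(r, s) \<in> set qs. r + s > 0"
      by (cases ps) (auto simp: dynkin_index_def)
    from sum rs have "(\<Sum>(r, s)\<leftarrow>qs. r + s) = 0" by linarith
    with qs have "qs = []" by (cases qs) auto
    with ps sum show ?thesis by auto
  qed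
  moreover have "[(1, 0)] \<in> dynkin_index 1" "[(0, 1)] \<in> dynkin_index 1"
    by (auto simp: dynkin_index_def)
  ultimately show ?thesis by blast
qed

lemma deg_add: "m \<in> Nplus \<Longrightarrow> m' \<in> Nplus \<Longrightarrow> deg (m + m') = deg m + deg m'"
  by (simp add: Nplus_def deg_def sum.distrib nat_add_distrib)

lemma Nplus_add: "m \<in> Nplus \<Longrightarrow> m' \<in> Nplus \<Longrightarrow> m + m' \<in> Nplus"
  by (auto simp: Nplus_def sum.distrib)

lemma lie_in_ghat: "lie B d x y \<in> ghat"
  by (auto simp: ghat_def lie_def intro!: sum.neutral dest: Nplus_add)

lemma finite_lie_index: "finite {(m, m'). m \<in> Nplus \<and> m' \<in> Nplus \<and> m + m' = (n :: int ^ 'r::finite)}"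
proof (rule finite_subset)
  let ?A = "(\<lambda>f. (\<chi> i. f i)) ` (\<Pi>\<^sub>E i\<in>UNIV. {0..n $ i})"
  have *: "m \<in> ?A" if "\<forall>i. m $ i \<in> {0..n $ i}" for m
    using that by (intro image_eqI[of _ _ "($) m"]) auto
  show "{(m, m'). m \<in> Nplus \<and> m' \<in> Nplus \<and> m + m' = n} \<subseteq> ?A \<times> ?A"
  proof (rule subsetI, elim CollectE case_prodE conjE)
    fix p m m' assume m: "m \<in> Nplus" "m' \<in> Nplus" "m + m' = n" and p: "p = (m, m')"
    then have "\<forall>i. m $ i \<in> {0..n $ i}" "\<forall>i. m' $ i \<in> {0..n $ i}"
      by (auto simp: Nplus_def)
    then show "p \<in> ?A \<times> ?A" using * p by blast
  qed
  show "finite (?A \<times> ?A)" by (intro finite_cartesian_product finite_imageI finite_PiE) auto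
qed

lemma lie_gt:
  assumes "x \<in> qgroup_gt l \<or> y \<in> qgroup_gt l"
  shows "lie B d x y \<in> qgroup_gt l"
proof -
  have "lie B d x y n = 0" if "\<not> deg n > l" for n
    unfolding lie_def
  proof (rule sum.neutral, clarify)
    fix m m' assume m: "m \<in> Nplus" "m' \<in> Nplus" "n = m + m'"
    then have "\<not> deg m > l" "\<not> deg m' > l"
      using that by (auto simp: deg_add)
    then have "x m = 0 \<or> y m' = 0"
      using assms by (auto simp: qgroup_gt_def)
    then show "x m * y m' * qnum d (B m m') = 0" by auto
  qed
  then show ?thesis using lie_in_ghat by (auto simp: qgroup_gt_def)
qed

lemma nested_gt:
  assumes "x \<in> qgroup_gt l" "x \<in> set ws"
  shows "nested B d ws \<in> qgroup_gt l"
  using assms(2)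
proof (induction ws rule: induct_list012)
  case (3 y z ws)
  then show ?case using assms(1) by (auto intro!: lie_gt)
qed (use assms(1) in auto)

text \<open>Limits in \<open>G\<close> are unique, so \<open>has_limit\<close> determines the value of an infinite product.\<close>

context fixed_data
begin

lemma lie_self: "lie B d y y = (\<lambda>_. 0)"
proof
  fix n :: "int ^ 'r"
  let ?S = "{(m, m'). m \<in> Nplus \<and> m' \<in> Nplus \<and> m + m' = n}"
  let ?f = "\<lambda>(m, m'). y m * y m' * qnum d (B m m')"
  have neg: "qnum d (B m' m) = - qnum d (B m m')" for m m'
    using skew[of m' m] by (simp add: qnum_def minus_divide_left)
  have "?f p = - ?f (prod.swap p)" for p
    using neg[of "snd p" "fst p"] by (simp add: case_prod_beta mult.commute)
  then have "sum ?f ?S = (\<Sum>p\<in>?S. - ?f p)"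
    by (intro sum.reindex_bij_witness[of _ prod.swap prod.swap])
       (auto simp: add.commute simp del: minus_mult_left minus_mult_right)
  then show "lie B d y y n = 0"
    by (simp add: lie_def sum_negf)
qed

lemma nested_replicate: "nested B d (replicate (Suc (Suc m)) y) = (\<lambda>_. 0)"
proof (induction m)
  case 0
  then show ?case by (simp add: lie_self)
next
  case (Suc m)
  then have "nested B d (replicate (Suc (Suc (Suc m))) y) = lie B d y (\<lambda>_. 0)" by simp
  also have "\<dots> = (\<lambda>_. 0)" by (auto simp: lie_def intro!: sum.neutral)
  finally show ?case .
qed

lemma nested_dynkin_gt:
  assumes x: "x \<in> qgroup_gt l" and n: "deg n \<le> l" and ps: "ps \<in> dynkin_index m" and m: "m > 1"
  shows "nested B d (dynkin_word x y ps) n = 0"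
proof (cases "\<exists>(r, s) \<in> set ps. r > 0")
  case True
  then obtain r s where "(r, s) \<in> set ps" "r > 0" by auto
  then have "x \<in> set (replicate r x @ replicate s y)" by simp
  with \<open>(r, s) \<in> set ps\<close> have "x \<in> set (dynkin_word x y ps)"
    unfolding dynkin_word_def set_concat set_map by (intro UN_I) auto
  then have "nested B d (dynkin_word x y ps) \<in> qgroup_gt l" by (rule nested_gt[OF x])
  then show ?thesis using n unfolding qgroup_gt_def by (metis (mono_tags, lifting) mem_Collect_eq not_less)
next
  case False
  then have "dynkin_word x y ps = replicate (\<Sum>(r, s)\<leftarrow>ps. r + s) y"
    by (induction ps) (auto simp: dynkin_word_def replicate_add)
  also have "(\<Sum>(r, s)\<leftarrow>ps. r + s) = Suc (Suc (m - 2))"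
    using ps m by (simp add: dynkin_index_def)
  finally show ?thesis using nested_replicate by metis
qed

lemma bch_gt:
  assumes x: "x \<in> qgroup_gt l" and n: "n \<in> Nplus" "deg n \<le> l"
  shows "bch B d x y n = y n"
proof -
  let ?T = "\<lambda>m. \<Sum>ps \<in> dynkin_index m. dynkin_coeff ps * nested B d (dynkin_word x y ps) n"
  have "deg n \<ge> 1" using n(1) by (auto simp: Nplus_def deg_def)
  then have "bch B d x y n = ?T 1 + (\<Sum>m = 2..deg n. ?T m)"
    by (simp add: bch_def sum.atLeast_Suc_atMost numeral_2_eq_2)
  also have "(\<Sum>m = 2..deg n. ?T m) = 0"
    using nested_dynkin_gt[OF x n(2)] by (intro sum.neutral ballI) auto
  also have "?T 1 = x n + y n"
    by (simp add: dynkin_index_1[unfolded One_nat_def] dynkin_coeff_def dynkin_word_def)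
  also have "x n = 0" using x n by (auto simp: qgroup_gt_def)
  finally show ?thesis by simp
qed

lemma has_limit_unique:
  assumes g: "has_limit B d s g" and h: "has_limit B d s h"
  shows "g = h"
proof
  fix n
  show "g n = h n"
  proof (cases "n \<in> Nplus")
    case False
    then show ?thesis using g h by (simp add: has_limit_def qgroup_def ghat_def)
  next
    case True
    define l where "l = deg n"
    let ?C = "\<lambda>u. qgroup_gt l #>\<^bsub>qgroup B d\<^esub> u"
    have "\<forall>\<^sub>F k in sequentially. ?C (s k) = ?C g \<and> ?C (s k) = ?C h"
      using g h by (auto simp: has_limit_def intro: eventually_conj)
    then have eq: "?C g = ?C h"
      by (metis (mono_tags, lifting) eventually_happens' sequentially_bot)
    have zero: "(\<lambda>_. 0) \<in> qgroup_gt l" by (simp add: qgroup_gt_def ghat_def)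
    then have "bch B d (\<lambda>_. 0) g \<in> ?C g"
      by (auto simp: r_coset_def qgroup_def)
    then obtain x where x: "x \<in> qgroup_gt l" "bch B d (\<lambda>_. 0) g = bch B d x h"
      unfolding eq by (auto simp: r_coset_def qgroup_def)
    have "g n = bch B d (\<lambda>_. 0) g n" using bch_gt[OF zero True] by (simp add: l_def)
    also have "\<dots> = h n" using bch_gt[OF x(1) True] x(2) by (simp add: l_def)
    finally show ?thesis .
  qed
qed

end

end

theory Submission
  imports Defs "HOL-Computational_Algebra.Formal_Laurent_Series" "HOL-Analysis.Cartesian_Space"
begin

text \<open>
  The Lie algebra embeds into the quantum torus with \<open>Y\<^sub>n Y\<^sub>k = q\<^sup>{\<^sup>n\<^sup>,\<^sup>k\<^sup>} Y\<^sub>n\<^sub>+\<^sub>k\<close> by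
  \<open>X\<^sub>n = Y\<^sub>n / (q - q\<^sup>-\<^sup>1)\<close>, and by the Baker--Campbell--Hausdorff theorem the exponential embeds the
  group into the invertible series over the quantum torus. There \<open>[n]\<^sub>a\<^sub>,\<^sub>b\<close> becomes \<open>\<Phi>\<^sub>a (q\<^sup>b Y\<^sub>n)\<close>, where
  \<open>\<Phi>\<^sub>a (q\<^sup>a z) = (1 + z) \<Phi>\<^sub>a (q\<^sup>-\<^sup>a z)\<close>. This functional equation yields the pentagon relation, and
  \<open>\<Phi>\<^sub>a (z) = \<Phi>\<^sub>2\<^sub>a (q\<^sup>a z) \<Phi>\<^sub>2\<^sub>a (q\<^sup>-\<^sup>a z)\<close>. Writing \<open>\<Phi> = \<Phi>\<^sub>c\<^sub>/\<^sub>2\<close>, \<open>F = \<Phi>\<^sub>c\<close>, \<open>Q = q\<^sup>c\<^sup>/\<^sup>2\<close>, and \<open>(i, j)\<close> for the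
  normalised monomial of exponent \<open>i n + j n'\<close>, these two facts give
  \<open>\<Phi>(0,1) \<Phi>(1,0) = \<Phi>(1,0) F(Q(2,1)) \<Phi>(Q(1,1)) \<cdot> F(Q(0,1)) F(Q\<^sup>-\<^sup>1(2,1)) \<cdot> \<Phi>(Q\<^sup>-\<^sup>1(1,1)) F(Q\<^sup>-\<^sup>1(0,1))\<close>.
  The two factors in the middle are again of the form of the left-hand side, with \<open>c\<close> doubled and in
  higher degree, so modulo each degree they are factorized by induction. Moving
  \<open>\<Phi>(Q\<^sup>\<plusminus>\<^sup>1(1,1))\<close> to the centre by pentagon relations recombines the pairs of \<open>F\<close> into the
  remaining \<open>\<Phi>(p+1,p)\<close> and \<open>\<Phi>(p,p+1)\<close>.
\<close>

section \<open>Functional calculus in power series over noncommutative algebras\<close>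

unbundle no vec_syntax
unbundle fps_syntax

text \<open>The product of \<open>qgroup\<close> is given by brackets alone, and not even its
  associativity can be read off from them; so the Baker--Campbell--Hausdorff theorem is proved here
  in Dynkin's form. This needs exponentials in power series over an algebra and in power series over
  such series, which is why algebras with central scalars form a class closed under
  \<open>fps\<close>. Identities of infinite products are proved as congruences up to every degree.

  One constant shapes the factorization: Y_n' and Y_n commute up to q^(2c) = Q^4, while the pentagon
  relation for Phi_Q requires Q^2. Only F = Phi_(Q^2) fits, so a Phi_Q has to be split into two F
  before it can be moved. In the inductive step the first monomial (1,0) is replaced by (2,1), while
  (0,1) stays in the same degree; hence the order of the first monomial alone measures progress. The
  logarithm of the infinite product in the centre can be summed in closed form; thus the induction
  carries a single function of (1,1) instead of a product.\<close>

class ratfun_algebra = ring_1 +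
  fixes scl :: "ratfun \<Rightarrow> 'a \<Rightarrow> 'a" (infixr "*\<^sub>q" 73)
  assumes scl_add_right: "c *\<^sub>q (x + y) = c *\<^sub>q x + c *\<^sub>q y"
    and scl_add_left: "(c + c') *\<^sub>q x = c *\<^sub>q x + c' *\<^sub>q x"
    and scl_scl: "c *\<^sub>q c' *\<^sub>q x = (c * c') *\<^sub>q x"
    and scl_one [simp]: "1 *\<^sub>q x = x"
    and scl_mult_left: "(c *\<^sub>q x) * y = c *\<^sub>q (x * y)"
    and scl_mult_right: "x * (c *\<^sub>q y) = c *\<^sub>q (x * y)"
begin

lemma scl_zero_right [simp]: "c *\<^sub>q 0 = 0"
  using scl_add_right[of c 0 0] by simp

lemma scl_zero_left [simp]: "0 *\<^sub>q x = 0"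
  using scl_add_left[of 0 0 x] by simp

lemma scl_minus_right: "c *\<^sub>q (- x) = - (c *\<^sub>q x)"
  by (rule minus_unique[symmetric]) (simp flip: scl_add_right)

lemma scl_minus_left: "(- c) *\<^sub>q x = - (c *\<^sub>q x)"
  by (rule minus_unique[symmetric]) (simp flip: scl_add_left)

lemma scl_diff_right: "c *\<^sub>q (x - y) = c *\<^sub>q x - c *\<^sub>q y"
  using scl_add_right[of c x "- y"] by (simp add: scl_minus_right)

lemma scl_diff_left: "(c - c') *\<^sub>q x = c *\<^sub>q x - c' *\<^sub>q x"
  using scl_add_left[of c "- c'" x] by (simp add: scl_minus_left)

lemma scl_sum_right: "c *\<^sub>q (\<Sum>i\<in>I. f i) = (\<Sum>i\<in>I. c *\<^sub>q f i)"
  by (induction I rule: infinite_finite_induct) (auto simp: scl_add_right)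

lemma scl_sum_left: "(\<Sum>i\<in>I. f i) *\<^sub>q x = (\<Sum>i\<in>I. f i *\<^sub>q x)"
  by (induction I rule: infinite_finite_induct) (auto simp: scl_add_left)

lemma scl_of_nat: "of_nat k *\<^sub>q x = of_nat k * x"
  by (induction k) (auto simp: scl_add_left algebra_simps)

lemma scl_power: "(c *\<^sub>q x) ^ k = c ^ k *\<^sub>q x ^ k"
  by (induction k) (auto simp: scl_mult_left scl_mult_right scl_scl mult.commute)

lemmas scl_mult = scl_mult_left scl_mult_right scl_scl

end

instantiation fps :: (ratfun_algebra) ratfun_algebra
begin

definition "scl c f = Abs_fps (\<lambda>n. c *\<^sub>q f $ n)"

lemma scl_fps_nth [simp]: "(c *\<^sub>q f) $ n = c *\<^sub>q f $ n"
  by (simp add: scl_fps_def)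

instance
  by standard
    (auto simp: fps_eq_iff fps_mult_nth scl_add_right scl_add_left scl_scl scl_mult_left scl_mult_right
       scl_sum_right)

end

section \<open>Congruence of power series up to a given degree\<close>

definition fps_cong :: "nat \<Rightarrow> 'a::zero fps \<Rightarrow> 'a fps \<Rightarrow> bool" where
  "fps_cong l f g \<longleftrightarrow> (\<forall>k\<le>l. f $ k = g $ k)"

lemma fps_cong_refl [simp]: "fps_cong l f f"
  by (simp add: fps_cong_def)

lemma fps_cong_sym: "fps_cong l f g \<Longrightarrow> fps_cong l g f"
  by (simp add: fps_cong_def)

lemma fps_cong_trans [trans]: "fps_cong l f g \<Longrightarrow> fps_cong l g h \<Longrightarrow> fps_cong l f h"
  by (simp add: fps_cong_def)

lemma fps_congD: "fps_cong l f g \<Longrightarrow> k \<le> l \<Longrightarrow> f $ k = g $ k"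
  by (simp add: fps_cong_def)

lemma fps_cong_all_eq: "(\<And>l. fps_cong l f g) \<Longrightarrow> f = g"
  by (auto simp: fps_eq_iff fps_cong_def)

lemma fps_cong_diff:
  fixes f g :: "'a::group_add fps"
  shows "fps_cong l f f' \<Longrightarrow> fps_cong l g g' \<Longrightarrow> fps_cong l (f - g) (f' - g')"
  by (simp add: fps_cong_def)

lemma fps_cong_mult:
  fixes f g :: "'a::semiring_0 fps"
  shows "fps_cong l f f' \<Longrightarrow> fps_cong l g g' \<Longrightarrow> fps_cong l (f * g) (f' * g')"
  by (auto simp: fps_cong_def fps_mult_nth intro!: sum.cong)

lemma fps_cong_scl:
  "fps_cong l f f' \<Longrightarrow> fps_cong l (c *\<^sub>q f) (c *\<^sub>q f')"
  by (simp add: fps_cong_def)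

lemma fps_cong_sum:
  fixes f g :: "'b \<Rightarrow> 'a::comm_monoid_add fps"
  shows "(\<And>i. i \<in> I \<Longrightarrow> fps_cong l (f i) (g i)) \<Longrightarrow> fps_cong l (\<Sum>i\<in>I. f i) (\<Sum>i\<in>I. g i)"
  by (simp add: fps_cong_def fps_sum_nth)

text \<open>
  The operator \<open>T\<close> is meant to raise the order, so that only the terms with \<open>k \<le> n\<close> of
  \<open>\<Sum>\<^sub>k p\<^sub>k T\<^sup>k w\<close> contribute to the \<open>n\<close>-th coefficient.
\<close>

definition act :: "('a::ratfun_algebra fps \<Rightarrow> 'a fps) \<Rightarrow> ratfun fps \<Rightarrow> 'a fps \<Rightarrow> 'a fps" where
  "act T p w = Abs_fps (\<lambda>n. \<Sum>k\<le>n. p $ k *\<^sub>q (T ^^ k) w $ n)"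

definition order_ge :: "nat \<Rightarrow> 'a::zero fps \<Rightarrow> bool" where
  "order_ge m f \<longleftrightarrow> (\<forall>k<m. f $ k = 0)"

text \<open>Common to left multiplication by \<open>z\<close> and to \<open>ad z\<close> whenever
  \<open>z $ 0 = 0\<close>, so that the product and composition rules of the functional calculus are
  proved once for both.\<close>

locale raising =
  fixes T :: "'a::ratfun_algebra fps \<Rightarrow> 'a fps"
  assumes T_add: "T (v + w) = T v + T w"
    and T_scl: "T (c *\<^sub>q v) = c *\<^sub>q T v"
    and T_raise: "order_ge m v \<Longrightarrow> order_ge (Suc m) (T v)"
begin

lemma pow_add: "(T ^^ k) (v + w) = (T ^^ k) v + (T ^^ k) w"
  by (induction k) (auto simp: T_add)

lemma pow_scl: "(T ^^ k) (c *\<^sub>q v) = c *\<^sub>q (T ^^ k) v"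
  by (induction k) (auto simp: T_scl)

lemma pow_zero: "(T ^^ k) 0 = 0"
  using pow_scl[of k 0 0] by simp

lemma pow_diff: "(T ^^ k) (v - w) = (T ^^ k) v - (T ^^ k) w"
  using pow_add[of k "v - w" w] by (simp add: algebra_simps)

lemma pow_sum: "(T ^^ k) (\<Sum>i\<in>I. f i) = (\<Sum>i\<in>I. (T ^^ k) (f i))"
  by (induction I rule: infinite_finite_induct) (auto simp: pow_add pow_zero)

lemma pow_raise: "order_ge m v \<Longrightarrow> order_ge (m + k) ((T ^^ k) v)"
  by (induction k) (auto intro: T_raise)

lemma pow_nth: "n < k \<Longrightarrow> (T ^^ k) v $ n = 0"
  using pow_raise[of 0 v k] by (simp add: order_ge_def)

lemma pow_cong:
  assumes "fps_cong l v w"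
  shows "fps_cong l ((T ^^ k) v) ((T ^^ k) w)"
proof -
  have "order_ge (Suc l) (v - w)"
    using assms by (simp add: fps_cong_def order_ge_def)
  from pow_raise[OF this, of k] show ?thesis
    by (simp add: fps_cong_def order_ge_def pow_diff)
qed

lemma act_cong_finite: "l \<le> K \<Longrightarrow> fps_cong l (act T p w) (\<Sum>k\<le>K. p $ k *\<^sub>q (T ^^ k) w)"
  unfolding fps_cong_def act_def
  by (intro allI impI, simp add: fps_sum_nth, rule sum.mono_neutral_left) (simp_all add: pow_nth)

lemma act_cong: "fps_cong l v w \<Longrightarrow> fps_cong l (act T p v) (act T p w)"
  by (rule fps_cong_trans[OF act_cong_finite[OF order_refl]],
      rule fps_cong_trans[OF _ fps_cong_sym[OF act_cong_finite[OF order_refl]]])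
    (intro fps_cong_sum fps_cong_scl pow_cong)

lemma act_mult: "act T (p * q) w = act T p (act T q w)"
proof (rule fps_cong_all_eq)
  fix l
  let ?t = "\<lambda>k j. (p $ k * q $ j) *\<^sub>q (T ^^ (k + j)) w"
  have "fps_cong l (act T p (act T q w)) (act T p (\<Sum>j\<le>l. q $ j *\<^sub>q (T ^^ j) w))"
    by (intro act_cong act_cong_finite) auto
  also have "fps_cong l \<dots> (\<Sum>k\<le>l. p $ k *\<^sub>q (T ^^ k) (\<Sum>j\<le>l. q $ j *\<^sub>q (T ^^ j) w))"
    by (intro act_cong_finite) auto
  also have "(\<Sum>k\<le>l. p $ k *\<^sub>q (T ^^ k) (\<Sum>j\<le>l. q $ j *\<^sub>q (T ^^ j) w)) = (\<Sum>k\<le>l. \<Sum>j\<le>l. ?t k j)"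
    by (simp add: pow_sum pow_scl scl_sum_right scl_scl funpow_add)
  \<comment> \<open>Terms with \<open>k + j > l\<close> vanish in all degrees up to
    \<open>l\<close>, so the square of indices may be cut down to the triangle over which the Cauchy
    product sums.\<close>
  also have "fps_cong l \<dots> (\<Sum>k\<le>l. \<Sum>j\<le>l - k. ?t k j)"
  proof (intro fps_cong_sum)
    fix k assume "k \<in> {..l}"
    show "fps_cong l (\<Sum>j\<le>l. ?t k j) (\<Sum>j\<le>l - k. ?t k j)"
      unfolding fps_cong_def
    proof (intro allI impI)
      fix n assume "n \<le> l"
      then have "?t k j $ n = 0" if "j \<in> {..l} - {..l - k}" for j
        using that \<open>k \<in> {..l}\<close> by (subst scl_fps_nth, subst pow_nth) auto
      then show "(\<Sum>j\<le>l. ?t k j) $ n = (\<Sum>j\<le>l - k. ?t k j) $ n"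
        unfolding fps_sum_nth by (intro sum.mono_neutral_right) auto
    qed
  qed
  also have "(\<Sum>k\<le>l. \<Sum>j\<le>l - k. ?t k j) = (\<Sum>m\<le>l. \<Sum>k\<le>m. ?t k (m - k))"
    unfolding sum.Sigma[OF finite_atMost ballI[OF finite_atMost]]
    by (rule sum.reindex_bij_witness[of _ "\<lambda>(m, k). (k, m - k)" "\<lambda>(k, j). (k + j, k)"]) auto
  also have "\<dots> = (\<Sum>m\<le>l. (p * q) $ m *\<^sub>q (T ^^ m) w)"
    by (auto simp: fps_mult_nth scl_sum_left atLeast0AtMost intro!: sum.cong)
  also have "fps_cong l \<dots> (act T (p * q) w)"
    by (intro fps_cong_sym[OF act_cong_finite]) auto
  finally show "fps_cong l (act T (p * q) w) (act T p (act T q w))"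
    by (rule fps_cong_sym)
qed

end

lemma act_diff_left: "act T (p - q) w = act T p w - act T q w"
  by (simp add: act_def fps_eq_iff scl_diff_left sum_subtractf)

lemma act_1 [simp]: "act T 1 w = w"
  by (simp add: act_def fps_eq_iff if_distrib[of "\<lambda>c. c *\<^sub>q _"] cong: if_cong)

context raising
begin

lemma act_pow: "(act T E ^^ k) w = act T (E ^ k) w"
  by (induction k) (auto simp: act_mult)

text \<open>By \<open>act_mult\<close> the \<open>k\<close>-th power of \<open>act T E\<close> is
  \<open>act T (E ^ k)\<close>. As \<open>E ^ k\<close> starts in degree \<open>k\<close>, both
  sides are finite double sums in each degree, which are exchanged.\<close>

lemma act_compose:
  assumes "E $ 0 = 0"
  shows "act (act T E) p w = act T (p oo E) w"
proof (rule fps_ext)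
  fix n
  have "act (act T E) p w $ n = (\<Sum>k\<le>n. \<Sum>j\<le>n. (p $ k * (E ^ k) $ j) *\<^sub>q (T ^^ j) w $ n)"
    by (simp add: act_def[of "act T E"] act_pow) (simp add: act_def scl_sum_right scl_scl)
  also have "\<dots> = (\<Sum>j\<le>n. \<Sum>k\<le>n. (p $ k * (E ^ k) $ j) *\<^sub>q (T ^^ j) w $ n)"
    by (rule sum.swap)
  also have "\<dots> = (\<Sum>j\<le>n. (p oo E) $ j *\<^sub>q (T ^^ j) w $ n)"
  proof (intro sum.cong refl)
    fix j assume "j \<in> {..n}"
    then have "(\<Sum>k\<le>n. p $ k * (E ^ k) $ j) = (p oo E) $ j"
      using assms unfolding fps_compose_nth atLeast0AtMost
      by (intro sum.mono_neutral_right) (auto simp: startsby_zero_power_prefix)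
    then show "(\<Sum>k\<le>n. (p $ k * (E ^ k) $ j) *\<^sub>q (T ^^ j) w $ n) = (p oo E) $ j *\<^sub>q (T ^^ j) w $ n"
      by (simp flip: scl_sum_left)
  qed
  finally show "act (act T E) p w $ n = act T (p oo E) w $ n"
    by (simp add: act_def)
qed

end

text \<open>Substitution of \<open>z\<close> into a series \<open>p\<close> with scalar
  coefficients, which equals \<open>act\<close> for left multiplication by \<open>z\<close>, applied
  to 1. The cutoff at \<open>n\<close> loses nothing when \<open>z $ 0 = 0\<close>; the
  multiplicative rules assume this.\<close>

definition ev :: "ratfun fps \<Rightarrow> 'a::ratfun_algebra fps \<Rightarrow> 'a fps" where
  "ev p z = Abs_fps (\<lambda>n. \<Sum>k\<le>n. p $ k *\<^sub>q (z ^ k) $ n)"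

lemma ev_nth_0 [simp]: "ev p z $ 0 = p $ 0 *\<^sub>q 1"
  by (simp add: ev_def)

lemma raising_mult_left:
  fixes z :: "'a::ratfun_algebra fps"
  assumes "z $ 0 = 0"
  shows "raising ((*) z)"
proof
  fix m and v :: "'a fps" assume "order_ge m v"
  then have "z $ i * v $ (n - i) = 0" if "n < Suc m" "i \<le> n" for i n
    using that assms by (cases "i = 0") (auto simp: order_ge_def)
  then show "order_ge (Suc m) (z * v)"
    unfolding order_ge_def fps_mult_nth by (intro allI impI sum.neutral ballI) simp
qed (simp_all add: distrib_left scl_mult_right)

lemma funpow_mult_left: "((*) z ^^ k) w = z ^ k * (w::'a::monoid_mult)"
  by (induction k) (auto simp: mult.assoc)

lemma act_mult_left: 
  assumes "z $ 0 = 0"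
  shows "act ((*) z) p w = ev p z * w"
proof (rule fps_cong_all_eq)
  interpret raising "(*) z" by (rule raising_mult_left) fact
  fix l
  have ev: "ev p z = act ((*) z) p 1"
    by (simp add: ev_def act_def funpow_mult_left)
  have "fps_cong l (act ((*) z) p w) (\<Sum>k\<le>l. p $ k *\<^sub>q ((*) z ^^ k) w)"
    by (rule act_cong_finite) simp
  also have "\<dots> = (\<Sum>k\<le>l. p $ k *\<^sub>q ((*) z ^^ k) 1) * w"
    unfolding sum_distrib_right by (intro sum.cong) (simp_all only: funpow_mult_left scl_mult_left mult_1_right)
  also have "fps_cong l \<dots> (ev p z * w)"
    unfolding ev by (intro fps_cong_mult fps_cong_sym[OF act_cong_finite] fps_cong_refl) simp
  finally show "fps_cong l (act ((*) z) p w) (ev p z * w)" .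
qed

lemma ev_mult: "z $ 0 = 0 \<Longrightarrow> ev (p * q) z = ev p z * ev q z"
  using raising.act_mult[OF raising_mult_left, of z p q 1] by (simp add: act_mult_left)

lemma ev_1 [simp]: "ev 1 z = 1"
  by (simp add: ev_def fps_eq_iff if_distrib[of "\<lambda>c. c *\<^sub>q _"] cong: if_cong)

lemma ev_compose:
  assumes "z $ 0 = 0" "q $ 0 = 0"
  shows "ev (p oo q) z = ev p (ev q z)"
proof -
  have "act ((*) z) q = (*) (ev q z)"
    using assms by (auto simp: act_mult_left)
  moreover have "ev q z $ 0 = 0"
    using assms by simp
  ultimately have "ev p (ev q z) = act (act ((*) z) q) p 1"
    by (simp add: act_mult_left)
  also have "\<dots> = ev (p oo q) z"
    using assms by (simp add: raising.act_compose[OF raising_mult_left] act_mult_left)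
  finally show ?thesis ..
qed

lemma ev_cong_finite: "z $ 0 = 0 \<Longrightarrow> l \<le> K \<Longrightarrow> fps_cong l (ev p z) (\<Sum>k\<le>K. p $ k *\<^sub>q z ^ k)"
  using raising.act_cong_finite[OF raising_mult_left, of z l K p 1]
  by (simp add: act_mult_left funpow_mult_left)

lemma ev_add: "ev (p + q) z = ev p z + ev q z"
  by (simp add: ev_def fps_eq_iff scl_add_left sum.distrib)

lemma ev_diff: "ev (p - q) z = ev p z - ev q z"
  by (simp add: ev_def fps_eq_iff scl_diff_left sum_subtractf)

lemma ev_scl: "ev p (c *\<^sub>q z) = ev (p oo (fps_const c * fps_X)) z"
  by (simp add: ev_def fps_eq_iff scl_power scl_scl mult.commute[of "p $ _"])

lemma ev_fps_X: 
  assumes "z $ 0 = 0"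
  shows "ev fps_X z = z"
proof (rule fps_ext)
  fix n
  have "(\<Sum>k\<le>n. fps_X $ k *\<^sub>q (z ^ k) $ n) = (\<Sum>k\<le>n. if k = 1 then z $ n else 0)"
    by (intro sum.cong) (auto simp: fps_X_def)
  also have "\<dots> = z $ n"
    using assms by (cases n) auto
  finally show "ev fps_X z $ n = z $ n"
    by (simp add: ev_def)
qed

section \<open>Exponential and logarithm of noncommutative power series\<close>

definition nexp :: "'a::ratfun_algebra fps \<Rightarrow> 'a fps" where
  "nexp z = ev (fps_exp 1) z"

lemma nexp_nth_0 [simp]: "nexp z $ 0 = 1"
  by (simp add: nexp_def)

lemma nexp_uminus_right [simp]:
  assumes "z $ 0 = 0"
  shows "nexp z * nexp (- z) = 1"
proof -
  have "nexp (- z) = ev (fps_exp 1 oo (fps_const (- 1) * fps_X)) z"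
    unfolding nexp_def ev_scl[symmetric] by (simp add: scl_minus_left)
  then have "nexp z * nexp (- z) = ev (fps_exp 1 * fps_exp (- 1)) z"
    using assms by (simp only: nexp_def ev_mult fps_exp_compose_linear) simp
  also have "fps_exp 1 * fps_exp (- 1) = (1 :: ratfun fps)"
    by (simp flip: fps_exp_add_mult)
  finally show ?thesis by simp
qed

lemma nexp_uminus_left [simp]: "z $ 0 = 0 \<Longrightarrow> nexp (- z) * nexp z = 1"
  using nexp_uminus_right[of "- z"] by simp

text \<open>\<open>fps_ln 1\<close> is the series of log (1 + X), whence the shift by 1 in the inner
  series.\<close>

lemma fps_ln_compose_exp: "fps_ln 1 oo (fps_exp 1 - 1) = (fps_X :: ratfun fps)"
  by (simp add: fps_ln_fps_exp_inv fps_inv)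

lemma fps_exp_compose_ln: "fps_exp 1 oo fps_ln 1 = (1 + fps_X :: ratfun fps)"
proof -
  have "(fps_exp 1 - 1) oo fps_ln 1 = (fps_X :: ratfun fps)"
    by (simp add: fps_ln_fps_exp_inv fps_inv_right)
  then show ?thesis
    by (simp add: fps_compose_sub_distrib algebra_simps)
qed

lemma ev_ln_nexp:
  assumes "z $ 0 = 0"
  shows "ev (fps_ln 1) (nexp z - 1) = z"
proof -
  have "nexp z - 1 = ev (fps_exp 1 - 1) z"
    by (simp add: ev_diff nexp_def)
  with assms show ?thesis
    by (simp add: ev_fps_X fps_ln_compose_exp flip: ev_compose)
qed

lemma nexp_inj: "nexp z = nexp z' \<Longrightarrow> z $ 0 = 0 \<Longrightarrow> z' $ 0 = 0 \<Longrightarrow> z = z'"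
  by (metis ev_ln_nexp)

lemma nexp_surj:
  assumes "u $ 0 = 1"
  obtains z where "z $ 0 = 0" "nexp z = u"
proof
  show "ev (fps_ln 1) (u - 1) $ 0 = 0"
    by simp
  show "nexp (ev (fps_ln 1) (u - 1)) = u"
    using assms by (simp add: nexp_def fps_exp_compose_ln ev_add ev_fps_X flip: ev_compose)
qed

section \<open>Conjugation by an exponential and the derivative of an exponential\<close>

definition ad :: "'a::ring \<Rightarrow> 'a \<Rightarrow> 'a" where
  "ad x w = x * w - w * x"

lemma raising_ad:
  fixes z :: "'a::ratfun_algebra fps"
  assumes "z $ 0 = 0"
  shows "raising (ad z)"
proof
  fix m and v :: "'a fps" assume v: "order_ge m v"
  have "v $ i * z $ (n - i) = 0" if "n < Suc m" "i \<le> n" for i n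
    using that assms v by (cases "i = n") (auto simp: order_ge_def)
  then have "order_ge (Suc m) (v * z)"
    unfolding order_ge_def fps_mult_nth by (intro allI impI sum.neutral ballI) simp
  with raising.T_raise[OF raising_mult_left, OF assms v] show "order_ge (Suc m) (ad z v)"
    by (simp add: order_ge_def ad_def)
qed (simp_all add: algebra_simps ad_def scl_mult scl_diff_right)

lemma order_ge_mult:
  fixes f g :: "'a::semiring_0 fps"
  assumes "order_ge m f" "order_ge n g"
  shows "order_ge (m + n) (f * g)"
  unfolding order_ge_def fps_mult_nth
proof (intro allI impI sum.neutral ballI)
  fix k i assume "k < m + n" "i \<in> {0..k}"
  then have "i < m \<or> k - i < n" by auto
  with assms show "f $ i * g $ (k - i) = 0"
    by (auto simp: order_ge_def)
qed

lemma order_ge_power: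
  fixes f :: "'a::semiring_1 fps"
  shows "order_ge m f \<Longrightarrow> order_ge (m * k) (f ^ k)"
  by (induction k) (auto simp: order_ge_mult order_ge_def[of 0])

text \<open>The square of index pairs exceeds the triangle only by pairs with
  \<open>i + j > l\<close>, and their products have order above \<open>l\<close>.\<close>

lemma cauchy_product_cong:
  fixes a b :: "nat \<Rightarrow> 'a::semiring_0 fps"
  assumes "\<And>i. order_ge i (a i)" "\<And>i. order_ge i (b i)"
  shows "fps_cong l (\<Sum>k\<le>l. \<Sum>i\<le>k. a i * b (k - i)) ((\<Sum>i\<le>l. a i) * (\<Sum>i\<le>l. b i))"
proof -
  have "(\<Sum>k\<le>l. \<Sum>i\<le>k. a i * b (k - i)) = (\<Sum>i\<le>l. \<Sum>j\<le>l - i. a i * b j)"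
    unfolding sum.Sigma[OF finite_atMost ballI[OF finite_atMost]]
    by (rule sum.reindex_bij_witness[of _ "\<lambda>(k, j). (k + j, k)" "\<lambda>(m, k). (k, m - k)"]) auto
  also have "fps_cong l \<dots> (\<Sum>i\<le>l. \<Sum>j\<le>l. a i * b j)"
  proof (intro fps_cong_sum, unfold fps_cong_def, intro allI impI)
    fix i n assume "i \<in> {..l}" "n \<le> l"
    then have "(a i * b j) $ n = 0" if "j \<in> {..l} - {..l - i}" for j
      using that order_ge_mult[OF assms, of i j] by (auto simp: order_ge_def)
    then show "(\<Sum>j\<le>l - i. a i * b j) $ n = (\<Sum>j\<le>l. a i * b j) $ n"
      unfolding fps_sum_nth by (intro sum.mono_neutral_left) auto
  qed
  finally show ?thesis
    by (simp add: sum_product)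
qed

lemma of_nat_scl_cancel: "of_nat (Suc k) *\<^sub>q x = of_nat (Suc k) *\<^sub>q y \<longleftrightarrow> x = y"
proof
  assume "of_nat (Suc k) *\<^sub>q x = of_nat (Suc k) *\<^sub>q y"
  then have "(1 / of_nat (Suc k)) *\<^sub>q of_nat (Suc k) *\<^sub>q x = (1 / of_nat (Suc k)) *\<^sub>q of_nat (Suc k) *\<^sub>q y"
    by simp
  then show "x = y"
    by (simp add: scl_scl del: of_nat_Suc)
qed simp

definition dpow :: "'a::ratfun_algebra \<Rightarrow> nat \<Rightarrow> 'a" where
  "dpow z k = (1 / fact k) *\<^sub>q z ^ k"

lemma dpow_0 [simp]: "dpow z 0 = 1"
  by (simp add: dpow_def)

lemma mult_dpow: "z * dpow z k = of_nat (Suc k) *\<^sub>q dpow z (Suc k)"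
  by (simp add: dpow_def scl_mult del: of_nat_Suc)

text \<open>The homogeneous part of exp(z) w = (exp(ad z) w) exp(z). Multiplying by \<open>z\<close>
  and moving it past the \<open>i\<close>-th term \<open>a i\<close> gives
  \<open>(i + 1) a (i + 1) + a i z\<close>; in the resulting sums each product receives the weights
  \<open>i\<close> and \<open>k + 1 - i\<close>, which add up to \<open>k + 1\<close>.\<close>

lemma dpow_mult_ad:
  "dpow z k * w = (\<Sum>i\<le>k. ((1 / fact i) *\<^sub>q (ad z ^^ i) w) * dpow z (k - i))"
proof (induction k)
  case (Suc k)
  define a where "a = (\<lambda>i. (1 / fact i) *\<^sub>q (ad z ^^ i) w)"
  have za: "z * a i = of_nat (Suc i) *\<^sub>q a (Suc i) + a i * z" for i
    by (simp add: a_def scl_mult ad_def scl_diff_right del: of_nat_Suc)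
  have "of_nat (Suc k) *\<^sub>q (dpow z (Suc k) * w) = z * (\<Sum>i\<le>k. a i * dpow z (k - i))"
    using Suc.IH by (simp add: mult_dpow a_def flip: scl_mult_left mult.assoc)
      (metis mult.assoc mult_dpow of_nat_Suc)
  also have "\<dots> = (\<Sum>i\<le>k. of_nat (Suc i) *\<^sub>q (a (Suc i) * dpow z (k - i)))
      + (\<Sum>i\<le>k. of_nat (Suc k - i) *\<^sub>q (a i * dpow z (Suc k - i)))"
    unfolding sum_distrib_left mult.assoc[symmetric] za distrib_right sum.distrib
    unfolding mult.assoc mult_dpow
    by (auto simp: scl_mult Suc_diff_le simp del: of_nat_Suc intro!: sum.cong)
  also have "(\<Sum>i\<le>k. of_nat (Suc i) *\<^sub>q (a (Suc i) * dpow z (k - i)))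
      = (\<Sum>i\<le>Suc k. of_nat i *\<^sub>q (a i * dpow z (Suc k - i)))"
    by (subst sum.atMost_Suc_shift) simp
  also have "(\<Sum>i\<le>k. of_nat (Suc k - i) *\<^sub>q (a i * dpow z (Suc k - i)))
      = (\<Sum>i\<le>Suc k. of_nat (Suc k - i) *\<^sub>q (a i * dpow z (Suc k - i)))"
    by simp
  also have "(\<Sum>i\<le>Suc k. of_nat i *\<^sub>q (a i * dpow z (Suc k - i))) + \<dots>
      = of_nat (Suc k) *\<^sub>q (\<Sum>i\<le>Suc k. a i * dpow z (Suc k - i))"
    unfolding sum.distrib[symmetric] scl_add_left[symmetric] scl_sum_right
    by (intro sum.cong) (auto simp flip: of_nat_add simp del: of_nat_Suc)
  finally show ?case
    unfolding of_nat_scl_cancel a_def .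
qed simp

lemma deriv_scl: "fps_deriv (c *\<^sub>q f) = c *\<^sub>q fps_deriv f"
  by (simp add: fps_eq_iff scl_mult_right)

text \<open>The same scheme as for \<open>dpow_mult_ad\<close>, with factorials shifted by one: the
  product rule for \<open>z * dpow z (Suc k)\<close> supplies the term with \<open>i = 0\<close>,
  and the weights \<open>i + 1\<close> and \<open>k + 1 - i\<close> add up to
  \<open>k + 2\<close>.\<close>

lemma deriv_dpow:
  "fps_deriv (dpow z (Suc k)) = (\<Sum>i\<le>k. ((1 / fact (Suc i)) *\<^sub>q (ad z ^^ i) (fps_deriv z)) * dpow z (k - i))"
proof (induction k)
  case 0
  then show ?case by (simp add: dpow_def)
next
  case (Suc k)
  define a where "a = (\<lambda>i. (1 / fact (Suc i)) *\<^sub>q (ad z ^^ i) (fps_deriv z))"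
  have za: "z * a i = of_nat (Suc (Suc i)) *\<^sub>q a (Suc i) + a i * z" for i
    by (simp add: a_def scl_mult ad_def scl_diff_right fact_Suc[of "Suc _"] del: of_nat_Suc fact_Suc)
  have a0: "a 0 = fps_deriv z"
    by (simp add: a_def)
  have "of_nat (Suc (Suc k)) *\<^sub>q fps_deriv (dpow z (Suc (Suc k))) = fps_deriv (z * dpow z (Suc k))"
    by (simp add: mult_dpow deriv_scl del: fps_deriv_mult of_nat_Suc)
  also have "\<dots> = a 0 * dpow z (Suc k) + z * (\<Sum>i\<le>k. a i * dpow z (k - i))"
    using Suc.IH by (simp add: a_def)
  also have "z * (\<Sum>i\<le>k. a i * dpow z (k - i)) = (\<Sum>i\<le>k. of_nat (Suc (Suc i)) *\<^sub>q (a (Suc i) * dpow z (k - i)))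
      + (\<Sum>i\<le>k. of_nat (Suc k - i) *\<^sub>q (a i * dpow z (Suc k - i)))"
    unfolding sum_distrib_left mult.assoc[symmetric] za distrib_right sum.distrib
    unfolding mult.assoc mult_dpow
    by (auto simp: scl_mult Suc_diff_le simp del: of_nat_Suc intro!: sum.cong)
  also have "a 0 * dpow z (Suc k) + (\<dots>) = (\<Sum>i\<le>Suc k. of_nat (Suc i) *\<^sub>q (a i * dpow z (Suc k - i)))
      + (\<Sum>i\<le>k. of_nat (Suc k - i) *\<^sub>q (a i * dpow z (Suc k - i)))"
    by (subst sum.atMost_Suc_shift[of "\<lambda>i. of_nat (Suc i) *\<^sub>q (a i * dpow z (Suc k - i))"])
      (simp add: add.assoc)
  also have "(\<Sum>i\<le>k. of_nat (Suc k - i) *\<^sub>q (a i * dpow z (Suc k - i)))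
      = (\<Sum>i\<le>Suc k. of_nat (Suc k - i) *\<^sub>q (a i * dpow z (Suc k - i)))"
    by simp
  also have "(\<Sum>i\<le>Suc k. of_nat (Suc i) *\<^sub>q (a i * dpow z (Suc k - i))) + \<dots>
      = of_nat (Suc (Suc k)) *\<^sub>q (\<Sum>i\<le>Suc k. a i * dpow z (Suc k - i))"
    unfolding sum.distrib[symmetric] scl_add_left[symmetric] scl_sum_right
    by (intro sum.cong) (auto simp: of_nat_diff algebra_simps)
  finally show ?case
    unfolding of_nat_scl_cancel a_def .
qed

lemma order_ge_scl: "order_ge m f \<Longrightarrow> order_ge m (c *\<^sub>q f)"
  by (simp add: order_ge_def)

lemma order_ge_1_iff: "order_ge 1 f \<longleftrightarrow> f $ 0 = 0"
  by (simp add: order_ge_def)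

lemma order_ge_0 [simp]: "order_ge 0 f"
  by (simp add: order_ge_def)

lemma order_ge_dpow: "z $ 0 = 0 \<Longrightarrow> order_ge k (dpow z k)"
  using order_ge_power[of 1 z k] unfolding dpow_def order_ge_1_iff by (intro order_ge_scl) simp

lemma nexp_cong_finite: "z $ 0 = 0 \<Longrightarrow> l \<le> K \<Longrightarrow> fps_cong l (nexp z) (\<Sum>k\<le>K. dpow z k)"
  using ev_cong_finite[of z l K "fps_exp 1"] by (simp add: nexp_def dpow_def)

lemma nexp_mult_ad:
  assumes z: "z $ 0 = 0"
  shows "nexp z * w = act (ad z) (fps_exp 1) w * nexp z"
proof (rule fps_cong_all_eq)
  interpret raising "ad z" by (rule raising_ad) fact
  fix l
  let ?a = "\<lambda>i. (1 / fact i) *\<^sub>q (ad z ^^ i) w"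
  have "order_ge i (?a i)" for i
    using pow_raise[of 0 w i] by (simp add: order_ge_scl)
  note cauchy = cauchy_product_cong[OF this order_ge_dpow[OF z]]
  have "fps_cong l (nexp z * w) ((\<Sum>k\<le>l. dpow z k) * w)"
    by (intro fps_cong_mult nexp_cong_finite z) auto
  also have "\<dots> = (\<Sum>k\<le>l. \<Sum>i\<le>k. ?a i * dpow z (k - i))"
    by (simp add: sum_distrib_right dpow_mult_ad)
  also have "fps_cong l \<dots> ((\<Sum>i\<le>l. ?a i) * (\<Sum>i\<le>l. dpow z i))"
    by (rule cauchy)
  also have "fps_cong l \<dots> (act (ad z) (fps_exp 1) w * nexp z)"
    using act_cong_finite[of l l "fps_exp 1" w]
    by (intro fps_cong_mult fps_cong_sym[OF nexp_cong_finite] z) (auto intro: fps_cong_sym)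
  finally show "fps_cong l (nexp z * w) (act (ad z) (fps_exp 1) w * nexp z)" .
qed

lemma fps_cong_deriv: "fps_cong (Suc l) f g \<Longrightarrow> fps_cong l (fps_deriv f) (fps_deriv g)"
  by (simp add: fps_cong_def)

text \<open>The coefficients are those of (e^u - 1) / u. At u = \<open>ad z\<close> this series
  corrects the chain rule for the failure of \<open>z\<close> to commute with its
  derivative.\<close>

lemma nexp_deriv:
  assumes z: "z $ 0 = 0"
  shows "fps_deriv (nexp z) = act (ad z) (Abs_fps (\<lambda>i. 1 / fact (Suc i))) (fps_deriv z) * nexp z"
    (is "_ = act _ ?p _ * _")
proof (rule fps_cong_all_eq)
  interpret raising "ad z" by (rule raising_ad) fact
  fix l
  let ?a = "\<lambda>i. (1 / fact (Suc i)) *\<^sub>q (ad z ^^ i) (fps_deriv z)"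
  have "order_ge i (?a i)" for i
    using pow_raise[of 0 "fps_deriv z" i] by (simp add: order_ge_scl)
  note cauchy = cauchy_product_cong[OF this order_ge_dpow[OF z]]
  have "fps_cong l (fps_deriv (nexp z)) (fps_deriv (\<Sum>k\<le>Suc l. dpow z k))"
    by (intro fps_cong_deriv nexp_cong_finite z) auto
  also have "\<dots> = (\<Sum>k\<le>l. fps_deriv (dpow z (Suc k)))"
    by (subst sum.atMost_Suc_shift) (simp add: fps_deriv_sum)
  also have "\<dots> = (\<Sum>k\<le>l. \<Sum>i\<le>k. ?a i * dpow z (k - i))"
    by (simp add: deriv_dpow del: fact_Suc)
  also have "fps_cong l \<dots> ((\<Sum>i\<le>l. ?a i) * (\<Sum>i\<le>l. dpow z i))"
    by (rule cauchy)
  also have "fps_cong l \<dots> (act (ad z) ?p (fps_deriv z) * nexp z)"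
    using act_cong_finite[of l l ?p "fps_deriv z"]
    by (intro fps_cong_mult fps_cong_sym[OF nexp_cong_finite] z) (auto intro: fps_cong_sym simp del: fact_Suc)
  finally show "fps_cong l (fps_deriv (nexp z)) (act (ad z) ?p (fps_deriv z) * nexp z)" .
qed

section \<open>The Baker--Campbell--Hausdorff series in Dynkin's form\<close>

text \<open>The counterpart of \<open>nested\<close> for commutators in an associative ring; the
  embedding of the Lie algebra carries one to the other.\<close>

fun right_nested :: "'a::ring list \<Rightarrow> 'a" where
  "right_nested [] = 0"
| "right_nested [x] = x"
| "right_nested (x # y # ws) = ad x (right_nested (y # ws))"

lemma ad_zero_right [simp]: "ad x 0 = 0"
  by (simp add: ad_def)

lemma ad_self [simp]: "ad x x = 0"
  by (simp add: ad_def)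

lemma ad_funpow_zero [simp]: "(ad x ^^ k) 0 = 0"
  by (induction k) auto

lemma ad_scl: "ad x (c *\<^sub>q w) = c *\<^sub>q ad x w" for w :: "'a::ratfun_algebra"
  by (simp add: ad_def scl_mult scl_diff_right)

lemma ad_funpow_scl: "(ad x ^^ k) (c *\<^sub>q w) = c *\<^sub>q (ad x ^^ k) w" for w :: "'a::ratfun_algebra"
  by (induction k) (auto simp: ad_scl)

lemma ad_sum: "ad x (\<Sum>i\<in>I. f i) = (\<Sum>i\<in>I. ad x (f i))"
  by (simp add: ad_def sum_distrib_left sum_distrib_right sum_subtractf)

lemma ad_funpow_sum: "(ad x ^^ k) (\<Sum>i\<in>I. f i) = (\<Sum>i\<in>I. (ad x ^^ k) (f i))"
  by (induction k) (auto simp: ad_sum)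

lemma right_nested_replicate_append:
  "ws \<noteq> [] \<Longrightarrow> right_nested (replicate r x @ ws) = (ad x ^^ r) (right_nested ws)"
proof (induction r)
  case (Suc r)
  then obtain y us where "replicate r x @ ws = y # us"
    by (cases "replicate r x @ ws") auto
  with Suc show ?case by simp
qed simp

lemma right_nested_replicate:
  "right_nested (replicate (Suc s) y) = (if s = 0 then y else 0)"
proof -
  have "right_nested (replicate s y @ [y]) = (ad y ^^ s) y"
    by (subst right_nested_replicate_append) auto
  moreover have "(ad y ^^ Suc s) y = 0" for s
    by (induction s) auto
  ultimately show ?thesis
    by (cases s) (auto simp: replicate_append_same)
qed

text \<open>Words are sorted by their number of blocks, because the \<open>k\<close>-th power of
  exp(ad xt) exp(ad yt) - 1 prepends exactly \<open>k\<close> blocks.\<close>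

definition dynkin_index_len :: "nat \<Rightarrow> nat \<Rightarrow> (nat \<times> nat) list set" where
  "dynkin_index_len m k = {ps \<in> dynkin_index m. length ps = k}"

lemma finite_dynkin_index_len [simp]: "finite (dynkin_index_len m k)"
  by (simp add: dynkin_index_len_def finite_dynkin_index)

lemma dynkin_index_len_1:
  "dynkin_index_len (Suc n) (Suc 0) = (\<lambda>s. [(Suc n - s, s)]) ` {..Suc n}"
proof (intro equalityI subsetI)
  fix ps assume "ps \<in> dynkin_index_len (Suc n) (Suc 0)"
  then obtain r s where "ps = [(r, s)]" "r + s = Suc n"
    by (cases ps) (auto simp: dynkin_index_len_def dynkin_index_def)
  then show "ps \<in> (\<lambda>s. [(Suc n - s, s)]) ` {..Suc n}"
    by (intro image_eqI[of _ _ s]) auto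
qed (auto simp: dynkin_index_len_def dynkin_index_def)

definition block_index :: "nat \<Rightarrow> (nat \<times> nat) set" where
  "block_index n = {(r, s). 0 < r + s \<and> r + s \<le> n}"

lemma finite_block_index [simp]: "finite (block_index n)"
  by (rule finite_subset[of _ "{..n} \<times> {..n}"]) (auto simp: block_index_def)

text \<open>The part of \<open>dynkin_coeff\<close> that is multiplicative over the blocks. The
  remaining factors arise elsewhere: sign and number of blocks from the logarithm, the total degree
  from a differentiation.\<close>

definition block_coeff :: "(nat \<times> nat) list \<Rightarrow> ratfun" where
  "block_coeff ps = 1 / of_nat (\<Prod>(r, s)\<leftarrow>ps. fact r * fact s)"

lemma block_coeff_Cons: "block_coeff ((r, s) # ps) = (1 / fact r) * (1 / fact s) * block_coeff ps"
  by (simp add: block_coeff_def)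

lemma dynkin_index_pos: "ps \<in> dynkin_index m \<Longrightarrow> m > 0"
  by (cases ps) (auto simp: dynkin_index_def)

text \<open>Splits off the first block. What is left is nonempty and so has positive total degree,
  which is why the first block satisfies \<open>r + s \<le> n\<close> although the word has degree
  \<open>Suc n\<close>.\<close>

lemma sum_dynkin_index_len_Suc:
  fixes f :: "(nat \<times> nat) list \<Rightarrow> 'a::comm_monoid_add"
  shows "(\<Sum>ps\<in>dynkin_index_len (Suc n) (Suc (Suc k)). f ps) =
    (\<Sum>(r, s)\<in>block_index n. \<Sum>qs\<in>dynkin_index_len (Suc (n - r - s)) (Suc k). f ((r, s) # qs))"
proof -
  have "(\<Sum>(r, s)\<in>block_index n. \<Sum>qs\<in>dynkin_index_len (Suc (n - r - s)) (Suc k). f ((r, s) # qs)) =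
    (\<Sum>(p, qs)\<in>Sigma (block_index n) (\<lambda>p. dynkin_index_len (Suc (n - fst p - snd p)) (Suc k)). f (p # qs))"
    by (subst sum.Sigma[symmetric]) (auto simp: case_prod_beta)
  also have "\<dots> = (\<Sum>ps\<in>dynkin_index_len (Suc n) (Suc (Suc k)). f ps)"
  proof (rule sum.reindex_bij_witness[of _ "\<lambda>ps. (hd ps, tl ps)" "\<lambda>(p, qs). p # qs"], goal_cases)
    case (4 ps)
    then obtain r s qs where ps: "ps = (r, s) # qs"
      by (cases ps) (auto simp: dynkin_index_len_def)
    with 4 have "0 < r + s" "qs \<in> dynkin_index (Suc n - r - s)" "length qs = Suc k"
      by (auto simp: dynkin_index_len_def dynkin_index_def)
    moreover from this have "Suc n - r - s > 0"
      using dynkin_index_pos by blast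
    moreover from this have "Suc n - r - s = Suc (n - r - s)" by simp
    ultimately show ?case
      by (auto simp: ps block_index_def dynkin_index_len_def)
  qed (auto simp: dynkin_index_len_def dynkin_index_def block_index_def)
  finally show ?thesis ..
qed

lemma dynkin_word_Cons: "dynkin_word x y ((r, s) # ps) = replicate r x @ replicate s y @ dynkin_word x y ps"
  by (simp add: dynkin_word_def)

lemma dynkin_word_not_Nil: "ps \<in> dynkin_index m \<Longrightarrow> dynkin_word x y ps \<noteq> []"
  by (cases ps) (auto simp: dynkin_index_def dynkin_word_def)

lemma ad_var_funpow_nth:
  fixes x :: "'a::ring_1"
  shows "(ad (fps_const x * fps_X) ^^ r) w $ n = (if r \<le> n then (ad x ^^ r) (w $ (n - r)) else 0)"
proof (induction r arbitrary: n)
  case (Suc r)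
  have "ad (fps_const x * fps_X) v $ n = (if n = 0 then 0 else ad x (v $ (n - 1)))" for v n
    by (simp add: ad_def mult.assoc[of "fps_const x"] mult.assoc[of v, symmetric])
  then show ?case
    using Suc.IH[of "n - 1"] by auto
qed simp

lemma act_ad_var_exp_nth:
  fixes x :: "'a::ratfun_algebra"
  shows "act (ad (fps_const x * fps_X)) (fps_exp 1) w $ n =
    (\<Sum>r\<le>n. (1 / fact r) *\<^sub>q (ad x ^^ r) (w $ (n - r)))"
  by (simp add: act_def ad_var_funpow_nth)

text \<open>The operator \<open>exp (ad xt) exp (ad yt) - 1\<close>; its powers produce the blocks of the Dynkin words.\<close>

definition ad_exp_prod :: "'a::ratfun_algebra \<Rightarrow> 'a \<Rightarrow> 'a fps \<Rightarrow> 'a fps" where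
  "ad_exp_prod x y w = act (ad (fps_const x * fps_X)) (fps_exp 1)
     (act (ad (fps_const y * fps_X)) (fps_exp 1) w) - w"

text \<open>Subtracting the identity removes the pair (0, 0); this is the origin of the condition
  \<open>r + s > 0\<close> on the blocks.\<close>

lemma ad_exp_prod_nth:
  "ad_exp_prod x y w $ n = (\<Sum>(r, s)\<in>block_index n.
     ((1 / fact r) * (1 / fact s)) *\<^sub>q (ad x ^^ r) ((ad y ^^ s) (w $ (n - r - s))))"
proof -
  let ?f = "\<lambda>(r, s). ((1 / fact r) * (1 / fact s)) *\<^sub>q (ad x ^^ r) ((ad y ^^ s) (w $ (n - r - s)))"
  have "act (ad (fps_const x * fps_X)) (fps_exp 1) (act (ad (fps_const y * fps_X)) (fps_exp 1) w) $ n =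
      (\<Sum>r\<le>n. \<Sum>s\<le>n - r. ?f (r, s))"
    by (simp add: act_ad_var_exp_nth ad_funpow_sum ad_funpow_scl scl_sum_right scl_scl)
  also have "\<dots> = (\<Sum>p\<in>Sigma {..n} (\<lambda>r. {..n - r}). ?f p)"
    by (simp add: sum.Sigma)
  also have "Sigma {..n} (\<lambda>r. {..n - r}) = insert (0, 0) (block_index n)"
    by (auto simp: block_index_def)
  also have "sum ?f \<dots> = w $ n + sum ?f (block_index n)"
    by (subst sum.insert) (simp_all, simp add: block_index_def)
  finally show ?thesis
    by (simp add: ad_exp_prod_def)
qed

definition dynkin_start :: "'a::ratfun_algebra \<Rightarrow> 'a \<Rightarrow> 'a fps" where
  "dynkin_start x y = fps_const x + act (ad (fps_const x * fps_X)) (fps_exp 1) (fps_const y)"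

text \<open>A right-nested bracket that ends in two equal letters vanishes. So a single block of
  degree \<open>n + 1\<close> contributes only for \<open>s = 1\<close>, or for \<open>s = 0\<close>
  when \<open>n = 0\<close>.\<close>

lemma dynkin_start_nth:
  "dynkin_start x y $ n = (\<Sum>ps\<in>dynkin_index_len (Suc n) (Suc 0).
     block_coeff ps *\<^sub>q right_nested (dynkin_word x y ps))"
proof -
  let ?f = "\<lambda>ps. block_coeff ps *\<^sub>q right_nested (dynkin_word x y ps)"
  let ?g = "\<lambda>s. [(Suc n - s, s)]"
  have f0: "?f (?g 0) = (if n = 0 then x else 0)"
    using right_nested_replicate[of n x]
    by (cases n) (auto simp: dynkin_word_def block_coeff_def simp del: replicate_Suc)
  have f1: "?f (?g 1) = (1 / fact n) *\<^sub>q (ad x ^^ n) y"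
    by (simp add: dynkin_word_def block_coeff_def right_nested_replicate_append)
  have f2: "?f (?g (Suc (Suc s))) = 0" for s
    using right_nested_replicate[of "Suc s" y]
    by (simp add: dynkin_word_def right_nested_replicate_append del: replicate_Suc)
  have "(\<Sum>ps\<in>dynkin_index_len (Suc n) (Suc 0). ?f ps) = (\<Sum>s\<le>Suc n. ?f (?g s))"
    unfolding dynkin_index_len_1 by (subst sum.reindex) (auto simp: inj_on_def)
  also have "\<dots> = (\<Sum>s\<in>{0,1}. ?f (?g s))"
  proof (rule sum.mono_neutral_right)
    show "\<forall>s\<in>{..Suc n} - {0, 1}. ?f (?g s) = 0"
    proof
      fix s assume "s \<in> {..Suc n} - {0, 1}"
      then obtain s' where "s = Suc (Suc s')"
        by (cases s; cases "s - 1") auto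
      with f2 show "?f (?g s) = 0" by simp
    qed
  qed auto
  also have "\<dots> = ?f (?g 0) + ?f (?g 1)"
    by simp
  also have "\<dots> = (if n = 0 then x else 0) + (1 / fact n) *\<^sub>q (ad x ^^ n) y"
    unfolding f0 f1 ..
  also have "\<dots> = dynkin_start x y $ n"
  proof -
    have "(\<Sum>r\<le>n. (1 / fact r) *\<^sub>q (ad x ^^ r) (fps_const y $ (n - r))) =
        (\<Sum>r\<le>n. if r = n then (1 / fact n) *\<^sub>q (ad x ^^ n) y else 0)"
      by (intro sum.cong) auto
    then show ?thesis
      by (simp add: dynkin_start_def act_ad_var_exp_nth)
  qed
  finally show ?thesis ..
qed

lemma ad_exp_prod_funpow_nth:
  "(ad_exp_prod x y ^^ k) (dynkin_start x y) $ n = (\<Sum>ps\<in>dynkin_index_len (Suc n) (Suc k).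
     block_coeff ps *\<^sub>q right_nested (dynkin_word x y ps))"
proof (induction k arbitrary: n)
  case 0
  then show ?case by (simp add: dynkin_start_nth)
next
  case (Suc k)
  have "((1 / fact r) * (1 / fact s)) *\<^sub>q (ad x ^^ r) ((ad y ^^ s) (\<Sum>qs\<in>dynkin_index_len (Suc (n - r - s)) (Suc k).
     block_coeff qs *\<^sub>q right_nested (dynkin_word x y qs))) =
    (\<Sum>qs\<in>dynkin_index_len (Suc (n - r - s)) (Suc k).
     block_coeff ((r, s) # qs) *\<^sub>q right_nested (dynkin_word x y ((r, s) # qs)))" for r s
    unfolding ad_funpow_sum scl_sum_right
  proof (intro sum.cong refl)
    fix qs assume "qs \<in> dynkin_index_len (Suc (n - r - s)) (Suc k)"
    then have "dynkin_word x y qs \<noteq> []"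
      by (auto simp: dynkin_index_len_def dynkin_word_not_Nil)
    then show "(1 / fact r * (1 / fact s)) *\<^sub>q (ad x ^^ r) ((ad y ^^ s) (block_coeff qs *\<^sub>q right_nested (dynkin_word x y qs))) =
      block_coeff ((r, s) # qs) *\<^sub>q right_nested (dynkin_word x y ((r, s) # qs))"
      by (simp add: dynkin_word_Cons right_nested_replicate_append ad_funpow_scl scl_scl block_coeff_Cons)
  qed
  then show ?case
    by (simp add: ad_exp_prod_nth Suc.IH sum_dynkin_index_len_Suc)
qed

lemma act_null: "T w = 0 \<Longrightarrow> (\<And>k. (T ^^ k) 0 = 0) \<Longrightarrow> act T p w = p $ 0 *\<^sub>q w"
proof (rule fps_ext)
  fix n assume T: "T w = 0" "\<And>k. (T ^^ k) 0 = 0"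
  have "(T ^^ k) w = 0" if "k > 0" for k
    using that T by (cases k) (auto simp: funpow_swap1 simp del: funpow.simps simp: funpow_Suc_right)
  then have "(\<Sum>k\<le>n. p $ k *\<^sub>q (T ^^ k) w $ n) = (\<Sum>k\<le>n. if k = 0 then p $ 0 *\<^sub>q w $ n else 0)"
    by (intro sum.cong) auto
  then show "act T p w $ n = (p $ 0 *\<^sub>q w) $ n"
    by (simp add: act_def)
qed

lemma deriv_nexp_var:
  fixes x :: "'a::ratfun_algebra"
  shows "fps_deriv (nexp (fps_const x * fps_X)) = fps_const x * nexp (fps_const x * fps_X)"
proof -
  have "ad (fps_const x * fps_X) (fps_const x) = 0"
    by (simp add: ad_def mult.assoc fps_mult_fps_X_commute)
  then show ?thesis
    by (subst nexp_deriv) (simp_all add: act_null)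
qed

text \<open>The formal variable records the word length, so each coefficient is a finite sum
  whatever \<open>x\<close> and \<open>y\<close> are.\<close>

definition dynkin_series :: "'a::ratfun_algebra \<Rightarrow> 'a \<Rightarrow> 'a fps" where
  "dynkin_series x y = Abs_fps (\<lambda>m. \<Sum>ps\<in>dynkin_index m. dynkin_coeff ps *\<^sub>q right_nested (dynkin_word x y ps))"

lemma dynkin_index_0: "dynkin_index 0 = {}"
  using dynkin_index_pos by blast

lemma dynkin_index_length:
  assumes "ps \<in> dynkin_index m"
  shows "0 < length ps" "length ps \<le> m"
proof -
  show "0 < length ps" using assms by (auto simp: dynkin_index_def)
  have "(\<forall>(r, s) \<in> set ps. r + s > 0) \<Longrightarrow> length ps \<le> (\<Sum>(r, s)\<leftarrow>ps. r + s)"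
    by (induction ps) (auto simp: Suc_le_eq intro: add_less_le_mono)
  with assms show "length ps \<le> m"
    by (auto simp: dynkin_index_def)
qed

text \<open>
  With \<open>e\<^sup>Z = e\<^sup>x\<^sup>t e\<^sup>y\<^sup>t\<close> one has \<open>f (ad Z) Z' = (e\<^sup>Z)' e\<^sup>-\<^sup>Z = x + exp (ad xt) y\<close> for \<open>f u = (e\<^sup>u - 1) / u\<close>.
  As \<open>1 / f u = \<Sum>\<^sub>k (-1)\<^sup>k / (k + 1) (e\<^sup>u - 1)\<^sup>k\<close> and \<open>exp (ad Z) = exp (ad xt) exp (ad yt)\<close>, solving for \<open>Z'\<close> gives
  Dynkin's form of the Baker--Campbell--Hausdorff series.
\<close>

theorem nexp_dynkin_series:
  fixes x y :: "'a::ratfun_algebra"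
  shows "nexp (dynkin_series x y) = nexp (fps_const x * fps_X) * nexp (fps_const y * fps_X)"
proof -
  define X Y where "X = fps_const x * fps_X" and "Y = fps_const y * fps_X"
  have X0: "X $ 0 = 0" and Y0: "Y $ 0 = 0"
    by (simp_all add: X_def Y_def)
  obtain Z where Z0: "Z $ 0 = 0" and Z: "nexp Z = nexp X * nexp Y"
    using nexp_surj[of "nexp X * nexp Y"] by (auto simp: fps_mult_nth_0)
  interpret raising "ad Z" by (rule raising_ad) fact
  let ?f = "Abs_fps (\<lambda>i. 1 / fact (Suc i)) :: ratfun fps"
  let ?l = "Abs_fps (\<lambda>k. (- 1) ^ k / of_nat (Suc k)) :: ratfun fps"
  let ?E = "fps_exp 1 - 1 :: ratfun fps"
  have cancel: "v = w" if "v * nexp Z = w * nexp Z" for v w :: "'a fps"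
  proof -
    from that have "v * (nexp Z * nexp (- Z)) = w * (nexp Z * nexp (- Z))"
      by (simp only: mult.assoc[symmetric])
    with Z0 show ?thesis by simp
  qed
  have "act (ad Z) ?f (fps_deriv Z) * nexp Z = fps_deriv (nexp X * nexp Y)"
    using nexp_deriv[OF Z0] by (simp only: Z)
  also have "\<dots> = nexp X * fps_const y * nexp Y + fps_const x * nexp Z"
    by (simp add: X_def Y_def deriv_nexp_var mult.assoc Z)
  also have "\<dots> = dynkin_start x y * nexp Z"
    using nexp_mult_ad[OF X0, of "fps_const y"]
    by (simp add: dynkin_start_def distrib_right X_def[symmetric] Z mult.assoc)
  finally have V: "act (ad Z) ?f (fps_deriv Z) = dynkin_start x y"
    by (rule cancel)
  have N: "act (ad Z) ?E = ad_exp_prod x y"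
  proof
    fix w
    have "act (ad Z) (fps_exp 1) w * nexp Z = nexp X * (nexp Y * w)"
      using nexp_mult_ad[OF Z0, of w] by (simp add: Z mult.assoc)
    also have "\<dots> = act (ad X) (fps_exp 1) (act (ad Y) (fps_exp 1) w) * nexp Z"
      using nexp_mult_ad[OF Y0, of w] nexp_mult_ad[OF X0, of "act (ad Y) (fps_exp 1) w"]
      by (simp add: Z flip: mult.assoc)
    finally have "act (ad Z) (fps_exp 1) w = act (ad X) (fps_exp 1) (act (ad Y) (fps_exp 1) w)"
      by (rule cancel)
    then show "act (ad Z) ?E w = ad_exp_prod x y w"
      by (simp add: act_diff_left ad_exp_prod_def X_def Y_def)
  qed
  have E0: "?E $ 0 = 0" by simp
  have f: "?E = fps_X * ?f"
    by (auto simp: fps_eq_iff simp del: fact_Suc of_nat_Suc)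
  have l: "fps_ln 1 = fps_X * ?l"
    by (auto simp: fps_eq_iff fps_ln_nth simp del: fact_Suc of_nat_Suc)
  have "fps_X * (?f * (?l oo ?E)) = ?E * (?l oo ?E)"
    using f by (simp add: mult.assoc)
  also have "\<dots> = (fps_X * ?l) oo ?E"
    using fps_compose_mult_distrib[OF E0, of fps_X ?l] by simp
  also have "\<dots> = fps_X"
    unfolding l[symmetric] by (rule fps_ln_compose_exp)
  finally have fl: "(?l oo ?E) * ?f = 1"
    by (simp add: mult.commute)
  have "fps_deriv Z = act (ad Z) ((?l oo ?E) * ?f) (fps_deriv Z)"
    unfolding fl by simp
  also have "\<dots> = act (ad_exp_prod x y) ?l (dynkin_start x y)"
    unfolding act_mult V by (subst act_compose[symmetric]) (simp_all add: N)
  finally have DZ: "fps_deriv Z = act (ad_exp_prod x y) ?l (dynkin_start x y)" .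
  have "Z = dynkin_series x y"
  proof (rule fps_ext)
    fix m
    show "Z $ m = dynkin_series x y $ m"
    proof (cases m)
      case 0
      then show ?thesis by (simp add: Z0 dynkin_series_def dynkin_index_0)
    next
      case (Suc n)
      let ?g = "\<lambda>ps. block_coeff ps *\<^sub>q right_nested (dynkin_word x y ps)"
      \<comment> \<open>The factor produced by the derivative is the total degree in the denominator
        of \<open>dynkin_coeff\<close>.\<close>
      have "of_nat (Suc n) *\<^sub>q Z $ Suc n = fps_deriv Z $ n"
        by (simp add: scl_of_nat del: of_nat_Suc)
      also have "\<dots> = (\<Sum>k\<le>n. \<Sum>ps\<in>dynkin_index_len (Suc n) (Suc k). ((- 1) ^ k / of_nat (Suc k)) *\<^sub>q ?g ps)"
        unfolding DZ by (simp add: act_def ad_exp_prod_funpow_nth scl_sum_right del: of_nat_Suc)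
      also have "\<dots> = (\<Sum>k\<le>n. \<Sum>ps\<in>dynkin_index_len (Suc n) (Suc k). ((- 1) ^ (length ps - 1) / of_nat (length ps)) *\<^sub>q ?g ps)"
        by (intro sum.cong) (auto simp: dynkin_index_len_def)
      also have "\<dots> = (\<Sum>ps\<in>(\<Union>k\<le>n. dynkin_index_len (Suc n) (Suc k)). ((- 1) ^ (length ps - 1) / of_nat (length ps)) *\<^sub>q ?g ps)"
        by (subst sum.UNION_disjoint) (auto simp: dynkin_index_len_def finite_dynkin_index)
      also have "(\<Union>k\<le>n. dynkin_index_len (Suc n) (Suc k)) = dynkin_index (Suc n)"
      proof (intro equalityI subsetI)
        fix ps assume "ps \<in> dynkin_index (Suc n)"
        with dynkin_index_length[OF this] show "ps \<in> (\<Union>k\<le>n. dynkin_index_len (Suc n) (Suc k))"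
          by (intro UN_I[of "length ps - 1"]) (auto simp: dynkin_index_len_def)
      qed (auto simp: dynkin_index_len_def)
      also have "(\<Sum>ps\<in>dynkin_index (Suc n). ((- 1) ^ (length ps - 1) / of_nat (length ps)) *\<^sub>q ?g ps)
        = of_nat (Suc n) *\<^sub>q dynkin_series x y $ Suc n"
        unfolding dynkin_series_def fps_nth_Abs_fps scl_sum_right
      proof (intro sum.cong refl)
        fix ps assume "ps \<in> dynkin_index (Suc n)"
        then have "(\<Sum>(r, s)\<leftarrow>ps. r + s) = Suc n"
          by (simp add: dynkin_index_def)
        then show "((- 1) ^ (length ps - 1) / of_nat (length ps)) *\<^sub>q ?g ps =
            of_nat (Suc n) *\<^sub>q dynkin_coeff ps *\<^sub>q right_nested (dynkin_word x y ps)"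
          by (simp add: dynkin_coeff_def block_coeff_def scl_scl del: of_nat_Suc mult_Suc)
      qed
      finally show ?thesis
        unfolding of_nat_scl_cancel Suc .
    qed
  qed
  with Z show ?thesis by (simp add: X_def Y_def)
qed

text \<open>
  For adapted series the outer variable can be set to \<open>1\<close>: only the terms with \<open>m \<le> n\<close>
  contribute to the \<open>n\<close>-th coefficient.
\<close>

definition adapted :: "'a::zero fps fps \<Rightarrow> bool" where
  "adapted F \<longleftrightarrow> (\<forall>m. order_ge m (F $ m))"

definition sum_at_1 :: "'a::comm_monoid_add fps fps \<Rightarrow> 'a fps" where
  "sum_at_1 F = Abs_fps (\<lambda>n. \<Sum>m\<le>n. F $ m $ n)"

lemma adaptedD: "adapted F \<Longrightarrow> order_ge m (F $ m)"
  by (simp add: adapted_def)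

lemma order_ge_sum: "(\<And>i. i \<in> I \<Longrightarrow> order_ge m (f i)) \<Longrightarrow> order_ge m (\<Sum>i\<in>I. f i)"
  for f :: "'b \<Rightarrow> 'a::comm_monoid_add fps"
  by (simp add: order_ge_def fps_sum_nth)

lemma order_ge_diff: "order_ge m f \<Longrightarrow> order_ge m g \<Longrightarrow> order_ge m (f - g)"
  for f :: "'a::group_add fps"
  by (simp add: order_ge_def)

lemma sum_at_1_cong_finite:
  assumes "adapted F"
  shows "fps_cong l (sum_at_1 F) (\<Sum>m\<le>l. F $ m)"
  unfolding fps_cong_def
proof (intro allI impI)
  fix n assume "n \<le> l"
  with assms show "sum_at_1 F $ n = (\<Sum>m\<le>l. F $ m) $ n"
    unfolding sum_at_1_def fps_sum_nth fps_nth_Abs_fps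
    by (intro sum.mono_neutral_left) (auto simp: adapted_def order_ge_def)
qed

lemma adapted_mult:
  fixes F G :: "'a::semiring_0 fps fps"
  assumes "adapted F" "adapted G"
  shows "adapted (F * G)"
  unfolding adapted_def fps_mult_nth
proof (intro allI order_ge_sum)
  fix m i :: nat assume "i \<in> {0..m}"
  then show "order_ge m (F $ i * G $ (m - i))"
    using order_ge_mult[OF adaptedD[OF assms(1), of i] adaptedD[OF assms(2), of "m - i"]] by simp
qed

lemma adapted_1 [simp]: "adapted (1 :: 'a::semiring_1 fps fps)"
  by (auto simp: adapted_def order_ge_def)

lemma adapted_power: "adapted F \<Longrightarrow> adapted (F ^ k)" for F :: "'a::semiring_1 fps fps"
  by (induction k) (auto simp: adapted_mult)

lemma adapted_ev: "adapted F \<Longrightarrow> adapted (ev p F)"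
  unfolding ev_def adapted_def fps_nth_Abs_fps
  by (intro allI order_ge_sum order_ge_scl adaptedD adapted_power) (simp add: adapted_def)

lemma sum_at_1_mult:
  fixes F G :: "'a::semiring_0 fps fps"
  assumes "adapted F" "adapted G"
  shows "sum_at_1 (F * G) = sum_at_1 F * sum_at_1 G"
proof (rule fps_cong_all_eq)
  fix l
  have "fps_cong l (sum_at_1 (F * G)) (\<Sum>m\<le>l. (F * G) $ m)"
    by (intro sum_at_1_cong_finite adapted_mult assms)
  also have "\<dots> = (\<Sum>m\<le>l. \<Sum>i\<le>m. F $ i * G $ (m - i))"
    by (simp add: fps_mult_nth atLeast0AtMost)
  also have "fps_cong l \<dots> ((\<Sum>m\<le>l. F $ m) * (\<Sum>m\<le>l. G $ m))"
    by (intro cauchy_product_cong adaptedD assms)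
  also have "fps_cong l \<dots> (sum_at_1 F * sum_at_1 G)"
    by (intro fps_cong_mult fps_cong_sym[OF sum_at_1_cong_finite] assms)
  finally show "fps_cong l (sum_at_1 (F * G)) (sum_at_1 F * sum_at_1 G)" .
qed

lemma sum_at_1_one: "sum_at_1 (1 :: 'a::semiring_1 fps fps) = 1"
proof (rule fps_ext)
  fix n
  have "(\<Sum>m\<le>n. (1 :: 'a fps fps) $ m $ n) = (\<Sum>m\<le>n. if m = 0 then (1 :: 'a fps) $ n else 0)"
    by (intro sum.cong) auto
  then show "sum_at_1 (1 :: 'a fps fps) $ n = 1 $ n"
    by (simp add: sum_at_1_def)
qed

lemma sum_at_1_power: "adapted F \<Longrightarrow> sum_at_1 (F ^ k) = sum_at_1 F ^ k" for F :: "'a::semiring_1 fps fps"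
  by (induction k) (auto simp: sum_at_1_mult adapted_power sum_at_1_one)

text \<open>Setting the variable to 1 is multiplicative on adapted series, hence commutes with
  powers. Since \<open>Z ^ k\<close> has no coefficients below \<open>k\<close>, the sums over
  \<open>k\<close> and \<open>m\<close> share a finite square and may be exchanged.\<close>

lemma sum_at_1_ev:
  fixes Z :: "'a::ratfun_algebra fps fps"
  assumes "adapted Z" "Z $ 0 = 0"
  shows "sum_at_1 (ev p Z) = ev p (sum_at_1 Z)"
proof (rule fps_ext)
  fix n
  have Zk: "(Z ^ k) $ m = 0" if "m < k" for k m
    using order_ge_power[of 1 Z k] that assms(2) by (simp add: order_ge_def)
  have "sum_at_1 (ev p Z) $ n = (\<Sum>m\<le>n. \<Sum>k\<le>m. p $ k *\<^sub>q (Z ^ k) $ m $ n)"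
    by (simp add: sum_at_1_def ev_def fps_sum_nth)
  also have "\<dots> = (\<Sum>m\<le>n. \<Sum>k\<le>n. p $ k *\<^sub>q (Z ^ k) $ m $ n)"
    by (intro sum.cong sum.mono_neutral_left) (auto simp: Zk)
  also have "\<dots> = (\<Sum>k\<le>n. \<Sum>m\<le>n. p $ k *\<^sub>q (Z ^ k) $ m $ n)"
    by (rule sum.swap)
  also have "\<dots> = (\<Sum>k\<le>n. p $ k *\<^sub>q sum_at_1 (Z ^ k) $ n)"
    by (simp add: sum_at_1_def scl_sum_right)
  also have "\<dots> = ev p (sum_at_1 Z) $ n"
    by (simp add: sum_at_1_power assms ev_def)
  finally show "sum_at_1 (ev p Z) $ n = ev p (sum_at_1 Z) $ n" .
qed

lemma order_ge_ad:
  fixes f g :: "'a::ring fps"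
  shows "order_ge m f \<Longrightarrow> order_ge n g \<Longrightarrow> order_ge (m + n) (ad f g)"
  using order_ge_mult[of m f n g] order_ge_mult[of n g m f]
  by (auto simp: ad_def add.commute intro: order_ge_diff)

lemma order_ge_right_nested:
  fixes ws :: "'a::ring fps list"
  shows "(\<And>w. w \<in> set ws \<Longrightarrow> order_ge 1 w) \<Longrightarrow> order_ge (length ws) (right_nested ws)"
proof (induction ws rule: right_nested.induct)
  case (3 x y ws)
  then show ?case using order_ge_ad[of 1 x "length (y # ws)"] by simp
qed simp_all

lemma length_dynkin_word: "length (dynkin_word x y ps) = (\<Sum>(r, s)\<leftarrow>ps. r + s)"
  by (induction ps) (auto simp: dynkin_word_def)

lemma set_dynkin_word: "set (dynkin_word x y ps) \<subseteq> {x, y}"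
proof (induction ps)
  case (Cons p ps)
  then show ?case
    by (cases p) (simp add: dynkin_word_Cons set_replicate_conv_if)
qed (simp add: dynkin_word_def)

lemma adapted_dynkin_series:
  fixes x y :: "'a::ratfun_algebra fps"
  assumes "x $ 0 = 0" "y $ 0 = 0"
  shows "adapted (dynkin_series x y)"
  unfolding adapted_def dynkin_series_def fps_nth_Abs_fps
proof (intro allI order_ge_sum order_ge_scl)
  fix m ps assume "ps \<in> dynkin_index m"
  then have "length (dynkin_word x y ps) = m"
    by (simp add: length_dynkin_word dynkin_index_def)
  then show "order_ge m (right_nested (dynkin_word x y ps))"
    using order_ge_right_nested[of "dynkin_word x y ps"] set_dynkin_word[of x y ps] assms
    unfolding order_ge_1_iff by blast
qed

text \<open>\<open>nexp_dynkin_series\<close> is applied over the algebra of power series, with an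
  outer variable that keeps word lengths apart. Brackets of \<open>m\<close> series without constant
  term have order at least \<open>m\<close>, so this variable can afterwards be set to 1.\<close>

theorem nexp_sum_dynkin_series:
  fixes x y :: "'a::ratfun_algebra fps"
  assumes "x $ 0 = 0" "y $ 0 = 0"
  shows "nexp (sum_at_1 (dynkin_series x y)) = nexp x * nexp y"
proof -
  have ad: "adapted (fps_const z * fps_X)" if "z $ 0 = 0" for z :: "'a fps"
    using that by (auto simp: adapted_def order_ge_def le_Suc_eq)
  have sum: "sum_at_1 (fps_const z * fps_X) = z" if "z $ 0 = 0" for z :: "'a fps"
  proof (rule fps_ext)
    fix n
    have "(\<Sum>m\<le>n. (fps_const z * fps_X) $ m $ n) = (\<Sum>m\<le>n. if m = 1 then z $ n else 0)"
      by (intro sum.cong) auto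
    then show "sum_at_1 (fps_const z * fps_X) $ n = z $ n"
      using that by (cases n) (auto simp: sum_at_1_def)
  qed
  have "dynkin_series x y $ 0 = 0"
    by (simp add: dynkin_series_def dynkin_index_0)
  then have "nexp (sum_at_1 (dynkin_series x y)) = sum_at_1 (nexp (dynkin_series x y))"
    by (simp add: nexp_def sum_at_1_ev adapted_dynkin_series assms)
  also have "\<dots> = sum_at_1 (nexp (fps_const x * fps_X)) * sum_at_1 (nexp (fps_const y * fps_X))"
    unfolding nexp_dynkin_series
    by (intro sum_at_1_mult) (simp_all add: nexp_def adapted_ev ad assms)
  also have "\<dots> = nexp x * nexp y"
    by (simp add: nexp_def sum_at_1_ev ad sum assms)
  finally show ?thesis .
qed

section \<open>The algebra of linear operators on scalar functions\<close>

typedef 'i linop = "{F :: ('i \<Rightarrow> ratfun) \<Rightarrow> 'i \<Rightarrow> ratfun.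
    (\<forall>f g. F (\<lambda>i. f i + g i) = (\<lambda>i. F f i + F g i)) \<and> (\<forall>c f. F (\<lambda>i. c * f i) = (\<lambda>i. c * F f i))}"
  by (rule exI[of _ "\<lambda>_ _. 0"]) auto

setup_lifting type_definition_linop

instantiation linop :: (type) ratfun_algebra
begin

lift_definition zero_linop :: "'a linop" is "\<lambda>_ _. 0" by auto
lift_definition one_linop :: "'a linop" is "\<lambda>f. f" by auto
lift_definition plus_linop :: "'a linop \<Rightarrow> 'a linop \<Rightarrow> 'a linop" is "\<lambda>F G f i. F f i + G f i"
  by (auto simp: algebra_simps)
lift_definition minus_linop :: "'a linop \<Rightarrow> 'a linop \<Rightarrow> 'a linop" is "\<lambda>F G f i. F f i - G f i"
  by (auto simp: algebra_simps)
lift_definition uminus_linop :: "'a linop \<Rightarrow> 'a linop" is "\<lambda>F f i. - F f i"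
  by (auto simp: algebra_simps)
lift_definition times_linop :: "'a linop \<Rightarrow> 'a linop \<Rightarrow> 'a linop" is "\<lambda>F G f. F (G f)"
  by auto
definition scl_linop :: "ratfun \<Rightarrow> 'a linop \<Rightarrow> 'a linop" where
  "scl_linop c F = Abs_linop (\<lambda>f i. c * Rep_linop F f i)"

lemma Rep_linop_scl: "Rep_linop (c *\<^sub>q F) = (\<lambda>f i. c * Rep_linop F f i)"
  unfolding scl_linop_def using Rep_linop[of F]
  by (subst Abs_linop_inverse) (auto simp: algebra_simps)

lemma Rep_linop_add: "Rep_linop F (\<lambda>i. f i + g i) = (\<lambda>i. Rep_linop F f i + Rep_linop F g i)"
  using Rep_linop[of F] by auto

lemma Rep_linop_mult: "Rep_linop F (\<lambda>i. c * f i) = (\<lambda>i. c * Rep_linop F f i)"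
  using Rep_linop[of F] by auto

lemmas Rep_linop_simps = zero_linop.rep_eq one_linop.rep_eq plus_linop.rep_eq minus_linop.rep_eq
  uminus_linop.rep_eq times_linop.rep_eq Rep_linop_scl

lemma linop_eqI: "(\<And>f i. Rep_linop F f i = Rep_linop G f i) \<Longrightarrow> F = G"
  by (simp add: fun_eq_iff flip: Rep_linop_inject)

instance
proof
  have "Rep_linop 0 (\<lambda>_. 1) \<noteq> Rep_linop 1 (\<lambda>_ :: 'a. 1)"
    by (simp add: Rep_linop_simps fun_eq_iff)
  then show "(0 :: 'a linop) \<noteq> 1" by metis
qed (rule linop_eqI; simp add: Rep_linop_simps Rep_linop_add Rep_linop_mult algebra_simps; fail)+

end

section \<open>The group as a group of power series over the quantum torus\<close>

lemma fps_cong_power: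
  fixes f g :: "'a::semiring_1 fps"
  shows "fps_cong l f g \<Longrightarrow> fps_cong l (f ^ k) (g ^ k)"
  by (induction k) (auto intro: fps_cong_mult)

lemma ev_cong:
  assumes "fps_cong l z z'"
  shows "fps_cong l (ev p z) (ev p z')"
  using fps_cong_power[OF assms] unfolding fps_cong_def ev_def by simp

text \<open>\<open>ev\<close> respects congruences, and the logarithm, which is itself an
  \<open>ev\<close>, undoes \<open>nexp\<close>.\<close>

lemma nexp_cong_iff:
  assumes "z $ 0 = 0" "z' $ 0 = 0"
  shows "fps_cong l (nexp z) (nexp z') \<longleftrightarrow> fps_cong l z z'"
proof
  assume "fps_cong l (nexp z) (nexp z')"
  then have "fps_cong l (ev (fps_ln 1) (nexp z - 1)) (ev (fps_ln 1) (nexp z' - 1))"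
    by (intro ev_cong fps_cong_diff) auto
  then show "fps_cong l z z'"
    by (simp add: ev_ln_nexp assms)
qed (simp add: nexp_def ev_cong)

lemma tvar_nonzero [simp]: "tvar \<noteq> 0"
  by (simp add: tvar_def eq_fract Zero_fract_def)

lemma tvar_power: "tvar ^ k = Fract (monom 1 k) 1"
  by (induction k) (auto simp: tvar_def One_fract_def monom_altdef one_pCons)

lemma tvar_power_eq_1_iff: "tvar ^ k = 1 \<longleftrightarrow> k = 0"
proof
  assume "tvar ^ k = 1"
  then have "monom (1::rat) k = 1"
    by (simp add: tvar_power One_fract_def eq_fract)
  then show "k = 0"
    using degree_monom_eq[of "1::rat" k] by simp
qed simp

lemma tvar_powi_eq_1_iff: "tvar powi k = 1 \<longleftrightarrow> k = 0"
  by (auto simp: power_int_def tvar_power_eq_1_iff power_inverse split: if_splits)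

lemma tvar_powi_inj: "tvar powi j = tvar powi k \<longleftrightarrow> j = k"
  using tvar_powi_eq_1_iff[of "j - k"] by (auto simp: power_int_diff)

context fixed_data
begin

text \<open>The form measured in exponents of \<open>tvar\<close>, which stands for the root of q of
  order \<open>delta0 d\<close>.\<close>

definition omega :: "int ^ 'r \<Rightarrow> int ^ 'r \<Rightarrow> int" where
  "omega m n = \<lfloor>of_nat (delta0 d) * B m n\<rfloor>"

lemma delta0_pos: "delta0 d > 0"
proof -
  have "0 \<notin> range d" using d_pos by (metis less_irrefl rangeE)
  then show ?thesis unfolding delta0_def by (metis Lcm_0_iff finite finite_imageI gr0I)
qed

lemma B_zero_left: "B 0 y = 0"
  using add_left[of 0 0 y] by simp

lemma B_scale_left: "B (int k *s x) y = of_nat k * B x y"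
proof (induction k)
  case (Suc k)
  have "int (Suc k) *s x = x + int k *s x"
    by (simp add: vec_eq_iff algebra_simps)
  with Suc show ?case
    by (simp add: add_left algebra_simps)
qed (simp add: B_zero_left)

text \<open>Every \<open>d i\<close> divides \<open>delta0 d\<close>, so \<open>delta0 d\<close>
  times any vector lies in the sublattice, on which the form is integral.\<close>

lemma B_integral: "of_nat (delta0 d) * B x y \<in> \<int>"
proof -
  have dvd: "d i dvd delta0 d" for i
    by (simp add: delta0_def)
  define a where "a i = int (delta0 d div d i) * vec_nth x i" for i
  have "int (delta0 d) *s x = (\<Sum>i\<in>UNIV. (a i * int (d i)) *s axis i 1)"
  proof (simp add: vec_eq_iff, intro allI)
    fix j
    have "(\<Sum>i\<in>UNIV. a i * int (d i) * vec_nth (axis i 1) j) = (\<Sum>i\<in>UNIV. if i = j then a i * int (d i) else 0)"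
      by (intro sum.cong) (auto simp: axis_def)
    also have "\<dots> = int (delta0 d) * vec_nth x j"
      using dvd[of j] by (simp add: a_def algebra_simps flip: of_nat_mult)
    finally show "int (delta0 d) * vec_nth x j = (\<Sum>i\<in>UNIV. a i * int (d i) * vec_nth (axis i 1) j)"
      by simp
  qed
  then have "int (delta0 d) *s x \<in> sublattice d"
    unfolding sublattice_def by blast
  from integral[OF this] show ?thesis
    by (simp add: B_scale_left)
qed

lemma of_int_omega: "of_int (omega m n) = of_nat (delta0 d) * B m n"
  using B_integral[of m n] unfolding omega_def by (metis Ints_cases floor_of_int)

lemma omega_add_left: "omega (m + m') n = omega m n + omega m' n"
proof -
  have "(of_int (omega (m + m') n) :: rat) = of_int (omega m n + omega m' n)"
    by (simp add: of_int_omega add_left algebra_simps)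
  then show ?thesis by (simp only: of_int_eq_iff)
qed

lemma omega_skew: "omega m n = - omega n m"
proof -
  have "(of_int (omega m n) :: rat) = of_int (- omega n m)"
    using skew[of m n] by (simp add: of_int_omega)
  then show ?thesis by (simp only: of_int_eq_iff)
qed

lemma omega_add_right: "omega m (n + n') = omega m n + omega m n'"
  using omega_add_left[of n n' m] omega_skew by (metis minus_add_distrib)

lemma omega_self [simp]: "omega m m = 0"
  using omega_skew[of m m] by simp

lemma omega_minus_right: "omega m (n - n') = omega m n - omega m n'"
  using omega_add_right[of m "n - n'" n'] by simp

text \<open>
  The quantum torus is realised by operators on functions on the lattice, because a type for it
  cannot depend on \<open>B\<close> and \<open>d\<close>.
\<close>

definition torus :: "int ^ 'r \<Rightarrow> (int ^ 'r) linop" where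
  "torus n = Abs_linop (\<lambda>f m. tvar powi omega n m * f (m - n))"

lemma Rep_linop_torus: "Rep_linop (torus n) = (\<lambda>f m. tvar powi omega n m * f (m - n))"
  unfolding torus_def by (subst Abs_linop_inverse) (auto simp: algebra_simps)

lemma torus_mult: "torus n * torus k = tvar powi omega n k *\<^sub>q torus (n + k)"
proof (rule linop_eqI)
  fix f i
  have "omega n i + omega k (i - n) = omega n k + omega (n + k) i"
    using omega_skew[of k n] by (simp add: omega_minus_right omega_add_left)
  then have "tvar powi omega n i * tvar powi omega k (i - n) = tvar powi omega n k * tvar powi omega (n + k) i"
    by (simp flip: power_int_add)
  then show "Rep_linop (torus n * torus k) f i = Rep_linop (tvar powi omega n k *\<^sub>q torus (n + k)) f i"
    by (simp add: Rep_linop_simps Rep_linop_torus diff_diff_eq add.commute mult.assoc[symmetric])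
qed

definition qdiff :: ratfun where
  "qdiff = qpow d 1 - qpow d (- 1)"

lemma qdiff_nonzero [simp]: "qdiff \<noteq> 0"
proof -
  have "\<lfloor>- rat_of_nat (delta0 d)\<rfloor> = - int (delta0 d)"
    by (metis floor_of_int of_int_minus of_int_of_nat_eq)
  then show ?thesis
    using delta0_pos tvar_powi_inj[of "int (delta0 d)" "- int (delta0 d)"] by (simp add: qdiff_def qpow_def)
qed

lemma qpow_B: "qpow d (B m n) = tvar powi omega m n" "qpow d (- B m n) = tvar powi - omega m n"
proof -
  show "qpow d (B m n) = tvar powi omega m n" by (simp add: qpow_def omega_def)
  show "qpow d (- B m n) = tvar powi - omega m n"
    using omega_skew[of m n] skew[of m n] by (simp add: qpow_def omega_def)
qed

lemma qnum_B: "qnum d (B m n) = (tvar powi omega m n - tvar powi omega n m) / qdiff"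
  using omega_skew[of n m] by (simp add: qnum_def qpow_B qdiff_def)

definition level :: "nat \<Rightarrow> (int ^ 'r) set" where
  "level k = {n \<in> Nplus. deg n = k}"

lemma finite_level [simp]: "finite (level k)"
proof (rule finite_subset)
  let ?A = "vec_lambda ` (\<Pi>\<^sub>E i\<in>UNIV. {0..int k})"
  show "level k \<subseteq> ?A"
  proof
    fix n :: "int ^ 'r" assume n: "n \<in> level k"
    have "vec_nth n i \<le> (\<Sum>i\<in>UNIV. vec_nth n i)" for i
      using n by (intro member_le_sum) (auto simp: level_def Nplus_def)
    with n have "vec_nth n i \<in> {0..int k}" for i
      by (auto simp: level_def Nplus_def deg_def)
    then show "n \<in> ?A"
      by (intro image_eqI[of _ _ "vec_nth n"]) auto
  qed
  show "finite ?A"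
    by (intro finite_imageI finite_PiE) auto
qed

lemma deg_pos: "n \<in> Nplus \<Longrightarrow> deg n > 0"
  by (auto simp: Nplus_def deg_def)

lemma level_0 [simp]: "level 0 = {}"
  using deg_pos by (force simp: level_def)

text \<open>The power series variable marks the degree in the lattice. Each coefficient is then a
  finite sum, and congruence up to degree \<open>l\<close> matches the filtration by
  \<open>qgroup_gt l\<close>.\<close>

definition emb :: "'r series \<Rightarrow> (int ^ 'r) linop fps" where
  "emb x = Abs_fps (\<lambda>k. \<Sum>n\<in>level k. (x n / qdiff) *\<^sub>q torus n)"

lemma emb_nth: "emb x $ k = (\<Sum>n\<in>level k. (x n / qdiff) *\<^sub>q torus n)"
  by (simp add: emb_def)

lemma emb_nth_0 [simp]: "emb x $ 0 = 0"
  by (simp add: emb_nth)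

lemma emb_zero [simp]: "emb (\<lambda>_. 0) = 0"
  by (simp add: fps_eq_iff emb_nth)

lemma emb_uminus: "emb (\<lambda>n. - x n) = - emb x"
  by (simp add: fps_eq_iff emb_nth scl_minus_left sum_negf)

text \<open>The operator \<open>torus m\<close> sends the indicator of 0 to the indicator of
  \<open>m\<close>, since \<open>omega m m = 0\<close>. Evaluation on this function therefore reads
  off coefficients, which makes the embedding injective.\<close>

lemma emb_coeff:
  assumes "n \<in> level k"
  shows "Rep_linop (emb x $ k) (\<lambda>m. if m = 0 then 1 else 0) n = x n / qdiff"
proof -
  have Rep_sum: "Rep_linop (\<Sum>i\<in>I. F i) f j = (\<Sum>i\<in>I. Rep_linop (F i) f j)"
    for I and F :: "int ^ 'r \<Rightarrow> (int ^ 'r) linop" and f j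
    by (induction I rule: infinite_finite_induct) (auto simp: Rep_linop_simps)
  have "Rep_linop (emb x $ k) (\<lambda>m. if m = 0 then 1 else 0) n = (\<Sum>m\<in>level k. if m = n then x n / qdiff else 0)"
    unfolding emb_nth Rep_sum by (intro sum.cong) (auto simp: Rep_linop_simps Rep_linop_torus)
  also have "\<dots> = x n / qdiff"
    using assms by simp
  finally show ?thesis .
qed

lemma emb_cong_iff:
  "fps_cong l (emb x) (emb y) \<longleftrightarrow> (\<forall>n\<in>Nplus. deg n \<le> l \<longrightarrow> x n = y n)"
proof
  assume *: "fps_cong l (emb x) (emb y)"
  show "\<forall>n\<in>Nplus. deg n \<le> l \<longrightarrow> x n = y n"
  proof (intro ballI impI)
    fix n :: "int ^ 'r" assume n: "n \<in> Nplus" "deg n \<le> l"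
    then have "n \<in> level (deg n)" by (simp add: level_def)
    from emb_coeff[OF this, of x] emb_coeff[OF this, of y] show "x n = y n"
      using fps_congD[OF * n(2)] by simp
  qed
next
  assume "\<forall>n\<in>Nplus. deg n \<le> l \<longrightarrow> x n = y n"
  then show "fps_cong l (emb x) (emb y)"
    unfolding fps_cong_def emb_nth by (auto intro!: sum.cong simp: level_def)
qed

lemma emb_inj:
  assumes "emb x = emb y" "x \<in> ghat" "y \<in> ghat"
  shows "x = y"
proof
  fix n
  show "x n = y n"
    using emb_cong_iff[of "deg n" x y] assms by (cases "n \<in> Nplus") (auto simp: ghat_def)
qed

lemma emb_mult_nth:
  "(emb x * emb y) $ k = (\<Sum>(m, m')\<in>{(m, m'). m \<in> Nplus \<and> m' \<in> Nplus \<and> deg m + deg m' = k}.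
     (x m * y m' / (qdiff * qdiff)) *\<^sub>q (torus m * torus m'))"
proof -
  let ?f = "\<lambda>(m, m'). (x m * y m' / (qdiff * qdiff)) *\<^sub>q (torus m * torus m')"
  have "(emb x * emb y) $ k = (\<Sum>i\<le>k. \<Sum>p\<in>level i \<times> level (k - i). ?f p)"
    by (simp add: fps_mult_nth emb_nth sum_product scl_mult sum.cartesian_product atLeast0AtMost
        case_prod_beta mult.commute[of "y _"])
  also have "\<dots> = sum ?f (\<Union>i\<le>k. level i \<times> level (k - i))"
    by (rule sum.UNION_disjoint[symmetric]) (auto simp: level_def[abs_def] intro: finite_level[unfolded level_def])
  also have "(\<Union>i\<le>k. level i \<times> level (k - i)) = {(m, m'). m \<in> Nplus \<and> m' \<in> Nplus \<and> deg m + deg m' = k}"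
    by (auto simp: level_def)
  finally show ?thesis .
qed

text \<open>The commutator of two torus monomials is their q-number times \<open>qdiff\<close> times
  the monomial of the sum; one of the two factors \<open>1 / qdiff\<close> of the embeddings cancels
  that \<open>qdiff\<close>, and the other is the normalisation of the image.\<close>

lemma emb_lie: "emb (lie B d x y) = ad (emb x) (emb y)"
proof (rule fps_ext)
  fix k
  let ?P = "{(m, m'). m \<in> Nplus \<and> m' \<in> Nplus \<and> deg m + deg m' = k} :: ((int ^ 'r) \<times> (int ^ 'r)) set"
  let ?Q = "\<lambda>n. {(m, m'). m \<in> Nplus \<and> m' \<in> Nplus \<and> m + m' = (n :: int ^ 'r)}"
  let ?g = "\<lambda>(m, m'). (x m * y m' * qnum d (B m m') / qdiff) *\<^sub>q torus (m + m')"
  have "emb (lie B d x y) $ k = (\<Sum>n\<in>level k. \<Sum>p\<in>?Q n. ?g p)"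
    unfolding emb_nth lie_def sum_divide_distrib scl_sum_left
    by (intro sum.cong) auto
  also have "\<dots> = sum ?g (\<Union>n\<in>level k. ?Q n)"
    by (rule sum.UNION_disjoint[symmetric]) (use finite_lie_index in auto)
  also have "(\<Union>n\<in>level k. ?Q n) = ?P"
    by (auto simp: level_def deg_add Nplus_add)
  also have "sum ?g ?P = (\<Sum>(m, m')\<in>?P. (x m * y m' / (qdiff * qdiff)) *\<^sub>q (torus m * torus m') -
      (y m' * x m / (qdiff * qdiff)) *\<^sub>q (torus m' * torus m))"
    by (intro sum.cong refl) (auto simp: torus_mult qnum_B scl_scl add.commute diff_divide_distrib algebra_simps
        simp flip: scl_diff_left)
  also have "\<dots> = (emb x * emb y) $ k - (\<Sum>(m, m')\<in>?P. (y m' * x m / (qdiff * qdiff)) *\<^sub>q (torus m' * torus m))"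
    by (simp add: emb_mult_nth sum_subtractf case_prod_beta)
  also have "(\<Sum>(m, m')\<in>?P. (y m' * x m / (qdiff * qdiff)) *\<^sub>q (torus m' * torus m)) = (emb y * emb x) $ k"
    unfolding emb_mult_nth by (rule sum.reindex_bij_witness[of _ prod.swap prod.swap]) auto
  finally show "emb (lie B d x y) $ k = ad (emb x) (emb y) $ k"
    by (simp add: ad_def)
qed

lemma emb_nested: "emb (nested B d ws) = right_nested (map emb ws)"
  by (induction ws rule: induct_list012) (auto simp: emb_lie)

lemma map_dynkin_word: "map f (dynkin_word x y ps) = dynkin_word (f x) (f y) ps"
  by (induction ps) (auto simp: dynkin_word_def)

lemma emb_bch: "emb (bch B d x y) = sum_at_1 (dynkin_series (emb x) (emb y))"
proof (rule fps_ext)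
  fix k
  have "emb (bch B d x y) $ k = (\<Sum>n\<in>level k. \<Sum>m = 1..k. \<Sum>ps\<in>dynkin_index m.
      dynkin_coeff ps *\<^sub>q (nested B d (dynkin_word x y ps) n / qdiff) *\<^sub>q torus n)"
    unfolding emb_nth bch_def sum_divide_distrib scl_sum_left
    by (intro sum.cong) (auto simp: level_def scl_scl)
  also have "\<dots> = (\<Sum>m = 1..k. \<Sum>n\<in>level k. \<Sum>ps\<in>dynkin_index m.
      dynkin_coeff ps *\<^sub>q (nested B d (dynkin_word x y ps) n / qdiff) *\<^sub>q torus n)"
    by (rule sum.swap)
  also have "\<dots> = (\<Sum>m = 1..k. \<Sum>ps\<in>dynkin_index m. dynkin_coeff ps *\<^sub>q emb (nested B d (dynkin_word x y ps)) $ k)"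
    unfolding emb_nth scl_sum_right by (intro sum.cong sum.swap refl)
  also have "\<dots> = (\<Sum>m = 1..k. dynkin_series (emb x) (emb y) $ m $ k)"
    by (simp add: dynkin_series_def emb_nested map_dynkin_word fps_sum_nth)
  also have "\<dots> = (\<Sum>m\<le>k. dynkin_series (emb x) (emb y) $ m $ k)"
    by (rule sum.mono_neutral_left) (auto simp: dynkin_series_def dynkin_index_0 not_le)
  finally show "emb (bch B d x y) $ k = sum_at_1 (dynkin_series (emb x) (emb y)) $ k"
    by (simp add: sum_at_1_def)
qed

section \<open>The exponential embedding, the group axioms and limits\<close>

definition gexp :: "'r series \<Rightarrow> (int ^ 'r) linop fps" where
  "gexp x = nexp (emb x)"

lemma gexp_bch: "gexp (bch B d x y) = gexp x * gexp y"
  by (simp add: gexp_def emb_bch nexp_sum_dynkin_series)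

lemma gexp_zero [simp]: "gexp (\<lambda>_. 0) = 1"
  by (simp add: gexp_def nexp_def ev_def fps_eq_iff)
     (simp add: power_0_left if_distrib[of "\<lambda>f. f $ _"] if_distrib[of "\<lambda>c. _ *\<^sub>q c"] cong: if_cong)

lemma gexp_inj: "gexp x = gexp y \<Longrightarrow> x \<in> ghat \<Longrightarrow> y \<in> ghat \<Longrightarrow> x = y"
  by (auto simp: gexp_def intro: emb_inj dest: nexp_inj)

lemma gexp_cong_iff: "fps_cong l (gexp x) (gexp y) \<longleftrightarrow> (\<forall>n\<in>Nplus. deg n \<le> l \<longrightarrow> x n = y n)"
  by (simp add: gexp_def nexp_cong_iff emb_cong_iff)

lemma nested_in_ghat: "ws \<noteq> [] \<Longrightarrow> set ws \<subseteq> ghat \<Longrightarrow> nested B d ws \<in> ghat"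
  by (induction ws rule: induct_list012) (auto simp: lie_in_ghat)

lemma bch_in_ghat:
  assumes "x \<in> ghat" "y \<in> ghat"
  shows "bch B d x y \<in> ghat"
proof -
  have "nested B d (dynkin_word x y ps) \<in> ghat" if "ps \<in> dynkin_index m" for ps m
    using dynkin_word_not_Nil[OF that, of x y] set_dynkin_word[of x y ps] assms by (intro nested_in_ghat) auto
  then show ?thesis
    unfolding ghat_def bch_def by (auto intro!: sum.neutral)
qed

text \<open>\<open>gexp\<close> is injective on \<open>ghat\<close> and multiplicative, so the
  axioms are inherited from multiplication of power series; inverses come from changing the sign of
  the logarithm.\<close>

lemma group_qgroup: "group (qgroup B d)"
proof (rule groupI)
  fix x assume x: "x \<in> carrier (qgroup B d)"
  let ?y = "\<lambda>n. - x n"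
  have y: "?y \<in> ghat" using x by (simp add: qgroup_def ghat_def)
  have "gexp (bch B d ?y x) = gexp (\<lambda>_. 0)"
    unfolding gexp_bch by (simp add: emb_uminus gexp_def[of x] gexp_def[of ?y])
  then have "bch B d ?y x = (\<lambda>_. 0)"
    using x y by (intro gexp_inj bch_in_ghat) (auto simp: qgroup_def ghat_def)
  with y show "\<exists>y\<in>carrier (qgroup B d). y \<otimes>\<^bsub>qgroup B d\<^esub> x = \<one>\<^bsub>qgroup B d\<^esub>"
    by (auto simp: qgroup_def)
next
  fix x y z
  assume "x \<in> carrier (qgroup B d)" "y \<in> carrier (qgroup B d)" "z \<in> carrier (qgroup B d)"
  then show "x \<otimes>\<^bsub>qgroup B d\<^esub> y \<otimes>\<^bsub>qgroup B d\<^esub> z = x \<otimes>\<^bsub>qgroup B d\<^esub> (y \<otimes>\<^bsub>qgroup B d\<^esub> z)"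
    by (auto simp: qgroup_def gexp_bch mult.assoc intro!: gexp_inj bch_in_ghat)
next
  fix x assume "x \<in> carrier (qgroup B d)"
  then have "bch B d (\<lambda>_. 0) x = x"
    by (intro gexp_inj bch_in_ghat) (auto simp: qgroup_def gexp_bch ghat_def)
  then show "\<one>\<^bsub>qgroup B d\<^esub> \<otimes>\<^bsub>qgroup B d\<^esub> x = x"
    by (simp add: qgroup_def)
qed (auto simp: qgroup_def bch_in_ghat, simp add: ghat_def)

sublocale G: group "qgroup B d"
  by (rule group_qgroup)

lemma carrier_qgroup [simp]: "carrier (qgroup B d) = ghat"
  by (simp add: qgroup_def)

lemma gexp_mult: "gexp (x \<otimes>\<^bsub>qgroup B d\<^esub> y) = gexp x * gexp y"
  by (simp add: qgroup_def gexp_bch)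

lemma gexp_one: "gexp \<one>\<^bsub>qgroup B d\<^esub> = 1"
  by (simp add: qgroup_def)

lemma gexp_inv:
  assumes "x \<in> ghat"
  shows "gexp x * gexp (inv\<^bsub>qgroup B d\<^esub> x) = 1" "gexp (inv\<^bsub>qgroup B d\<^esub> x) * gexp x = 1"
  using assms by (simp_all flip: gexp_mult add: gexp_one)

lemma qgroup_gt_iff: "x \<in> qgroup_gt l \<longleftrightarrow> x \<in> ghat \<and> fps_cong l (gexp x) 1"
proof -
  have "fps_cong l (gexp x) 1 \<longleftrightarrow> (\<forall>n\<in>Nplus. deg n \<le> l \<longrightarrow> x n = 0)"
    using gexp_cong_iff[of l x "\<lambda>_. 0"] by simp
  then show ?thesis
    by (auto simp: qgroup_gt_def ghat_def not_less[symmetric])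
qed

lemma subgroup_qgroup_gt: "subgroup (qgroup_gt l) (qgroup B d)"
proof (rule G.subgroupI)
  show "(qgroup_gt l :: 'r series set) \<noteq> {}"
    using G.one_closed qgroup_gt_iff[of "\<one>\<^bsub>qgroup B d\<^esub>" l] by (auto simp: gexp_one)
next
  fix x :: "'r series" assume x: "x \<in> qgroup_gt l"
  then have "fps_cong l (gexp x * gexp (inv\<^bsub>qgroup B d\<^esub> x)) (1 * gexp (inv\<^bsub>qgroup B d\<^esub> x))"
    by (intro fps_cong_mult) (auto simp: qgroup_gt_iff)
  with x show "inv\<^bsub>qgroup B d\<^esub> x \<in> qgroup_gt l"
    using G.inv_closed[of x] by (auto simp: qgroup_gt_iff gexp_inv intro: fps_cong_sym)
next
  fix x y :: "'r series" assume xy: "x \<in> qgroup_gt l" "y \<in> qgroup_gt l"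
  then have "fps_cong l (gexp x * gexp y) (1 * 1)"
    by (intro fps_cong_mult) (auto simp: qgroup_gt_iff)
  with xy show "x \<otimes>\<^bsub>qgroup B d\<^esub> y \<in> qgroup_gt l"
    using G.m_closed[of x y] by (auto simp: qgroup_gt_iff gexp_mult)
qed (auto simp: qgroup_gt_iff)

lemma coset_eqI:
  assumes "x \<in> ghat" "y \<in> ghat" "fps_cong l (gexp x) (gexp y)"
  shows "qgroup_gt l #>\<^bsub>qgroup B d\<^esub> x = qgroup_gt l #>\<^bsub>qgroup B d\<^esub> y"
proof -
  let ?h = "x \<otimes>\<^bsub>qgroup B d\<^esub> inv\<^bsub>qgroup B d\<^esub> y"
  have "fps_cong l (gexp ?h) (gexp y * gexp (inv\<^bsub>qgroup B d\<^esub> y))"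
    unfolding gexp_mult by (intro fps_cong_mult assms) simp
  then have "?h \<in> qgroup_gt l"
    using assms G.inv_closed[of y] G.m_closed[of x "inv\<^bsub>qgroup B d\<^esub> y"] by (auto simp: qgroup_gt_iff gexp_inv)
  moreover have "x = ?h \<otimes>\<^bsub>qgroup B d\<^esub> y"
    using assms G.inv_closed[of y] by (simp add: G.m_assoc)
  ultimately have "x \<in> qgroup_gt l #>\<^bsub>qgroup B d\<^esub> y"
    by (auto simp: r_coset_def)
  then show ?thesis
    using G.repr_independence[OF _ _ subgroup_qgroup_gt] assms by simp
qed

lemma has_limitI:
  assumes "g \<in> ghat" "\<And>k. s k \<in> ghat" "\<And>l. \<forall>\<^sub>F k in sequentially. fps_cong l (gexp (s k)) (gexp g)"
  shows "has_limit B d s g"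
  unfolding has_limit_def
proof (intro conjI allI)
  fix l
  show "\<forall>\<^sub>F k in sequentially. qgroup_gt l #>\<^bsub>qgroup B d\<^esub> s k = qgroup_gt l #>\<^bsub>qgroup B d\<^esub> g"
    using assms(3)[of l] by eventually_elim (intro coset_eqI assms)
qed (use assms in simp)

text \<open>Coefficients of degree at most \<open>l\<close> no longer change from \<open>s l\<close>
  on, so the limit takes its coefficient at \<open>n\<close> from \<open>s (deg n)\<close>.\<close>

lemma limit_exists:
  assumes s: "\<And>k. s k \<in> ghat"
    and cauchy: "\<And>l k. k \<ge> l \<Longrightarrow> fps_cong l (gexp (s (Suc k))) (gexp (s k))"
  obtains g where "g \<in> ghat" "has_limit B d s g" "\<And>l k. k \<ge> l \<Longrightarrow> fps_cong l (gexp (s k)) (gexp g)"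
proof -
  define g where "g n = s (deg n) n" for n
  have g: "g \<in> ghat"
    using s by (auto simp: ghat_def g_def)
  have mono: "fps_cong l (gexp (s k)) (gexp (s l))" if "l \<le> k" for l k
    using that by (induction rule: dec_induct) (auto intro: fps_cong_trans[OF cauchy])
  have cong: "fps_cong l (gexp (s k)) (gexp g)" if "l \<le> k" for l k
    unfolding gexp_cong_iff
  proof (intro ballI impI)
    fix n :: "int ^ 'r" assume "n \<in> Nplus" "deg n \<le> l"
    then show "s k n = g n"
      using mono[of "deg n" k] that by (auto simp: gexp_cong_iff g_def)
  qed
  have "has_limit B d s g"
    using cong by (intro has_limitI g s) (auto simp: eventually_sequentially)
  with g cong that show ?thesis by blast
qed

end

section \<open>Quantum dilogarithms and the pentagon relation\<close>

lemma fps_linear_ode_unique: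
  fixes f g :: "'a::field_char_0 fps"
  assumes "fps_deriv f = h * f" "fps_deriv g = h * g" "f $ 0 = g $ 0"
  shows "f = g"
proof (rule fps_ext)
  fix n
  show "f $ n = g $ n"
  proof (induction n rule: less_induct)
    case (less n)
    show ?case
    proof (cases n)
      case 0
      then show ?thesis using assms(3) by simp
    next
      case (Suc m)
      have "of_nat (Suc m) * f $ Suc m = (h * f) $ m" "of_nat (Suc m) * g $ Suc m = (h * g) $ m"
        using arg_cong[OF assms(1), of "\<lambda>p. p $ m"] arg_cong[OF assms(2), of "\<lambda>p. p $ m"]
        by (simp_all del: of_nat_Suc)
      moreover have "(h * f) $ m = (h * g) $ m"
        unfolding fps_mult_nth using less Suc by (intro sum.cong) auto
      ultimately have "of_nat (Suc m) * f $ Suc m = of_nat (Suc m) * g $ Suc m"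
        by simp
      then show ?thesis
        unfolding Suc by (simp del: of_nat_Suc)
    qed
  qed
qed

text \<open>Both sides solve the linear equation f' = (a + b)' f with constant term 1.\<close>

lemma fps_exp_compose_add:
  fixes a b :: "'a::field_char_0 fps"
  assumes "a $ 0 = 0" "b $ 0 = 0"
  shows "fps_exp 1 oo (a + b) = (fps_exp 1 oo a) * (fps_exp 1 oo b)"
proof (rule fps_linear_ode_unique[where h = "fps_deriv (a + b)"])
  show "fps_deriv (fps_exp 1 oo (a + b)) = fps_deriv (a + b) * (fps_exp 1 oo (a + b))"
    using assms by (subst fps_compose_deriv) (auto simp: mult.commute)
  show "fps_deriv ((fps_exp 1 oo a) * (fps_exp 1 oo b)) = fps_deriv (a + b) * ((fps_exp 1 oo a) * (fps_exp 1 oo b))"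
    using assms by (simp add: fps_compose_deriv algebra_simps)
qed simp

section \<open>Logarithms of the dilogarithm and of the central factor\<close>

definition generic :: "ratfun \<Rightarrow> bool" where
  "generic Q \<longleftrightarrow> Q \<noteq> 0 \<and> (\<forall>j>0. Q ^ j \<noteq> 1)"

lemma generic_nonzero [simp]: "generic Q \<Longrightarrow> Q \<noteq> 0"
  by (simp add: generic_def)

lemma generic_diff: "generic Q \<Longrightarrow> j > 0 \<Longrightarrow> Q ^ j - inverse Q ^ j \<noteq> 0"
proof
  assume Q: "generic Q" "j > 0" "Q ^ j - inverse Q ^ j = 0"
  then have "Q ^ j = inverse (Q ^ j)"
    by (simp add: power_inverse)
  then have "Q ^ j * Q ^ j = inverse (Q ^ j) * Q ^ j"
    by (rule arg_cong)
  then have "Q ^ j * Q ^ j = 1"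
    using Q by simp
  then have "Q ^ (j + j) = 1"
    by (simp add: power_add)
  with Q show False
    by (auto simp: generic_def)
qed

lemma generic_power: "generic Q \<Longrightarrow> k > 0 \<Longrightarrow> generic (Q ^ k)"
  by (auto simp: generic_def simp flip: power_mult)

text \<open>With \<open>Q\<close> for q^a, the factor \<open>1 / qdiff\<close> of the embedding
  turns the denominator \<open>[ja]_q\<close> into \<open>Q ^ j - inverse Q ^ j\<close>.\<close>

definition dilog_log :: "ratfun \<Rightarrow> ratfun fps" where
  "dilog_log Q = Abs_fps (\<lambda>j. if j = 0 then 0 else (- 1) ^ (j + 1) / (of_nat j * (Q ^ j - inverse Q ^ j)))"

definition Phi :: "ratfun \<Rightarrow> 'a::ratfun_algebra fps \<Rightarrow> 'a fps" where
  "Phi Q z = ev (fps_exp 1 oo dilog_log Q) z"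

text \<open>The summed logarithm of the product in the centre. For j = 2^s times an odd number, the
  pair of factors with index p contributes to the \<open>j\<close>-th coefficient only if p is at
  most s, namely the stated quotient times 2^p, with sign plus for p = s and minus for p < s; and
  2^s - (1 + 2 + ... + 2^(s-1)) = 1.\<close>

definition mid_log :: "ratfun \<Rightarrow> ratfun fps" where
  "mid_log Q = Abs_fps (\<lambda>j. if j = 0 then 0 else (Q ^ j + inverse Q ^ j) / (of_nat j * (Q ^ j - inverse Q ^ j)))"

definition Mid :: "ratfun \<Rightarrow> 'a::ratfun_algebra fps \<Rightarrow> 'a fps" where
  "Mid Q z = ev (fps_exp 1 oo mid_log Q) z"

lemma dilog_log_0 [simp]: "dilog_log Q $ 0 = 0"
  by (simp add: dilog_log_def)

lemma mid_log_0 [simp]: "mid_log Q $ 0 = 0"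
  by (simp add: mid_log_def)

lemma Phi_eq_nexp: "z $ 0 = 0 \<Longrightarrow> Phi Q z = nexp (ev (dilog_log Q) z)"
  by (simp add: Phi_def nexp_def ev_compose)

lemma Phi_scl:
  "Phi Q (c *\<^sub>q z) = ev (fps_exp 1 oo (dilog_log Q oo (fps_const c * fps_X))) z"
  by (simp add: Phi_def ev_scl fps_compose_assoc)

lemma divide_diff_split:
  fixes a b :: "'a::field"
  assumes "a * a - b * b \<noteq> 0"
  shows "s / (k * (a - b)) = a * (s / (k * (a * a - b * b))) + b * (s / (k * (a * a - b * b)))"
proof -
  have eq: "a * a - b * b = (a + b) * (a - b)" by (simp add: algebra_simps)
  have "a * (s / (k * (a * a - b * b))) + b * (s / (k * (a * a - b * b))) = (a + b) * (s / (k * (a * a - b * b)))"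
    by (simp only: distrib_right)
  also have "\<dots> = s / (k * (a - b))"
    using assms unfolding eq by simp
  finally show ?thesis ..
qed

text \<open>In each degree this is 1 / (a - b) = (a + b) / (a^2 - b^2) with a = \<open>Q ^ j\<close>
  and b = \<open>inverse Q ^ j\<close>.\<close>

lemma dilog_log_fission:
  assumes "generic Q"
  shows "dilog_log Q = (dilog_log (Q ^ 2) oo (fps_const Q * fps_X)) +
    (dilog_log (Q ^ 2) oo (fps_const (inverse Q) * fps_X))"
proof (rule fps_ext)
  fix j
  show "dilog_log Q $ j = ((dilog_log (Q ^ 2) oo (fps_const Q * fps_X)) +
    (dilog_log (Q ^ 2) oo (fps_const (inverse Q) * fps_X))) $ j"
  proof (cases "j = 0")
    case False
    let ?a = "Q ^ j" and ?b = "inverse Q ^ j"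
    have sq: "(Q ^ 2) ^ j = ?a * ?a" "inverse (Q ^ 2) ^ j = ?b * ?b"
      by (simp_all add: power2_eq_square power_mult_distrib)
    have "?a * ?a - ?b * ?b \<noteq> 0"
      using False generic_diff[OF generic_power[OF assms, of 2], of j] unfolding sq by simp
    from divide_diff_split[OF this, of "(- 1) ^ (j + 1)" "of_nat j"] show ?thesis
      using False unfolding fps_add_nth fps_nth_compose_linear dilog_log_def fps_nth_Abs_fps sq
      by simp
  qed simp
qed

lemma Phi_fission:
  assumes "generic Q" "z $ 0 = 0"
  shows "Phi Q z = Phi (Q ^ 2) (Q *\<^sub>q z) * Phi (Q ^ 2) (inverse Q *\<^sub>q z)"
  unfolding Phi_scl using assms
  by (subst Phi_def, subst dilog_log_fission[OF assms(1)])
    (simp add: fps_exp_compose_add ev_mult fps_compose_nth_0)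

text \<open>Let r be the \<open>j\<close>-th coefficient on the left. The two outer terms give r for
  odd \<open>j\<close> and -r for even \<open>j\<close>; the middle term lives in even degrees and
  gives 2r there, because the denominator is \<open>j / 2\<close> while (Q^2)^(j/2) = Q^j.\<close>

lemma mid_log_rec:
  assumes "generic Q"
  shows "mid_log Q = (dilog_log Q oo (fps_const Q * fps_X)) + (mid_log (Q ^ 2) oo fps_X ^ 2) +
    (dilog_log Q oo (fps_const (inverse Q) * fps_X))"
proof (rule fps_ext)
  fix j
  show "mid_log Q $ j = ((dilog_log Q oo (fps_const Q * fps_X)) + (mid_log (Q ^ 2) oo fps_X ^ 2) +
    (dilog_log Q oo (fps_const (inverse Q) * fps_X))) $ j"
  proof (cases "j = 0")
    case False
    let ?r = "(Q ^ j + inverse Q ^ j) / (of_nat j * (Q ^ j - inverse Q ^ j))"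
    have 1: "(dilog_log Q oo (fps_const Q * fps_X)) $ j + (dilog_log Q oo (fps_const (inverse Q) * fps_X)) $ j
        = (- 1) ^ (j + 1) * ?r"
      using False unfolding fps_nth_compose_linear dilog_log_def
      by (simp add: add_divide_distrib algebra_simps)
    have 2: "(mid_log (Q ^ 2) oo fps_X ^ 2) $ j = (if even j then 2 * ?r else 0)"
    proof (cases "even j")
      case True
      then obtain k where j: "j = 2 * k" by auto
      have half: "X / (of_nat k * Y) = 2 * (X / (of_nat j * Y))" for X Y :: ratfun
        by (simp add: j)
      have "(Q ^ 2) ^ k = Q ^ j" "inverse (Q ^ 2) ^ k = inverse Q ^ j"
        by (simp_all add: j power_mult power_inverse)
      then have "(mid_log (Q ^ 2) oo fps_X ^ 2) $ j = (Q ^ j + inverse Q ^ j) / (of_nat k * (Q ^ j - inverse Q ^ j))"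
        using False j by (simp add: fps_nth_compose_X_power mid_log_def)
      with True show ?thesis
        by (simp only: half if_True)
    qed (simp add: fps_nth_compose_X_power)
    have "mid_log Q $ j = ?r"
      using False by (simp add: mid_log_def)
    also have "\<dots> = (- 1) ^ (j + 1) * ?r + (if even j then 2 * ?r else 0)"
    proof -
      have "r = (- 1) ^ (j + 1) * r + (if even j then 2 * r else 0)" for r :: ratfun
        by simp
      then show ?thesis .
    qed
    finally show ?thesis
      using 1 2 by (simp add: add_ac)
  qed (simp add: fps_nth_compose_X_power)
qed

lemma ev_power:
  assumes "z $ 0 = 0"
  shows "ev (fps_X ^ k) z = z ^ k"
  using assms by (induction k) (auto simp: ev_mult ev_fps_X)

lemma Mid_rec:
  assumes "generic Q" "z $ 0 = 0"
  shows "Mid Q z = Phi Q (Q *\<^sub>q z) * Mid (Q ^ 2) (z ^ 2) * Phi Q (inverse Q *\<^sub>q z)"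
proof -
  have "fps_exp 1 oo mid_log Q = (fps_exp 1 oo (dilog_log Q oo (fps_const Q * fps_X))) *
      ((fps_exp 1 oo mid_log (Q ^ 2)) oo fps_X ^ 2) *
      (fps_exp 1 oo (dilog_log Q oo (fps_const (inverse Q) * fps_X)))"
    by (subst mid_log_rec[OF assms(1)])
      (simp add: fps_exp_compose_add fps_compose_assoc fps_nth_power_0)
  moreover have "ev ((fps_exp 1 oo mid_log (Q ^ 2)) oo fps_X ^ 2) z = Mid (Q ^ 2) (z ^ 2)"
    unfolding Mid_def using assms by (subst ev_compose) (simp_all add: ev_power fps_nth_power_0)
  ultimately show ?thesis
    using assms unfolding Phi_scl by (simp add: Mid_def[of Q] ev_mult)
qed

lemma Phi_commute: "z $ 0 = 0 \<Longrightarrow> Phi Q (a *\<^sub>q z) * Phi Q' (b *\<^sub>q z) = Phi Q' (b *\<^sub>q z) * Phi Q (a *\<^sub>q z)"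
  unfolding Phi_scl by (simp add: mult.commute flip: ev_mult)

text \<open>For generic \<open>Q\<close> this is (-Q)^k / ((1 - Q^2) (1 - Q^4) ... (1 - Q^(2k))), as
  in Euler's q-exponential; only the recursion below is used.\<close>

definition dilog_coeff :: "ratfun \<Rightarrow> nat \<Rightarrow> ratfun" where
  "dilog_coeff Q k = (fps_exp 1 oo dilog_log Q) $ k"

lemma dilog_coeff_0 [simp]: "dilog_coeff Q 0 = 1"
  by (simp add: dilog_coeff_def)

text \<open>Comparison of coefficients in \<open>\<Phi> (Q z) = (1 + z) \<Phi> (Q\<^sup>-\<^sup>1 z)\<close>.\<close>

lemma dilog_coeff_Suc:
  assumes "generic Q"
  shows "dilog_coeff Q (Suc k) * (Q ^ Suc k - inverse Q ^ Suc k) = dilog_coeff Q k * inverse Q ^ k"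
proof -
  let ?F = "fps_exp 1 oo dilog_log Q"
  let ?L = "\<lambda>c. dilog_log Q oo (fps_const c * fps_X)"
  \<comment> \<open>Logarithm of the functional equation: the factor
    \<open>Q ^ j - inverse Q ^ j\<close> cancels the denominator of \<open>dilog_log\<close> and
    leaves log (1 + X).\<close>
  have "?L Q = fps_ln 1 + ?L (inverse Q)"
  proof (rule fps_ext)
    fix j
    show "?L Q $ j = (fps_ln 1 + ?L (inverse Q)) $ j"
    proof (cases "j = 0")
      case False
      have "?L Q $ j - ?L (inverse Q) $ j = (Q ^ j - inverse Q ^ j) * dilog_log Q $ j"
        unfolding fps_nth_compose_linear by (simp add: left_diff_distrib)
      also have "\<dots> = fps_ln 1 $ j"
        using generic_diff[OF assms, of j] False by (cases j) (simp_all add: dilog_log_def fps_ln_nth)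
      finally show ?thesis
        unfolding fps_add_nth by (simp only: diff_eq_eq)
    qed simp
  qed
  then have "fps_exp 1 oo ?L Q = (fps_exp 1 oo fps_ln 1) * (fps_exp 1 oo ?L (inverse Q))"
    by (simp add: fps_exp_compose_add)
  then have "?F oo (fps_const Q * fps_X) = (1 + fps_X) * (?F oo (fps_const (inverse Q) * fps_X))"
    by (simp add: fps_exp_compose_ln fps_compose_assoc)
  from arg_cong[OF this, of "\<lambda>p. p $ Suc k"]
  have "Q ^ Suc k * ?F $ Suc k = inverse Q ^ Suc k * ?F $ Suc k + inverse Q ^ k * ?F $ k"
    by (simp add: distrib_right del: power_Suc)
  then show ?thesis
    unfolding dilog_coeff_def right_diff_distrib by (simp add: mult.commute del: power_Suc)
qed

text \<open>The coefficient of \<open>u ^ i * v ^ j\<close> in the pentagon relation. The induction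
  on \<open>i\<close> multiplies by \<open>Q ^ Suc i - inverse Q ^ Suc i\<close>, so that the
  recursion for \<open>dilog_coeff\<close> lowers the first or the second factor of each summand,
  and ends with the recursion for the third.\<close>

lemma pentagon_coefficients:
  assumes "generic Q"
  shows "(\<Sum>k\<le>i. if k \<le> j then dilog_coeff Q (i - k) * dilog_coeff Q k * dilog_coeff Q (j - k) * Q ^ (k * k) else 0)
    = dilog_coeff Q i * dilog_coeff Q j * Q ^ (2 * i * j)"
proof (induction i)
  case (Suc i)
  define c where "c = dilog_coeff Q"
  define P where "P = inverse Q"
  have QP: "Q * P = 1" using assms by (simp add: P_def)
  have QPn: "Q ^ n * P ^ n = 1" for n by (simp add: QP flip: power_mult_distrib)
  have rec: "c (Suc k) * (Q ^ Suc k - P ^ Suc k) = c k * P ^ k" for k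
    unfolding c_def P_def by (rule dilog_coeff_Suc[OF assms])
  define h where "h k = (if k \<le> j then c (j - k) else 0)" for k
  \<comment> \<open>The recursion for \<open>c (j - k)\<close>. Extending by 0 through
    \<open>h\<close> makes it hold for every \<open>k\<close>, including the boundary case
    \<open>k = j\<close>.\<close>
  have key: "Q ^ k * h k + Q ^ Suc k * h (Suc k) = Q ^ (2 * j) * P ^ k * h k" for k
  proof (cases "k \<le> j")
    case True
    then obtain m where j: "j = k + m" using le_Suc_ex by blast
    have Qk: "Q ^ (2 * (k + m)) * P ^ k = Q ^ k * Q ^ m * Q ^ m"
      using QPn[of k] by (simp add: power_add power_mult power2_eq_square algebra_simps)
    show ?thesis
    proof (cases m)
      case 0
      with Qk j show ?thesis by (simp add: h_def)
    next
      case (Suc m')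
      have "h (Suc k) = c m' * (P ^ m' * Q ^ m')"
        using j Suc QPn[of m'] by (simp add: h_def mult.commute)
      also have "\<dots> = c m * (Q ^ m - P ^ m) * Q ^ m'"
        using rec[of m'] Suc by (simp add: mult.assoc)
      finally have "Q ^ Suc k * h (Suc k) = Q ^ k * (c m * (Q ^ m - P ^ m) * (Q * Q ^ m'))"
        by (simp only: power_Suc mult_ac)
      also have "\<dots> = Q ^ k * (c m * (Q ^ m - P ^ m) * Q ^ m)"
        using Suc by simp
      also have "\<dots> = Q ^ k * c m * (Q ^ m * Q ^ m - 1)"
        using QPn[of m] by (simp add: algebra_simps)
      finally have "Q ^ k * h k + Q ^ Suc k * h (Suc k) = Q ^ k * c m + Q ^ k * c m * (Q ^ m * Q ^ m - 1)"
        using j by (simp add: h_def)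
      also have "\<dots> = (Q ^ k * Q ^ m * Q ^ m) * c m"
        by (simp add: algebra_simps)
      also have "\<dots> = Q ^ (2 * j) * P ^ k * h k"
        unfolding Qk[symmetric] using j by (simp add: h_def)
      finally show ?thesis .
    qed
  qed (simp add: h_def)
  let ?I = "Suc i"
  let ?b = "\<lambda>i. \<Sum>k\<le>i. c (i - k) * c k * h k * Q ^ (k * k)"
  \<comment> \<open>The factor is split as Q^k (Q^(I-k) - P^(I-k)) + P^(I-k) (Q^k - P^k): the first
    part meets the recursion for \<open>c (I - k)\<close>, the second, after shifting
    \<open>k\<close> by one, that for \<open>c k\<close>.\<close>
  have "(Q ^ ?I - P ^ ?I) * ?b ?I = (\<Sum>k\<le>?I. (Q ^ k * (Q ^ (?I - k) - P ^ (?I - k))) * (c (?I - k) * c k * h k * Q ^ (k * k)))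
      + (\<Sum>k\<le>?I. (P ^ (?I - k) * (Q ^ k - P ^ k)) * (c (?I - k) * c k * h k * Q ^ (k * k)))"
    unfolding sum_distrib_left sum.distrib[symmetric] distrib_right[symmetric]
  proof (intro sum.cong refl)
    fix k assume "k \<in> {..?I}"
    then have "Q ^ ?I = Q ^ k * Q ^ (?I - k)" "P ^ ?I = P ^ (?I - k) * P ^ k"
      by (simp_all flip: power_add)
    then have "Q ^ ?I - P ^ ?I = Q ^ k * (Q ^ (?I - k) - P ^ (?I - k)) + P ^ (?I - k) * (Q ^ k - P ^ k)"
      by (simp only: algebra_simps)
    then show "(Q ^ ?I - P ^ ?I) * (c (?I - k) * c k * h k * Q ^ (k * k)) =
      (Q ^ k * (Q ^ (?I - k) - P ^ (?I - k)) + P ^ (?I - k) * (Q ^ k - P ^ k)) * (c (?I - k) * c k * h k * Q ^ (k * k))"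
      by simp
  qed
  also have "(\<Sum>k\<le>?I. (Q ^ k * (Q ^ (?I - k) - P ^ (?I - k))) * (c (?I - k) * c k * h k * Q ^ (k * k)))
      = (\<Sum>k\<le>i. P ^ (i - k) * (c (i - k) * c k * Q ^ (k * k)) * (Q ^ k * h k))"
  proof (subst sum.atMost_Suc, simp del: power_Suc, intro sum.cong refl)
    fix k assume "k \<in> {..i}"
    then have "?I - k = Suc (i - k)" by auto
    then show "Q ^ k * (Q ^ (?I - k) - P ^ (?I - k)) * (c (?I - k) * c k * h k * Q ^ (k * k)) =
      P ^ (i - k) * (c (i - k) * c k * Q ^ (k * k)) * (Q ^ k * h k)"
      using rec[of "i - k"] by (simp add: algebra_simps del: power_Suc)
  qed
  also have "(\<Sum>k\<le>?I. (P ^ (?I - k) * (Q ^ k - P ^ k)) * (c (?I - k) * c k * h k * Q ^ (k * k)))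
      = (\<Sum>k\<le>i. P ^ (i - k) * (c (i - k) * c k * Q ^ (k * k)) * (Q ^ Suc k * h (Suc k)))"
  proof (subst sum.atMost_Suc_shift, simp del: power_Suc, intro sum.cong refl)
    fix k assume "k \<in> {..i}"
    have "Q ^ (Suc k * Suc k) * P ^ k = Q ^ (k * k) * Q ^ Suc k * (Q ^ k * P ^ k)"
      by (simp add: power_add algebra_simps)
    then have sq: "Q ^ (Suc k * Suc k) * P ^ k = Q ^ (k * k) * Q ^ Suc k"
      by (simp only: QPn mult_1_right)
    have "P ^ (i - k) * (Q ^ Suc k - P ^ Suc k) * (c (i - k) * c (Suc k) * h (Suc k) * Q ^ (Suc k * Suc k)) =
      P ^ (i - k) * (c (i - k) * (c (Suc k) * (Q ^ Suc k - P ^ Suc k)) * h (Suc k) * Q ^ (Suc k * Suc k))"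
      by (simp only: mult_ac)
    also have "\<dots> = P ^ (i - k) * (c (i - k) * c k * h (Suc k)) * (Q ^ (Suc k * Suc k) * P ^ k)"
      unfolding rec by (simp only: mult_ac)
    also have "\<dots> = P ^ (i - k) * (c (i - k) * c k * Q ^ (k * k)) * (Q ^ Suc k * h (Suc k))"
      unfolding sq by (simp only: mult_ac)
    finally show "P ^ (i - k) * (Q ^ Suc k - P ^ Suc k) * (c (i - k) * c (Suc k) * h (Suc k) * Q ^ (Suc (k + (k + k * k)))) =
      P ^ (i - k) * (c (i - k) * c k * Q ^ (k * k)) * (Q ^ Suc k * h (Suc k))"
      by (simp del: power_Suc)
  qed
  also have "(\<Sum>k\<le>i. P ^ (i - k) * (c (i - k) * c k * Q ^ (k * k)) * (Q ^ k * h k)) +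
       (\<Sum>k\<le>i. P ^ (i - k) * (c (i - k) * c k * Q ^ (k * k)) * (Q ^ Suc k * h (Suc k)))
      = P ^ i * Q ^ (2 * j) * ?b i"
    unfolding sum.distrib[symmetric] distrib_left[symmetric] key sum_distrib_left
  proof (intro sum.cong refl)
    fix k assume "k \<in> {..i}"
    then have "P ^ i = P ^ (i - k) * P ^ k" by (simp flip: power_add)
    then show "P ^ (i - k) * (c (i - k) * c k * Q ^ (k * k)) * (Q ^ (2 * j) * P ^ k * h k) =
      P ^ i * Q ^ (2 * j) * (c (i - k) * c k * h k * Q ^ (k * k))"
      by (simp only: mult_ac)
  qed
  also have b: "?b i = (\<Sum>k\<le>i. if k \<le> j then c (i - k) * c k * c (j - k) * Q ^ (k * k) else 0)" for i
    by (intro sum.cong) (auto simp: h_def)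
  also have "(\<Sum>k\<le>i. if k \<le> j then c (i - k) * c k * c (j - k) * Q ^ (k * k) else 0) = c i * c j * Q ^ (2 * i * j)"
    using Suc.IH unfolding c_def .
  also have "P ^ i * Q ^ (2 * j) * (c i * c j * Q ^ (2 * i * j)) = (c i * P ^ i) * c j * Q ^ (2 * ?I * j)"
    by (simp add: power_add algebra_simps)
  also have "\<dots> = (Q ^ ?I - P ^ ?I) * (c ?I * c j * Q ^ (2 * ?I * j))"
    unfolding rec[symmetric] by (simp only: mult_ac)
  finally show ?case
    using generic_diff[OF assms, of ?I] b[of ?I] unfolding P_def c_def by (simp del: power_Suc)
qed simp

section \<open>The pentagon relation for power series\<close>

lemma scl_commute_power:
  fixes u v :: "'a::ratfun_algebra"
  assumes "v * u = a *\<^sub>q (u * v)"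
  shows "v ^ i * u ^ j = a ^ (i * j) *\<^sub>q (u ^ j * v ^ i)"
proof -
  have 1: "v * u ^ j = a ^ j *\<^sub>q (u ^ j * v)" for j
  proof (induction j)
    case (Suc j)
    have "v * u ^ Suc j = (v * u ^ j) * u" by (simp add: power_Suc2 mult.assoc del: power_Suc)
    also have "\<dots> = a ^ j *\<^sub>q (u ^ j * (v * u))" by (simp add: Suc scl_mult mult.assoc)
    also have "\<dots> = a ^ Suc j *\<^sub>q (u ^ Suc j * v)"
      by (simp add: assms scl_mult mult.assoc power_Suc2 mult.commute del: power_Suc)
    finally show ?case .
  qed simp
  show ?thesis
  proof (induction i)
    case (Suc i)
    have "v ^ Suc i * u ^ j = v * (v ^ i * u ^ j)" by (simp add: mult.assoc)
    also have "\<dots> = a ^ (i * j) *\<^sub>q (v * u ^ j * v ^ i)" by (simp add: Suc scl_mult mult.assoc)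
    also have "\<dots> = a ^ (Suc i * j) *\<^sub>q (u ^ j * v ^ Suc i)"
      by (simp add: 1 scl_mult mult.assoc power_add mult.commute)
    finally show ?case .
  qed simp
qed

lemma fps_cong_sum_subset:
  fixes f :: "'b \<Rightarrow> 'a::comm_monoid_add fps"
  assumes "finite A" "S \<subseteq> A" "\<And>x. x \<in> A - S \<Longrightarrow> order_ge (Suc l) (f x)"
  shows "fps_cong l (sum f A) (sum f S)"
  unfolding fps_cong_def fps_sum_nth
proof (intro allI impI sum.mono_neutral_right assms ballI)
  fix k x assume "k \<le> l" "x \<in> A - S"
  with assms(3)[of x] show "f x $ k = 0"
    by (auto simp: order_ge_def)
qed

lemma Phi_cong_finite:
  "z $ 0 = 0 \<Longrightarrow> fps_cong l (Phi Q z) (\<Sum>k\<le>l. dilog_coeff Q k *\<^sub>q z ^ k)"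
  unfolding Phi_def dilog_coeff_def by (rule ev_cong_finite) auto

text \<open>Both sides are expanded in the ordered monomials \<open>u ^ i * v ^ j\<close>. On the
  left, reordering \<open>v ^ j * u ^ i\<close> costs \<open>Q ^ (2 * i * j)\<close>; on the right,
  a triple sum collapses by \<open>pentagon_coefficients\<close>.\<close>

theorem pentagon:
  fixes u v :: "'a::ratfun_algebra fps"
  assumes Q: "generic Q" and u: "u $ 0 = 0" and v: "v $ 0 = 0" and vu: "v * u = Q ^ 2 *\<^sub>q (u * v)"
  shows "Phi Q v * Phi Q u = Phi Q u * Phi Q (Q *\<^sub>q (u * v)) * Phi Q v"
proof (rule fps_cong_all_eq)
  fix l :: nat
  define c where "c = dilog_coeff Q"
  define T where "T i j = u ^ i * v ^ j" for i j
  define w where "w = Q *\<^sub>q (u * v)"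
  have w0: "w $ 0 = 0" using u by (simp add: w_def)
  have T: "order_ge (i + j) (T i j)" for i j
    using order_ge_mult[OF order_ge_power[of 1 u i] order_ge_power[of 1 v j]] u v
    by (simp add: order_ge_1_iff[unfolded One_nat_def] T_def)
  have vu': "v ^ i * u ^ j = Q ^ (2 * (i * j)) *\<^sub>q T j i" for i j
    using scl_commute_power[OF vu, of i j] by (simp add: T_def power_mult)
  \<comment> \<open>Ordering the \<open>k\<close>-th power of \<open>u * v\<close> produces
    Q^(k(k-1)), and the scalar in \<open>w\<close> contributes Q^k.\<close>
  have wk: "w ^ k = Q ^ (k * k) *\<^sub>q T k k" for k
  proof (induction k)
    case (Suc k)
    have "w ^ Suc k = w ^ k * w"
      by (simp add: power_Suc2 del: power_Suc)
    also have "\<dots> = Q ^ (k * k) *\<^sub>q (u ^ k * v ^ k) * (Q *\<^sub>q (u * v))"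
      by (simp only: Suc T_def) (simp add: w_def)
    also have "\<dots> = (Q ^ (k * k) * Q) *\<^sub>q (u ^ k * (v ^ k * u ^ 1) * v)"
      by (simp add: scl_mult mult_ac)
    also have "\<dots> = (Q ^ (k * k) * Q * Q ^ (2 * k)) *\<^sub>q (u ^ k * u * (v ^ k * v))"
      unfolding vu' T_def by (simp add: scl_mult mult.assoc)
    also have "Q ^ (k * k) * Q * Q ^ (2 * k) = Q ^ (k * k + 1 + 2 * k)"
      by (simp add: power_add mult_ac)
    also have "k * k + 1 + 2 * k = Suc k * Suc k"
      by simp
    finally show ?case
      by (simp add: T_def power_Suc2 del: power_Suc)
  qed (simp add: T_def)
  let ?f = "\<lambda>(a, k, b). (c a * c k * c b * Q ^ (k * k)) *\<^sub>q T (a + k) (k + b)"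
  let ?S = "{(a, k, b). a + k \<le> l \<and> k + b \<le> l}"
  have monomials: "c a *\<^sub>q u ^ a * (c k *\<^sub>q w ^ k * c b *\<^sub>q v ^ b) = ?f (a, k, b)" for a k b
  proof -
    have "u ^ a * (T k k * v ^ b) = T (a + k) (k + b)"
      by (simp add: T_def power_add mult.assoc)
    then show ?thesis
      by (simp add: wk scl_mult mult_ac)
  qed
  have fin: "finite ({..l} \<times> {..l} \<times> {..l})" by simp
  have "fps_cong l (Phi Q u * Phi Q w * Phi Q v)
      ((\<Sum>a\<le>l. c a *\<^sub>q u ^ a) * (\<Sum>k\<le>l. c k *\<^sub>q w ^ k) * (\<Sum>b\<le>l. c b *\<^sub>q v ^ b))"
    unfolding c_def by (intro fps_cong_mult Phi_cong_finite u v w0)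
  also have "\<dots> = (\<Sum>a\<le>l. c a *\<^sub>q u ^ a) * ((\<Sum>k\<le>l. c k *\<^sub>q w ^ k) * (\<Sum>b\<le>l. c b *\<^sub>q v ^ b))"
    by (rule mult.assoc)
  also have "\<dots> = (\<Sum>a\<le>l. \<Sum>k\<le>l. \<Sum>b\<le>l. ?f (a, k, b))"
    unfolding sum_product unfolding sum_distrib_left monomials ..
  also have "\<dots> = sum ?f ({..l} \<times> {..l} \<times> {..l})"
    by (simp add: sum.cartesian_product)
  also have "fps_cong l \<dots> (sum ?f ?S)"
  proof (rule fps_cong_sum_subset[OF fin])
    fix x assume "x \<in> {..l} \<times> {..l} \<times> {..l} - ?S"
    then obtain a k b where x: "x = (a, k, b)" "l < a + k \<or> l < k + b" by (cases x) auto
    have "order_ge (Suc l) (T (a + k) (k + b))"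
      using T[of "a + k" "k + b"] x(2) by (auto simp: order_ge_def)
    then show "order_ge (Suc l) (?f x)"
      by (simp add: x order_ge_scl)
  qed auto
  also have "sum ?f ?S = (\<Sum>(i, j, k)\<in>{(i, j, k). i \<le> l \<and> j \<le> l \<and> k \<le> i \<and> k \<le> j}.
      (c (i - k) * c k * c (j - k) * Q ^ (k * k)) *\<^sub>q T i j)"
    by (rule sum.reindex_bij_witness[of _ "\<lambda>(i, j, k). (i - k, k, j - k)" "\<lambda>(a, k, b). (a + k, k + b, k)"]) auto
  also have "{(i, j, k). i \<le> l \<and> j \<le> l \<and> k \<le> i \<and> k \<le> j} = Sigma {..l} (\<lambda>i. Sigma {..l} (\<lambda>j. {k. k \<le> i \<and> k \<le> j}))"
    by auto
  also have "(\<Sum>(i, j, k)\<in>\<dots>. (c (i - k) * c k * c (j - k) * Q ^ (k * k)) *\<^sub>q T i j)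
      = (\<Sum>i\<le>l. \<Sum>j\<le>l. \<Sum>k | k \<le> i \<and> k \<le> j. (c (i - k) * c k * c (j - k) * Q ^ (k * k)) *\<^sub>q T i j)"
    by (subst sum.Sigma[symmetric], simp, simp, subst sum.Sigma[symmetric]) auto
  also have "\<dots> = (\<Sum>i\<le>l. \<Sum>j\<le>l. (c i * c j * Q ^ (2 * i * j)) *\<^sub>q T i j)"
  proof (intro sum.cong refl)
    fix i j
    have "(\<Sum>k | k \<le> i \<and> k \<le> j. c (i - k) * c k * c (j - k) * Q ^ (k * k))
        = (\<Sum>k\<le>i. if k \<le> j then c (i - k) * c k * c (j - k) * Q ^ (k * k) else 0)"
      by (subst sum.inter_filter[symmetric]) (auto intro!: sum.cong)
    then show "(\<Sum>k | k \<le> i \<and> k \<le> j. (c (i - k) * c k * c (j - k) * Q ^ (k * k)) *\<^sub>q T i j)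
        = (c i * c j * Q ^ (2 * i * j)) *\<^sub>q T i j"
      unfolding scl_sum_left[symmetric] c_def pentagon_coefficients[OF Q] by simp
  qed
  also have "\<dots> = (\<Sum>j\<le>l. \<Sum>i\<le>l. (c i * c j * Q ^ (2 * i * j)) *\<^sub>q T i j)"
    by (rule sum.swap)
  also have "\<dots> = (\<Sum>j\<le>l. c j *\<^sub>q v ^ j) * (\<Sum>i\<le>l. c i *\<^sub>q u ^ i)"
    unfolding sum_product by (intro sum.cong refl) (simp add: scl_mult vu' mult_ac)
  also have "fps_cong l \<dots> (Phi Q v * Phi Q u)"
    unfolding c_def by (intro fps_cong_mult fps_cong_sym[OF Phi_cong_finite] u v)
  finally show "fps_cong l (Phi Q v * Phi Q u) (Phi Q u * Phi Q (Q *\<^sub>q (u * v)) * Phi Q v)"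
    unfolding w_def by (rule fps_cong_sym)
qed

lemma power_eq_powi_mult:
  fixes Q :: "'a::field"
  assumes "Q \<noteq> 0" "int a = e + int b"
  shows "Q ^ a = Q powi e * Q ^ b"
  using assms by (metis power_int_add power_int_of_nat)

text \<open>
  The pentagon relations between the monomials below involve \<open>Phi (Q ^ 2)\<close>; a factor \<open>Phi Q\<close>
  is treated by splitting it into two such factors.
\<close>

locale quantum_plane =
  fixes Q :: ratfun and u v :: "'a::ratfun_algebra fps"
  assumes Q: "generic Q" and u0: "u $ 0 = 0" and v0: "v $ 0 = 0"
    and vu: "v * u = Q ^ 4 *\<^sub>q (u * v)"
begin

text \<open>The scalar is the Weyl ordering factor: with it the product of two monomials involves
  only the determinant of their exponents, and \<open>yy i j\<close> becomes the torus monomial of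
  \<open>i n + j n'\<close>.\<close>

definition yy :: "nat \<Rightarrow> nat \<Rightarrow> 'a fps" where
  "yy i j = Q ^ (2 * i * j) *\<^sub>q (u ^ i * v ^ j)"

lemma yy_mult: "yy i j * yy k m = Q powi (2 * (int j * int k - int i * int m)) *\<^sub>q yy (i + k) (j + m)"
proof -
  have "yy i j * yy k m = (Q ^ (2 * i * j) * Q ^ (2 * k * m)) *\<^sub>q (u ^ i * (v ^ j * u ^ k) * v ^ m)"
    by (simp add: yy_def scl_mult mult_ac)
  also have "\<dots> = (Q ^ (2 * i * j + 2 * k * m + 4 * (j * k))) *\<^sub>q (u ^ (i + k) * v ^ (j + m))"
    unfolding scl_commute_power[OF vu] by (simp add: scl_mult power_add mult.assoc power_mult)
  also have "Q ^ (2 * i * j + 2 * k * m + 4 * (j * k)) =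
      Q powi (2 * (int j * int k - int i * int m)) * Q ^ (2 * (i + k) * (j + m))"
    using Q by (intro power_eq_powi_mult) (auto simp: algebra_simps)
  finally show ?thesis
    by (simp add: yy_def scl_scl)
qed

lemma order_ge_yy:
  assumes "order_ge m u"
  shows "order_ge (m * i + j) (yy i j)"
  unfolding yy_def using order_ge_mult[OF order_ge_power[OF assms, of i] order_ge_power[of 1 v j]] v0
  by (intro order_ge_scl) (simp add: order_ge_1_iff[unfolded One_nat_def])

lemma order_ge_yy_1: "order_ge (i + j) (yy i j)"
  using order_ge_yy[of 1 i j] u0 by (simp add: order_ge_1_iff[unfolded One_nat_def])

lemma yy_nth_0 [simp]: "i + j > 0 \<Longrightarrow> yy i j $ 0 = 0"
  using order_ge_yy_1[of i j] by (simp add: order_ge_def)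

lemma yy_1_0 [simp]: "yy (Suc 0) 0 = u" and yy_0_1 [simp]: "yy 0 (Suc 0) = v"
  by (simp_all add: yy_def)

abbreviation F :: "'a fps \<Rightarrow> 'a fps" where
  "F \<equiv> Phi (Q ^ 2)"

lemma fission:
  assumes "i + j > 0" "a = Q * c" "b = inverse Q * c"
  shows "Phi Q (c *\<^sub>q yy i j) = F (a *\<^sub>q yy i j) * F (b *\<^sub>q yy i j)"
  using Phi_fission[OF Q, of "c *\<^sub>q yy i j"] assms by (simp add: scl_scl)

text \<open>For exponents of determinant 1 the monomials commute up to Q^4, the square of Q^2, as
  required by the pentagon relation for \<open>F\<close>. The factor Q^2 at its middle term is
  absorbed by the normalisation of \<open>yy\<close>.\<close>

lemma pentagon_yy:
  assumes "int j * int k - int i * int m = 1" "a = c * e" "p = i + k" "q = j + m"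
  shows "F (c *\<^sub>q yy i j) * F (e *\<^sub>q yy k m) = F (e *\<^sub>q yy k m) * F (a *\<^sub>q yy p q) * F (c *\<^sub>q yy i j)"
proof -
  have pos: "i + j > 0" "k + m > 0"
    using assms(1) by (auto intro!: Nat.gr0I)
  have 1: "yy i j * yy k m = Q ^ 2 *\<^sub>q yy p q"
    using yy_mult[of i j k m] assms by simp
  have "int m * int i - int k * int j = - 1"
    using assms(1) by (simp add: algebra_simps)
  then have 2: "yy k m * yy i j = inverse (Q ^ 2) *\<^sub>q yy p q"
    using yy_mult[of k m i j] assms by (simp add: add.commute power_int_minus)
  have "(c *\<^sub>q yy i j) * (e *\<^sub>q yy k m) = (Q ^ 2) ^ 2 *\<^sub>q ((e *\<^sub>q yy k m) * (c *\<^sub>q yy i j))"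
    using Q by (simp add: scl_mult 1 2 power2_eq_square mult_ac)
  from pentagon[OF generic_power[OF Q] _ _ this] pos
  have "F (c *\<^sub>q yy i j) * F (e *\<^sub>q yy k m) =
      F (e *\<^sub>q yy k m) * F (Q ^ 2 *\<^sub>q (e *\<^sub>q yy k m * c *\<^sub>q yy i j)) * F (c *\<^sub>q yy i j)"
    by simp
  also have "Q ^ 2 *\<^sub>q (e *\<^sub>q yy k m * c *\<^sub>q yy i j) = a *\<^sub>q yy p q"
    using Q assms(2) by (simp add: scl_mult 2 mult_ac)
  finally show ?thesis .
qed

text \<open>\<open>Phi Q\<close> is split into two \<open>F\<close>, and \<open>F\<close> at (i, j)
  moves past both. The new factor at (p, q) created first must still pass the second half; their
  exponents again have determinant 1, and this third pentagon creates the factor at (p',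
  q').\<close>

lemma exchange_F_Phi:
  assumes "int j * int k - int i * int m = 1" "p = i + k" "q = j + m" "p' = i + 2 * k" "q' = j + 2 * m"
    and "a = c * e" "a' = c * e * e"
  shows "F (c *\<^sub>q yy i j) * Phi Q (e *\<^sub>q yy k m) =
    Phi Q (e *\<^sub>q yy k m) * F (a' *\<^sub>q yy p' q') * Phi Q (a *\<^sub>q yy p q) * F (c *\<^sub>q yy i j)"
proof -
  have pos: "k + m > 0" "p + q > 0"
    using assms(1-3) by (auto intro!: Nat.gr0I)
  define b1 b2 a1 a2 where "b1 = Q * e" "b2 = inverse Q * e" "a1 = Q * a" "a2 = inverse Q * a"
  have 1: "F (c *\<^sub>q yy i j) * F (b1 *\<^sub>q yy k m) = F (b1 *\<^sub>q yy k m) * F (a1 *\<^sub>q yy p q) * F (c *\<^sub>q yy i j)"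
    by (rule pentagon_yy) (use assms in \<open>auto simp: b1_b2_a1_a2_def\<close>)
  have 2: "F (c *\<^sub>q yy i j) * F (b2 *\<^sub>q yy k m) = F (b2 *\<^sub>q yy k m) * F (a2 *\<^sub>q yy p q) * F (c *\<^sub>q yy i j)"
    by (rule pentagon_yy) (use assms in \<open>auto simp: b1_b2_a1_a2_def\<close>)
  have 3: "F (a1 *\<^sub>q yy p q) * F (b2 *\<^sub>q yy k m) = F (b2 *\<^sub>q yy k m) * F (a' *\<^sub>q yy p' q') * F (a1 *\<^sub>q yy p q)"
    by (rule pentagon_yy) (use assms Q in \<open>auto simp: b1_b2_a1_a2_def algebra_simps\<close>)
  have fe: "Phi Q (e *\<^sub>q yy k m) = F (b1 *\<^sub>q yy k m) * F (b2 *\<^sub>q yy k m)"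
    by (rule fission) (use pos in \<open>auto simp: b1_b2_a1_a2_def\<close>)
  have fa: "Phi Q (a *\<^sub>q yy p q) = F (a1 *\<^sub>q yy p q) * F (a2 *\<^sub>q yy p q)"
    by (rule fission) (use pos in \<open>auto simp: b1_b2_a1_a2_def\<close>)
  have "F (c *\<^sub>q yy i j) * Phi Q (e *\<^sub>q yy k m)
      = F (b1 *\<^sub>q yy k m) * F (a1 *\<^sub>q yy p q) * (F (c *\<^sub>q yy i j) * F (b2 *\<^sub>q yy k m))"
    unfolding fe by (simp add: 1 flip: mult.assoc)
  also have "\<dots> = F (b1 *\<^sub>q yy k m) * (F (a1 *\<^sub>q yy p q) * F (b2 *\<^sub>q yy k m)) * F (a2 *\<^sub>q yy p q) * F (c *\<^sub>q yy i j)"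
    unfolding 2 by (simp only: mult.assoc)
  also have "\<dots> = Phi Q (e *\<^sub>q yy k m) * F (a' *\<^sub>q yy p' q') * Phi Q (a *\<^sub>q yy p q) * F (c *\<^sub>q yy i j)"
    unfolding 3 fe fa by (simp only: mult.assoc)
  finally show ?thesis .
qed

text \<open>The mirror image of \<open>exchange_F_Phi\<close>, with the left factor split.\<close>

lemma exchange_Phi_F:
  assumes "int j * int k - int i * int m = 1" "p = i + k" "q = j + m" "p' = 2 * i + k" "q' = 2 * j + m"
    and "a = c * e" "a' = c * c * e"
  shows "Phi Q (c *\<^sub>q yy i j) * F (e *\<^sub>q yy k m) =
    F (e *\<^sub>q yy k m) * Phi Q (a *\<^sub>q yy p q) * F (a' *\<^sub>q yy p' q') * Phi Q (c *\<^sub>q yy i j)"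
proof -
  have pos: "i + j > 0" "p + q > 0"
    using assms(1-3) by (auto intro!: Nat.gr0I)
  define c1 c2 a1 a2 where "c1 = Q * c" "c2 = inverse Q * c" "a1 = Q * a" "a2 = inverse Q * a"
  have 1: "F (c1 *\<^sub>q yy i j) * F (e *\<^sub>q yy k m) = F (e *\<^sub>q yy k m) * F (a1 *\<^sub>q yy p q) * F (c1 *\<^sub>q yy i j)"
    by (rule pentagon_yy) (use assms in \<open>auto simp: c1_c2_a1_a2_def\<close>)
  have 2: "F (c2 *\<^sub>q yy i j) * F (e *\<^sub>q yy k m) = F (e *\<^sub>q yy k m) * F (a2 *\<^sub>q yy p q) * F (c2 *\<^sub>q yy i j)"
    by (rule pentagon_yy) (use assms in \<open>auto simp: c1_c2_a1_a2_def\<close>)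
  have 3: "F (c1 *\<^sub>q yy i j) * F (a2 *\<^sub>q yy p q) = F (a2 *\<^sub>q yy p q) * F (a' *\<^sub>q yy p' q') * F (c1 *\<^sub>q yy i j)"
    by (rule pentagon_yy) (use assms Q in \<open>auto simp: c1_c2_a1_a2_def algebra_simps\<close>)
  have fc: "Phi Q (c *\<^sub>q yy i j) = F (c1 *\<^sub>q yy i j) * F (c2 *\<^sub>q yy i j)"
    by (rule fission) (use pos in \<open>auto simp: c1_c2_a1_a2_def\<close>)
  have fa: "Phi Q (a *\<^sub>q yy p q) = F (a1 *\<^sub>q yy p q) * F (a2 *\<^sub>q yy p q)"
    by (rule fission) (use pos in \<open>auto simp: c1_c2_a1_a2_def\<close>)
  have "Phi Q (c *\<^sub>q yy i j) * F (e *\<^sub>q yy k m)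
      = F (c1 *\<^sub>q yy i j) * F (e *\<^sub>q yy k m) * F (a2 *\<^sub>q yy p q) * F (c2 *\<^sub>q yy i j)"
    unfolding fc by (simp add: 2 mult.assoc)
  also have "\<dots> = F (e *\<^sub>q yy k m) * F (a1 *\<^sub>q yy p q) * (F (c1 *\<^sub>q yy i j) * F (a2 *\<^sub>q yy p q)) * F (c2 *\<^sub>q yy i j)"
    unfolding 1 by (simp only: mult.assoc)
  also have "\<dots> = F (e *\<^sub>q yy k m) * Phi Q (a *\<^sub>q yy p q) * F (a' *\<^sub>q yy p' q') * Phi Q (c *\<^sub>q yy i j)"
    unfolding 3 fc fa by (simp only: mult.assoc)
  finally show ?thesis .
qed

end

section \<open>Factorization in a quantum plane\<close>

definition rprod :: "(nat \<Rightarrow> 'a::monoid_mult) \<Rightarrow> nat \<Rightarrow> 'a" where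
  "rprod f k = prod_list (map f [0..<k])"

definition lprod :: "(nat \<Rightarrow> 'a::monoid_mult) \<Rightarrow> nat \<Rightarrow> 'a" where
  "lprod f k = prod_list (map f (rev [0..<k]))"

lemma rprod_simps [simp]: "rprod f 0 = 1" "rprod f (Suc k) = rprod f k * f k"
  by (simp_all add: rprod_def)

lemma lprod_simps [simp]: "lprod f 0 = 1" "lprod f (Suc k) = f k * lprod f k"
  by (simp_all add: lprod_def)

lemma rprod_cong_trivial:
  fixes f :: "nat \<Rightarrow> 'a::semiring_1 fps"
  assumes "\<And>p. k \<le> p \<Longrightarrow> fps_cong l (f p) 1"
  shows "fps_cong l (rprod f (k + n)) (rprod f k)"
proof (induction n)
  case (Suc n)
  have "fps_cong l (rprod f (k + n) * f (k + n)) (rprod f k * 1)"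
    by (intro fps_cong_mult Suc assms) simp
  then show ?case by simp
qed simp

lemma lprod_cong_trivial:
  fixes f :: "nat \<Rightarrow> 'a::semiring_1 fps"
  assumes "\<And>p. k \<le> p \<Longrightarrow> fps_cong l (f p) 1"
  shows "fps_cong l (lprod f (k + n)) (lprod f k)"
proof (induction n)
  case (Suc n)
  have "fps_cong l (f (k + n) * lprod f (k + n)) (1 * lprod f k)"
    by (intro fps_cong_mult Suc assms) simp
  then show ?case by simp
qed simp

lemma ev_trivial:
  assumes "order_ge (Suc l) z" "p $ 0 = 1"
  shows "fps_cong l (ev p z) 1"
proof -
  have "fps_cong l z 0"
    using assms by (simp add: fps_cong_def order_ge_def)
  then have "fps_cong l (ev p z) (ev p 0)"
    by (rule ev_cong)
  also have "ev p (0 :: 'a fps) = 1"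
  proof (rule fps_ext)
    fix n
    have "(\<Sum>k\<le>n. p $ k *\<^sub>q (0 ^ k :: 'a fps) $ n) = (\<Sum>k\<le>n. if k = 0 then p $ 0 *\<^sub>q (1 :: 'a fps) $ n else 0)"
      by (intro sum.cong) (auto simp: power_0_left)
    then show "ev p (0 :: 'a fps) $ n = 1 $ n"
      using assms(2) by (simp add: ev_def)
  qed
  finally show ?thesis .
qed

lemma Phi_trivial: "order_ge (Suc l) z \<Longrightarrow> fps_cong l (Phi Q z) 1"
  unfolding Phi_def by (rule ev_trivial) auto

lemma Mid_trivial: "order_ge (Suc l) z \<Longrightarrow> fps_cong l (Mid Q z) 1"
  unfolding Mid_def by (rule ev_trivial) auto

lemma order_ge_mono: "order_ge m f \<Longrightarrow> n \<le> m \<Longrightarrow> order_ge n f"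
  by (simp add: order_ge_def)

section \<open>Moving factors to the centre, and the doubled quantum plane\<close>

context quantum_plane
begin

lemma yy_power: "yy i j ^ k = yy (k * i) (k * j)"
proof (induction k)
  case 0
  then show ?case by (simp add: yy_def)
next
  case (Suc k)
  then show ?case using yy_mult[of i j "k * i" "k * j"] by (simp add: algebra_simps)
qed

text \<open>After \<open>K\<close> exchanges exactly one \<open>F\<close> is unpaired, at (2K+2,
  2K+1) with scalar \<open>Q\<close>. The next factor of the product has the same exponent and
  scalar \<open>inverse Q\<close>: passing \<open>Phi Q (Q *\<^sub>q yy 1 1)\<close> it fuses with
  the unpaired one into a \<open>Phi Q\<close>, and the exchange creates the \<open>Phi Q\<close> at
  (2K+3, 2K+2) and the next unpaired \<open>F\<close>.\<close>

lemma left_shuffle: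
  "Phi Q u * F (Q *\<^sub>q yy 2 1) * Phi Q (Q *\<^sub>q yy 1 1) * rprod (\<lambda>p. F (inverse Q *\<^sub>q yy (2 * p + 2) (2 * p + 1))) K
   = rprod (\<lambda>p. Phi Q (yy (p + 1) p)) (2 * K + 1) * F (Q *\<^sub>q yy (2 * K + 2) (2 * K + 1)) * Phi Q (Q *\<^sub>q yy 1 1)"
proof (induction K)
  case (Suc K)
  let ?P = "rprod (\<lambda>p. Phi Q (yy (p + 1) p)) (2 * K + 1)"
  let ?y = "yy (2 * K + 2) (2 * K + 1)"
  have 1: "Phi Q (Q *\<^sub>q yy 1 1) * F (inverse Q *\<^sub>q ?y) = F (inverse Q *\<^sub>q ?y) *
      Phi Q (1 *\<^sub>q yy (2 * K + 3) (2 * K + 2)) * F (Q *\<^sub>q yy (2 * K + 4) (2 * K + 3)) * Phi Q (Q *\<^sub>q yy 1 1)"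
    by (rule exchange_Phi_F) (use Q in auto)
  have 2: "Phi Q (1 *\<^sub>q ?y) = F (Q *\<^sub>q ?y) * F (inverse Q *\<^sub>q ?y)"
    by (rule fission) auto
  have "Phi Q u * F (Q *\<^sub>q yy 2 1) * Phi Q (Q *\<^sub>q yy 1 1) *
      rprod (\<lambda>p. F (inverse Q *\<^sub>q yy (2 * p + 2) (2 * p + 1))) (Suc K)
      = ?P * F (Q *\<^sub>q ?y) * (Phi Q (Q *\<^sub>q yy 1 1) * F (inverse Q *\<^sub>q ?y))"
    unfolding rprod_simps mult.assoc[symmetric] Suc ..
  also have "\<dots> = ?P * Phi Q ?y * Phi Q (yy (2 * K + 3) (2 * K + 2)) *
      F (Q *\<^sub>q yy (2 * K + 4) (2 * K + 3)) * Phi Q (Q *\<^sub>q yy 1 1)"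
    unfolding 1 using 2 by (simp add: mult.assoc)
  also have "?P * Phi Q ?y * Phi Q (yy (2 * K + 3) (2 * K + 2)) = rprod (\<lambda>p. Phi Q (yy (p + 1) p)) (2 * Suc K + 1)"
    by (simp add: numeral_3_eq_3)
  finally show ?case
    by (simp add: numeral_eq_Suc)
qed (simp add: numeral_2_eq_2)

text \<open>As for \<open>left_shuffle\<close>, with the unpaired \<open>F\<close> now carrying the
  scalar \<open>inverse Q\<close>. It starts at (0, 1) without a completed \<open>Phi Q\<close>, so
  there are \<open>2 * K\<close> complete factors and not \<open>2 * K + 1\<close>.\<close>

lemma right_shuffle:
  "lprod (\<lambda>p. F (Q *\<^sub>q yy (2 * p) (2 * p + 1))) K * Phi Q (inverse Q *\<^sub>q yy 1 1) * F (inverse Q *\<^sub>q v)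
   = Phi Q (inverse Q *\<^sub>q yy 1 1) * F (inverse Q *\<^sub>q yy (2 * K) (2 * K + 1)) * lprod (\<lambda>p. Phi Q (yy p (p + 1))) (2 * K)"
proof (induction K)
  case (Suc K)
  let ?P = "lprod (\<lambda>p. Phi Q (yy p (p + 1))) (2 * K)"
  let ?z = "yy (2 * K) (2 * K + 1)"
  have 1: "F (Q *\<^sub>q ?z) * Phi Q (inverse Q *\<^sub>q yy 1 1) = Phi Q (inverse Q *\<^sub>q yy 1 1) *
      F (inverse Q *\<^sub>q yy (2 * K + 2) (2 * K + 3)) * Phi Q (1 *\<^sub>q yy (2 * K + 1) (2 * K + 2)) * F (Q *\<^sub>q ?z)"
    by (rule exchange_F_Phi) (use Q in auto)
  have 2: "Phi Q (1 *\<^sub>q ?z) = F (Q *\<^sub>q ?z) * F (inverse Q *\<^sub>q ?z)"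
    by (rule fission) auto
  have "lprod (\<lambda>p. F (Q *\<^sub>q yy (2 * p) (2 * p + 1))) (Suc K) * Phi Q (inverse Q *\<^sub>q yy 1 1) * F (inverse Q *\<^sub>q v)
      = F (Q *\<^sub>q ?z) * (lprod (\<lambda>p. F (Q *\<^sub>q yy (2 * p) (2 * p + 1))) K * Phi Q (inverse Q *\<^sub>q yy 1 1) * F (inverse Q *\<^sub>q v))"
    by (simp add: mult.assoc)
  also have "\<dots> = (F (Q *\<^sub>q ?z) * Phi Q (inverse Q *\<^sub>q yy 1 1)) * F (inverse Q *\<^sub>q ?z) * ?P"
    unfolding Suc by (simp only: mult.assoc)
  also have "\<dots> = Phi Q (inverse Q *\<^sub>q yy 1 1) * F (inverse Q *\<^sub>q yy (2 * K + 2) (2 * K + 3)) *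
      (Phi Q (yy (2 * K + 1) (2 * K + 2)) * (Phi Q ?z * ?P))"
    unfolding 1 using 2 by (simp add: mult.assoc)
  also have "Phi Q (yy (2 * K + 1) (2 * K + 2)) * (Phi Q ?z * ?P) = lprod (\<lambda>p. Phi Q (yy p (p + 1))) (2 * Suc K)"
    by simp
  finally show ?case
    by (simp add: numeral_eq_Suc)
qed simp

text \<open>\<open>Phi Q v\<close> is split into \<open>F (Q *\<^sub>q v)\<close> and
  \<open>F (inverse Q *\<^sub>q v)\<close>, and each half is moved past \<open>Phi Q u\<close> by
  \<open>exchange_F_Phi\<close>.\<close>

lemma first_step:
  "Phi Q v * Phi Q u = (Phi Q u * F (Q *\<^sub>q yy 2 1) * Phi Q (Q *\<^sub>q yy 1 1)) *
     (F (Q *\<^sub>q v) * F (inverse Q *\<^sub>q yy 2 1)) * (Phi Q (inverse Q *\<^sub>q yy 1 1) * F (inverse Q *\<^sub>q v))"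
proof -
  have ex: "F (c *\<^sub>q yy 0 1) * Phi Q (1 *\<^sub>q yy 1 0) =
      Phi Q (1 *\<^sub>q yy 1 0) * F (c *\<^sub>q yy 2 1) * Phi Q (c *\<^sub>q yy 1 1) * F (c *\<^sub>q yy 0 1)" for c
    by (rule exchange_F_Phi) auto
  have "Phi Q (1 *\<^sub>q yy 0 1) = F (Q *\<^sub>q yy 0 1) * F (inverse Q *\<^sub>q yy 0 1)"
    by (rule fission) auto
  then have "Phi Q v * Phi Q u = F (Q *\<^sub>q v) * (F (inverse Q *\<^sub>q v) * Phi Q u)"
    by (simp add: mult.assoc)
  also have "F (inverse Q *\<^sub>q v) * Phi Q u =
      Phi Q u * (F (inverse Q *\<^sub>q yy 2 1) * (Phi Q (inverse Q *\<^sub>q yy 1 1) * F (inverse Q *\<^sub>q v)))"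
    using ex[of "inverse Q"] by (simp add: mult.assoc)
  also have "F (Q *\<^sub>q v) * \<dots> = (F (Q *\<^sub>q v) * Phi Q u) *
      (F (inverse Q *\<^sub>q yy 2 1) * (Phi Q (inverse Q *\<^sub>q yy 1 1) * F (inverse Q *\<^sub>q v)))"
    by (simp only: mult.assoc)
  also have "F (Q *\<^sub>q v) * Phi Q u = Phi Q u * F (Q *\<^sub>q yy 2 1) * Phi Q (Q *\<^sub>q yy 1 1) * F (Q *\<^sub>q v)"
    using ex[of Q] by simp
  finally show ?thesis
    by (simp only: mult.assoc)
qed

text \<open>The exponents (0, 1) and (2, 1) have determinant 2, so these monomials commute up to
  Q^8, the fourth power of Q^2: the two central factors of \<open>first_step\<close> are again a
  product to be factorized, with \<open>Q ^ 2\<close> for \<open>Q\<close>.\<close>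

lemma quantum_plane_double: "quantum_plane (Q ^ 2) (inverse Q *\<^sub>q yy 2 1) (Q *\<^sub>q v)"
proof
  show "generic (Q ^ 2)" using Q by (rule generic_power) simp
  show "(inverse Q *\<^sub>q yy 2 1) $ 0 = 0" by simp
  show "(Q *\<^sub>q v) $ 0 = 0" by (simp add: v0)
  have 1: "v * yy 2 1 = Q ^ 4 *\<^sub>q yy 2 2" and 2: "yy 2 1 * v = inverse (Q ^ 4) *\<^sub>q yy 2 2"
    using yy_mult[of 0 1 2 1] yy_mult[of 2 1 0 1] by (simp_all add: power_int_minus numeral_2_eq_2)
  have "(Q ^ 2) ^ 4 = Q ^ 4 * Q ^ 4"
    by (simp flip: power_add power_mult)
  with Q have "inverse Q * (Q * Q ^ 4) = (Q ^ 2) ^ 4 * (Q * (inverse Q * inverse (Q ^ 4)))"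
    by (simp add: field_simps)
  then show "Q *\<^sub>q v * inverse Q *\<^sub>q yy 2 1 = (Q ^ 2) ^ 4 *\<^sub>q (inverse Q *\<^sub>q yy 2 1 * Q *\<^sub>q v)"
    unfolding scl_mult_left scl_mult_right 1 2 by (simp only: scl_scl)
qed

text \<open>The scalar Q^(j-i) is \<open>inverse Q\<close> at (p+1, p), \<open>Q\<close> at (p, p+1)
  and 1 at (1, 1): exactly the scalars from which the two shuffles start, and the ones that let the
  centre be squared.\<close>

lemma yy_double:
  "quantum_plane.yy (Q ^ 2) (inverse Q *\<^sub>q yy 2 1) (Q *\<^sub>q v) i j = (inverse Q ^ i * Q ^ j) *\<^sub>q yy (2 * i) (i + j)"
proof -
  have "v ^ j = yy 0 j"
    by (simp add: yy_def)
  moreover have "yy 2 1 ^ i = yy (2 * i) i"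
    by (simp add: yy_power mult.commute)
  moreover have "yy (2 * i) i * yy 0 j = inverse ((Q ^ 2) ^ (2 * i * j)) *\<^sub>q yy (2 * i) (i + j)"
  proof -
    have "2 * (int i * int 0 - int (2 * i) * int j) = - int (2 * (2 * i * j))"
      by simp
    then show ?thesis
      using yy_mult[of "2 * i" i 0 j] by (simp only: power_int_minus power_int_of_nat power_mult add_0_right)
  qed
  moreover have "(Q ^ 2) ^ (2 * i * j) * (Q ^ j * (inverse Q ^ i * inverse ((Q ^ 2) ^ (2 * i * j)))) = inverse Q ^ i * Q ^ j"
    using Q by (simp add: field_simps)
  ultimately show ?thesis
    unfolding quantum_plane.yy_def[OF quantum_plane_double] scl_power scl_mult_left scl_mult_right
    by (simp only: scl_scl)
qed

end

text \<open>Induction on a bound \<open>N\<close> for the gap between \<open>l\<close> and the order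
  of \<open>u\<close>. Doubling raises the order of \<open>u\<close> at least by one and leaves that
  of \<open>v\<close> unchanged; once \<open>u\<close> has order above \<open>l\<close>, both sides
  reduce to \<open>Phi Q v\<close>.\<close>

theorem kronecker_factorization_cong:
  assumes "quantum_plane Q u v" "order_ge m u" "l < m + N" "l < K"
  shows "fps_cong l (Phi Q v * Phi Q u)
    (rprod (\<lambda>p. Phi Q (quantum_plane.yy Q u v (p + 1) p)) K * Mid Q (quantum_plane.yy Q u v 1 1) *
     lprod (\<lambda>p. Phi Q (quantum_plane.yy Q u v p (p + 1))) K)"
  using assms
proof (induction N arbitrary: Q u v m K)
  case 0
  interpret quantum_plane Q u v by fact
  have yy: "order_ge (Suc l) (yy i j)" if "i > 0" for i j
  proof (rule order_ge_mono[OF order_ge_yy[OF \<open>order_ge m u\<close>]])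
    have "m \<le> m * i" using that by simp
    with 0 show "Suc l \<le> m * i + j" by linarith
  qed
  \<comment> \<open>The factor with index 0 of the left product is \<open>Phi Q v\<close>, the only
    factor not involving \<open>u\<close>; it is kept apart from the trivial ones.\<close>
  obtain K' where K: "K = 1 + K'" using \<open>l < K\<close> by (cases K) auto
  have "fps_cong l (rprod (\<lambda>p. Phi Q (yy (p + 1) p)) (0 + K)) (rprod (\<lambda>p. Phi Q (yy (p + 1) p)) 0)"
    by (intro rprod_cong_trivial Phi_trivial yy) simp
  moreover have "fps_cong l (lprod (\<lambda>p. Phi Q (yy p (p + 1))) (1 + K')) (lprod (\<lambda>p. Phi Q (yy p (p + 1))) 1)"
    by (intro lprod_cong_trivial Phi_trivial yy) simp
  moreover have "fps_cong l (Mid Q (yy 1 1)) 1"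
    by (intro Mid_trivial yy) simp
  ultimately have "fps_cong l (rprod (\<lambda>p. Phi Q (yy (p + 1) p)) K * Mid Q (yy 1 1) * lprod (\<lambda>p. Phi Q (yy p (p + 1))) K)
      (1 * 1 * Phi Q v)"
    unfolding K by (intro fps_cong_mult) simp_all
  moreover have "fps_cong l (Phi Q v * Phi Q u) (Phi Q v * 1)"
    using yy[of 1 0] by (intro fps_cong_mult Phi_trivial) auto
  ultimately show ?case
    by (auto intro: fps_cong_trans fps_cong_sym)
next
  case (Suc N)
  interpret quantum_plane Q u v by fact
  let ?u = "inverse Q *\<^sub>q yy 2 1" and ?v = "Q *\<^sub>q v"
  let ?y = "quantum_plane.yy (Q ^ 2) ?u ?v"
  let ?A = "rprod (\<lambda>p. F (inverse Q *\<^sub>q yy (2 * p + 2) (2 * p + 1))) K"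
  let ?C = "lprod (\<lambda>p. F (Q *\<^sub>q yy (2 * p) (2 * p + 1))) K"
  let ?R = "\<lambda>k. rprod (\<lambda>p. Phi Q (yy (p + 1) p)) k" and ?L = "\<lambda>k. lprod (\<lambda>p. Phi Q (yy p (p + 1))) k"
  have y: "?y (p + 1) p = inverse Q *\<^sub>q yy (2 * p + 2) (2 * p + 1)"
    "?y p (p + 1) = Q *\<^sub>q yy (2 * p) (2 * p + 1)" "?y 1 1 = yy 1 1 ^ 2" for p
  proof -
    have "inverse Q ^ (p + 1) * Q ^ p = inverse Q" "inverse Q ^ p * Q ^ (p + 1) = Q"
      using Q by (simp_all add: power_inverse field_simps)
    then show "?y (p + 1) p = inverse Q *\<^sub>q yy (2 * p + 2) (2 * p + 1)"
      "?y p (p + 1) = Q *\<^sub>q yy (2 * p) (2 * p + 1)"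
      unfolding yy_double by (simp_all only: distrib_left mult_2 add_ac mult_1_right one_add_one)
    show "?y 1 1 = yy 1 1 ^ 2"
      using Q unfolding yy_double yy_power by (simp add: numeral_2_eq_2)
  qed
  \<comment> \<open>The factor \<open>v\<close> in \<open>yy 2 1\<close> supplies the summand 1, so
    the order grows even when \<open>m = 0\<close>.\<close>
  have "order_ge (m * 2 + 1) ?u"
    by (intro order_ge_scl order_ge_yy) fact
  then have "order_ge (Suc m) ?u"
    by (rule order_ge_mono) simp
  from Suc.IH[OF quantum_plane_double this, of K] Suc.prems
  have IH: "fps_cong l (F ?v * F ?u) (?A * Mid (Q ^ 2) (yy 1 1 ^ 2) * ?C)"
    unfolding y by simp
  have triv: "fps_cong l (Phi Q' (c *\<^sub>q yy i j)) 1" if "l < i + j" for Q' c i j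
    by (intro Phi_trivial order_ge_scl order_ge_mono[OF order_ge_yy_1]) (use that in simp)
  have R: "fps_cong l (?R (K + n)) (?R K)" for n
    using triv[where c = 1] Suc.prems by (intro rprod_cong_trivial) simp
  have L: "fps_cong l (?L (K + n)) (?L K)" for n
    using triv[where c = 1] Suc.prems by (intro lprod_cong_trivial) simp
  have "fps_cong l (Phi Q v * Phi Q u) ((Phi Q u * F (Q *\<^sub>q yy 2 1) * Phi Q (Q *\<^sub>q yy 1 1)) *
     (?A * Mid (Q ^ 2) (yy 1 1 ^ 2) * ?C) * (Phi Q (inverse Q *\<^sub>q yy 1 1) * F (inverse Q *\<^sub>q v)))"
    unfolding first_step by (intro fps_cong_mult IH) auto
  also have "\<dots> = (Phi Q u * F (Q *\<^sub>q yy 2 1) * Phi Q (Q *\<^sub>q yy 1 1) * ?A) * Mid (Q ^ 2) (yy 1 1 ^ 2) *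
      (?C * Phi Q (inverse Q *\<^sub>q yy 1 1) * F (inverse Q *\<^sub>q v))"
    by (simp only: mult.assoc)
  also have "\<dots> = ?R (K + (K + 1)) * F (Q *\<^sub>q yy (2 * K + 2) (2 * K + 1)) *
      (Phi Q (Q *\<^sub>q yy 1 1) * Mid (Q ^ 2) (yy 1 1 ^ 2) * Phi Q (inverse Q *\<^sub>q yy 1 1)) *
      (F (inverse Q *\<^sub>q yy (2 * K) (2 * K + 1)) * ?L (K + K))"
    unfolding left_shuffle right_shuffle by (simp only: mult.assoc mult_2 add.assoc)
  \<comment> \<open>All factors with index at least \<open>K\<close>, and both unpaired
    \<open>F\<close>, have exponent sum above \<open>l\<close> and are trivial up to degree
    \<open>l\<close>.\<close>
  also have "fps_cong l \<dots> (?R K * 1 *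
      (Phi Q (Q *\<^sub>q yy 1 1) * Mid (Q ^ 2) (yy 1 1 ^ 2) * Phi Q (inverse Q *\<^sub>q yy 1 1)) * (1 * ?L K))"
    using Suc.prems by (intro fps_cong_mult R L triv) auto
  also have "Phi Q (Q *\<^sub>q yy 1 1) * Mid (Q ^ 2) (yy 1 1 ^ 2) * Phi Q (inverse Q *\<^sub>q yy 1 1) = Mid Q (yy 1 1)"
    by (rule Mid_rec[symmetric]) (use Q in auto)
  finally show ?case by simp
qed

corollary (in quantum_plane) kronecker_factorization:
  assumes "l < K"
  shows "fps_cong l (Phi Q v * Phi Q u)
    (rprod (\<lambda>p. Phi Q (yy (p + 1) p)) K * Mid Q (yy 1 1) * lprod (\<lambda>p. Phi Q (yy p (p + 1))) K)"
  by (rule kronecker_factorization_cong[where m = 0 and N = "Suc l"])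
    (use assms quantum_plane_axioms in auto)

text \<open>Iterates \<open>Mid_rec\<close>. Its three factors are series in one element, hence
  commute, so both dilogarithms can be collected to the left of the remainder.\<close>

lemma Mid_partial_product:
  assumes "generic Q" "w $ 0 = 0"
  shows "Mid Q w = rprod (\<lambda>p. Phi (Q ^ 2 ^ p) (inverse (Q ^ 2 ^ p) *\<^sub>q w ^ 2 ^ p) * Phi (Q ^ 2 ^ p) (Q ^ 2 ^ p *\<^sub>q w ^ 2 ^ p)) K
    * Mid (Q ^ 2 ^ K) (w ^ 2 ^ K)"
proof (induction K)
  case (Suc K)
  let ?Q = "Q ^ 2 ^ K" and ?w = "w ^ 2 ^ K"
  have Q: "generic ?Q" using assms(1) by (rule generic_power) simp
  have w: "?w $ 0 = 0" using assms(2) by (simp add: fps_nth_power_0 zero_power)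
  have sq: "?Q ^ 2 = Q ^ 2 ^ Suc K" "?w ^ 2 = w ^ 2 ^ Suc K"
    by (simp_all add: mult.commute flip: power_mult)
  have "Mid ?Q ?w = Phi ?Q (inverse ?Q *\<^sub>q ?w) * Phi ?Q (?Q *\<^sub>q ?w) * Mid (?Q ^ 2) (?w ^ 2)"
  proof -
    have com: "ev p ?w * ev q ?w = ev q ?w * ev p ?w" for p q
      using w by (simp add: mult.commute flip: ev_mult)
    have "Mid (?Q ^ 2) (?w ^ 2) = ev (fps_exp 1 oo mid_log (?Q ^ 2) oo fps_X ^ 2) ?w"
      unfolding Mid_def using w by (subst ev_compose) (simp_all add: ev_power fps_nth_power_0)
    then have "Mid (?Q ^ 2) (?w ^ 2) * Phi ?Q (inverse ?Q *\<^sub>q ?w) = Phi ?Q (inverse ?Q *\<^sub>q ?w) * Mid (?Q ^ 2) (?w ^ 2)"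
      unfolding Phi_scl using com by simp
    then show ?thesis
      using Mid_rec[OF Q w] Phi_commute[OF w, of ?Q ?Q ?Q "inverse ?Q"]
      by (simp add: mult.assoc) (simp flip: mult.assoc)
  qed
  with Suc show ?case
    by (simp add: mult.assoc sq)
qed simp

section \<open>Quantum dilogarithm elements of the group\<close>

definition fmon :: "'a::semiring_1 \<Rightarrow> nat \<Rightarrow> 'a fps" where
  "fmon x m = fps_const x * fps_X ^ m"

lemma fmon_nth: "fmon x m $ k = (if k = m then x else 0)"
  by (simp add: fmon_def)

lemma fmon_mult: "fmon x m * fmon y k = fmon (x * y) (m + k)"
proof -
  have "fmon x m * fmon y k = fps_const x * (fps_X ^ m * fps_const y) * fps_X ^ k"
    by (simp add: fmon_def mult.assoc)
  also have "fps_X ^ m * fps_const y = fps_const y * fps_X ^ m"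
    by (rule fps_mult_fps_X_power_commute)
  finally show ?thesis
    by (simp add: fmon_def power_add mult.assoc flip: fps_const_mult)
qed

lemma fmon_power: "fmon x m ^ j = fmon (x ^ j) (j * m)"
proof (induction j)
  case (Suc j)
  then show ?case by (simp add: fmon_mult)
qed (simp add: fmon_def)

lemma scl_fmon: "c *\<^sub>q fmon x m = fmon (c *\<^sub>q x) m"
  by (simp add: fps_eq_iff fmon_nth)

lemma fracs_add: "a \<in> fracs d \<Longrightarrow> b \<in> fracs d \<Longrightarrow> a + b \<in> fracs d"
  unfolding fracs_def by (auto simp flip: add_divide_distrib of_int_add)

lemma fracs_minus: "a \<in> fracs d \<Longrightarrow> - a \<in> fracs d"
proof -
  assume "a \<in> fracs d"
  then obtain k where "a = of_int k / of_nat (delta0 d)" unfolding fracs_def by auto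
  then have "- a = of_int (- k) / of_nat (delta0 d)" by simp
  then show ?thesis unfolding fracs_def by blast
qed

lemma fracs_of_nat_mult: "a \<in> fracs d \<Longrightarrow> of_nat j * a \<in> fracs d"
proof -
  assume "a \<in> fracs d"
  then obtain k where "a = of_int k / of_nat (delta0 d)" unfolding fracs_def by auto
  then have "of_nat j * a = of_int (int j * k) / of_nat (delta0 d)" by simp
  then show ?thesis unfolding fracs_def by blast
qed

context fixed_data
begin

definition qexponent :: "rat \<Rightarrow> int" where
  "qexponent a = \<lfloor>of_nat (delta0 d) * a\<rfloor>"

lemma of_int_qexponent:
  assumes "a \<in> fracs d"
  shows "of_int (qexponent a) = of_nat (delta0 d) * a"
proof -
  obtain k where "a = of_int k / of_nat (delta0 d)"
    using assms unfolding fracs_def by auto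
  then show ?thesis
    using delta0_pos by (simp add: qexponent_def)
qed

lemma qpow_eq: "qpow d a = tvar powi qexponent a"
  by (simp add: qpow_def qexponent_def)

lemma qexponent_eqI:
  assumes "a \<in> fracs d" "of_int k = of_nat (delta0 d) * a"
  shows "qexponent a = k"
  using of_int_qexponent[OF assms(1)] assms(2) by (metis of_int_eq_iff)

lemma qexponent_add: "a \<in> fracs d \<Longrightarrow> b \<in> fracs d \<Longrightarrow> qexponent (a + b) = qexponent a + qexponent b"
  by (intro qexponent_eqI fracs_add) (auto simp: of_int_qexponent algebra_simps)

lemma qexponent_minus: "a \<in> fracs d \<Longrightarrow> qexponent (- a) = - qexponent a"
  by (intro qexponent_eqI fracs_minus) (auto simp: of_int_qexponent)

lemma qexponent_of_nat_mult: "a \<in> fracs d \<Longrightarrow> qexponent (of_nat j * a) = int j * qexponent a"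
  by (intro qexponent_eqI fracs_of_nat_mult) (auto simp: of_int_qexponent)

lemma qpow_add: "a \<in> fracs d \<Longrightarrow> b \<in> fracs d \<Longrightarrow> qpow d (a + b) = qpow d a * qpow d b"
  by (simp add: qpow_eq qexponent_add power_int_add)

lemma qpow_minus: "a \<in> fracs d \<Longrightarrow> qpow d (- a) = inverse (qpow d a)"
  by (simp add: qpow_eq qexponent_minus power_int_minus)

lemma qpow_of_nat_mult: "a \<in> fracs d \<Longrightarrow> qpow d (of_nat j * a) = qpow d a ^ j"
  by (simp add: qpow_eq qexponent_of_nat_mult power_int_mult mult.commute[of "int j"])

lemma generic_qpow:
  assumes "a \<in> fracs d" "a > 0"
  shows "generic (qpow d a)"
proof -
  have "(of_int (qexponent a) :: rat) > 0"
    unfolding of_int_qexponent[OF assms(1)] using assms(2) delta0_pos by simp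
  then have pos: "qexponent a > 0" by simp
  have "qpow d a ^ j = tvar powi (qexponent a * int j)" for j
    by (simp add: qpow_eq power_int_mult)
  with pos show ?thesis
    by (auto simp: generic_def tvar_powi_eq_1_iff) (simp add: qpow_eq)
qed

lemma torus_zero: "torus 0 = 1"
proof (rule linop_eqI)
  fix f i
  have "omega 0 i = 0"
    using omega_add_left[of 0 0 i] by simp
  then show "Rep_linop (torus 0) f i = Rep_linop 1 f i"
    by (simp add: Rep_linop_simps Rep_linop_torus)
qed

lemma omega_scale_left: "omega (int i *s m) n = int i * omega m n"
proof -
  have "(of_int (omega (int i *s m) n) :: rat) = of_int (int i * omega m n)"
    by (simp add: of_int_omega B_scale_left)
  then show ?thesis by (simp only: of_int_eq_iff)
qed

lemma omega_scale_right: "omega m (int i *s n) = int i * omega m n"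
  using omega_scale_left[of i n m] omega_skew[of m n] omega_skew[of m "int i *s n"] by simp

lemma torus_power: "torus n ^ j = torus (int j *s n)"
proof (induction j)
  case (Suc j)
  have "int (Suc j) *s n = n + int j *s n"
    by (simp add: vec_eq_iff algebra_simps)
  with Suc show ?case
    by (simp add: torus_mult omega_scale_right)
qed (simp add: torus_zero)

definition qmon :: "int ^ 'r \<Rightarrow> rat \<Rightarrow> (int ^ 'r) linop fps" where
  "qmon n b = fmon (qpow d b *\<^sub>q torus n) (deg n)"

lemma qmon_nth_0 [simp]: "n \<in> Nplus \<Longrightarrow> qmon n b $ 0 = 0"
  using deg_pos[of n] by (simp add: qmon_def fmon_nth)

lemma deg_combination:
  assumes "n \<in> Nplus" "n' \<in> Nplus"
  shows "deg (int i *s n + int j *s n') = i * deg n + j * deg n'"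
proof -
  have "(\<Sum>k\<in>UNIV. vec_nth (int i *s n + int j *s n') k) =
      int i * (\<Sum>k\<in>UNIV. vec_nth n k) + int j * (\<Sum>k\<in>UNIV. vec_nth n' k)"
    by (simp add: sum.distrib sum_distrib_left)
  then show ?thesis
    using assms unfolding deg_def Nplus_def by (simp add: nat_add_distrib nat_mult_distrib)
qed

lemma deg_scale: "n \<in> Nplus \<Longrightarrow> deg (int j *s n) = j * deg n"
  using deg_combination[of n n j 0] by simp

lemma Nplus_combination:
  assumes "n \<in> Nplus" "n' \<in> Nplus" "i + j > 0"
  shows "int i *s n + int j *s n' \<in> Nplus"
proof -
  have "deg (int i *s n + int j *s n') > 0"
    using assms deg_pos[of n] deg_pos[of n'] by (auto simp: deg_combination)
  with assms show ?thesis
    by (auto simp: Nplus_def deg_def)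
qed

lemma Nplus_scale: "n \<in> Nplus \<Longrightarrow> j > 0 \<Longrightarrow> int j *s n \<in> Nplus"
  using Nplus_combination[of n n j 0] by simp

lemma qdilog_in_ghat:
  assumes "n \<in> Nplus"
  shows "qdilog d n a b \<in> ghat"
  using Nplus_scale[OF assms] unfolding ghat_def qdilog_def
  by (auto intro!: sum.neutral)

lemma qmon_power: "n \<in> Nplus \<Longrightarrow> b \<in> fracs d \<Longrightarrow> qmon n b ^ j = qmon (int j *s n) (of_nat j * b)"
  by (simp add: qmon_def fmon_power scl_power torus_power qpow_of_nat_mult deg_scale)

lemma qnum_mult_qdiff:
  assumes "a \<in> fracs d"
  shows "qnum d (of_nat j * a) * qdiff = qpow d a ^ j - inverse (qpow d a) ^ j"
proof -
  have "qpow d (- (of_nat j * a)) = inverse (qpow d a) ^ j"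
    using qpow_of_nat_mult[OF fracs_minus[OF assms], of j] by (simp add: qpow_minus assms)
  then show ?thesis
    by (simp add: qnum_def qdiff_def[symmetric] qpow_of_nat_mult[OF assms])
qed

text \<open>The \<open>j\<close>-th power of q^b Y_n is q^(jb) Y_(jn), located at degree
  \<open>j * deg n\<close>; the sum over lattice points of degree \<open>k\<close> becomes a sum
  over \<open>j\<close>.\<close>

lemma emb_qdilog:
  assumes n: "n \<in> Nplus" and a: "a \<in> fracs d" and b: "b \<in> fracs d"
  shows "emb (qdilog d n a b) = ev (dilog_log (qpow d a)) (qmon n b)"
proof (rule fps_ext)
  fix k
  let ?A = "\<lambda>j. (- 1) ^ (j + 1) / (of_nat j * qnum d (of_nat j * a)) * qpow d (of_nat j * b)"
  let ?L = "dilog_log (qpow d a)"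
  have A: "?A j / qdiff = ?L $ j * qpow d b ^ j" if "j > 0" for j
    using that qnum_mult_qdiff[OF a, of j]
    by (simp add: dilog_log_def qpow_of_nat_mult b mult.assoc)
  \<comment> \<open>Bounding \<open>j\<close> by \<open>k\<close> makes the range of the inner sum
    independent of \<open>m\<close>, so the two sums can be exchanged.\<close>
  have idx: "{j. j \<ge> 1 \<and> int j *s n = m} = {j \<in> {1..k}. int j *s n = m}" if "m \<in> level k" for m
  proof -
    have "j \<le> k" if "int j *s n = m" for j
    proof -
      have "j \<le> j * deg n" using deg_pos[OF n] by simp
      also have "\<dots> = k"
        using deg_scale[OF n, of j] \<open>m \<in> level k\<close> that by (simp add: level_def)
      finally show ?thesis .
    qed
    then show ?thesis by auto
  qed
  have "emb (qdilog d n a b) $ k = (\<Sum>m\<in>level k. \<Sum>j\<in>{1..k}. if int j *s n = m then (?A j / qdiff) *\<^sub>q torus m else 0)"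
    unfolding emb_nth qdilog_def
  proof (intro sum.cong refl)
    fix m assume "m \<in> level k"
    then have "((\<Sum>j | 1 \<le> j \<and> int j *s n = m. ?A j) / qdiff) *\<^sub>q torus m
        = (\<Sum>j\<in>{j \<in> {1..k}. int j *s n = m}. (?A j / qdiff) *\<^sub>q torus m)"
      by (simp only: idx sum_divide_distrib scl_sum_left)
    also have "\<dots> = (\<Sum>j\<in>{1..k}. if int j *s n = m then (?A j / qdiff) *\<^sub>q torus m else 0)"
      by (rule sum.inter_filter) simp
    finally show "((\<Sum>j | 1 \<le> j \<and> int j *s n = m. ?A j) / qdiff) *\<^sub>q torus m
        = (\<Sum>j\<in>{1..k}. if int j *s n = m then (?A j / qdiff) *\<^sub>q torus m else 0)" .
  qed
  also have "\<dots> = (\<Sum>j\<in>{1..k}. \<Sum>m\<in>level k. if int j *s n = m then (?A j / qdiff) *\<^sub>q torus m else 0)"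
    by (rule sum.swap)
  also have "\<dots> = (\<Sum>j\<in>{1..k}. ?L $ j *\<^sub>q (qmon n b ^ j) $ k)"
  proof (intro sum.cong refl)
    fix j assume j: "j \<in> {1..k}"
    have "(\<Sum>m\<in>level k. if int j *s n = m then (?A j / qdiff) *\<^sub>q torus m else 0) =
        (if int j *s n \<in> level k then (?A j / qdiff) *\<^sub>q torus (int j *s n) else 0)"
      by (rule sum.delta') simp
    also have "int j *s n \<in> level k \<longleftrightarrow> k = j * deg n"
      using Nplus_scale[OF n, of j] deg_scale[OF n, of j] j by (auto simp: level_def)
    also have "(if k = j * deg n then (?A j / qdiff) *\<^sub>q torus (int j *s n) else 0) = ?L $ j *\<^sub>q (qmon n b ^ j) $ k"
      using A[of j] j by (auto simp: qmon_power n b)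
        (auto simp: qmon_def fmon_nth deg_scale n b qpow_of_nat_mult scl_scl)
    finally show "(\<Sum>m\<in>level k. if int j *s n = m then (?A j / qdiff) *\<^sub>q torus m else 0) = ?L $ j *\<^sub>q (qmon n b ^ j) $ k" .
  qed
  also have "\<dots> = (\<Sum>j\<le>k. ?L $ j *\<^sub>q (qmon n b ^ j) $ k)"
    by (rule sum.mono_neutral_left) (auto simp: not_le less_Suc_eq_0_disj)
  finally show "emb (qdilog d n a b) $ k = ev ?L (qmon n b) $ k"
    by (simp add: ev_def)
qed

lemma gexp_qdilog:
  assumes "n \<in> Nplus" "a \<in> fracs d" "b \<in> fracs d"
  shows "gexp (qdilog d n a b) = Phi (qpow d a) (qmon n b)"
  using assms by (simp add: gexp_def emb_qdilog Phi_eq_nexp)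

section \<open>Infinite products in the group and transfer of the factorization\<close>

lemma gexp_list_prod: "gexp (list_prod (qgroup B d) xs) = prod_list (map gexp xs)"
  by (induction xs) (auto simp: list_prod_def gexp_mult gexp_one)

lemma list_prod_in_ghat: "set xs \<subseteq> ghat \<Longrightarrow> list_prod (qgroup B d) xs \<in> ghat"
proof (induction xs)
  case Nil
  then show ?case using G.one_closed by (simp add: list_prod_def)
next
  case (Cons x xs)
  then show ?case using G.m_closed[of x "list_prod (qgroup B d) xs"] by (simp add: list_prod_def)
qed

text \<open>The factor with index \<open>p\<close> is trivial up to degree \<open>p\<close>, so up
  to degree \<open>l\<close> the partial products are constant from length \<open>l\<close>
  on.\<close>

lemma right_product_exists:
  assumes f: "\<And>p. f p \<in> ghat" and triv: "\<And>l p. l \<le> p \<Longrightarrow> fps_cong l (gexp (f p)) 1"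
  obtains g where "g \<in> ghat" "has_prod_right B d f g"
    "\<And>l. fps_cong l (rprod (\<lambda>p. gexp (f p)) (Suc l)) (gexp g)"
proof -
  let ?s = "\<lambda>k. list_prod (qgroup B d) (map f [0..<k])"
  have s: "gexp (?s k) = rprod (\<lambda>p. gexp (f p)) k" for k
    by (simp add: gexp_list_prod rprod_def comp_def)
  have "fps_cong l (gexp (?s (Suc k))) (gexp (?s k))" if "l \<le> k" for l k
    using fps_cong_mult[OF fps_cong_refl triv[OF that], of "gexp (?s k)"] unfolding s rprod_simps by simp
  moreover have "?s k \<in> ghat" for k
    using f by (intro list_prod_in_ghat) auto
  ultimately obtain g where g: "g \<in> ghat" "has_limit B d ?s g" "\<And>l k. l \<le> k \<Longrightarrow> fps_cong l (gexp (?s k)) (gexp g)"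
    using limit_exists[of ?s] by metis
  with that[of g] s show ?thesis
    by (metis has_prod_right_def le_SucI order_refl)
qed

lemma left_product_exists:
  assumes f: "\<And>p. f p \<in> ghat" and triv: "\<And>l p. l \<le> p \<Longrightarrow> fps_cong l (gexp (f p)) 1"
  obtains g where "g \<in> ghat" "has_prod_left B d f g"
    "\<And>l. fps_cong l (lprod (\<lambda>p. gexp (f p)) (Suc l)) (gexp g)"
proof -
  let ?s = "\<lambda>k. list_prod (qgroup B d) (map f (rev [0..<k]))"
  have s: "gexp (?s k) = lprod (\<lambda>p. gexp (f p)) k" for k
    by (simp add: gexp_list_prod lprod_def comp_def rev_map)
  have "fps_cong l (gexp (?s (Suc k))) (gexp (?s k))" if "l \<le> k" for l k
    using fps_cong_mult[OF triv[OF that] fps_cong_refl, of "gexp (?s k)"] unfolding s lprod_simps by simp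
  moreover have "?s k \<in> ghat" for k
    using f by (intro list_prod_in_ghat) auto
  ultimately obtain g where g: "g \<in> ghat" "has_limit B d ?s g" "\<And>l k. l \<le> k \<Longrightarrow> fps_cong l (gexp (?s k)) (gexp g)"
    using limit_exists[of ?s] by metis
  with that[of g] s show ?thesis
    by (metis has_prod_left_def le_SucI order_refl)
qed

theorem kronecker_factorization:
  assumes n: "n \<in> Nplus" and n': "n' \<in> Nplus" and c: "B n' n = c" "c > 0"
    and b: "b \<in> fracs d" and b': "b' \<in> fracs d" and c2: "c / 2 \<in> fracs d"
  shows "\<exists>P M R.
    has_prod_right B d
      (\<lambda>p. qdilog d (int (p + 1) *s n + int p *s n') (c / 2) (of_nat (p + 1) * b + of_nat p * b')) P \<and>
    has_prod_right B d
      (\<lambda>p. qdilog d (2 ^ p *s (n + n')) (2 powi (int p - 1) * c)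
             (2 ^ p * (b + b') - 2 powi (int p - 1) * c) \<otimes>\<^bsub>qgroup B d\<^esub>
           qdilog d (2 ^ p *s (n + n')) (2 powi (int p - 1) * c)
             (2 ^ p * (b + b') + 2 powi (int p - 1) * c)) M \<and>
    has_prod_left B d
      (\<lambda>p. qdilog d (int p *s n + int (p + 1) *s n') (c / 2) (of_nat p * b + of_nat (p + 1) * b')) R \<and>
    qdilog d n' (c / 2) b' \<otimes>\<^bsub>qgroup B d\<^esub> qdilog d n (c / 2) b
      = P \<otimes>\<^bsub>qgroup B d\<^esub> M \<otimes>\<^bsub>qgroup B d\<^esub> R"
proof -
  define Q where "Q = qpow d (c / 2)"
  define u v where "u = qmon n b" "v = qmon n' b'"
  have Q: "generic Q"
    unfolding Q_def using c c2 by (intro generic_qpow) auto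
  have omega: "omega n n' = - 2 * qexponent (c / 2)" "omega n' n = 2 * qexponent (c / 2)"
  proof -
    have "(of_int (omega n' n) :: rat) = of_int (2 * qexponent (c / 2))"
      by (simp add: of_int_omega of_int_qexponent[OF c2] c)
    then show "omega n' n = 2 * qexponent (c / 2)" by (simp only: of_int_eq_iff)
    then show "omega n n' = - 2 * qexponent (c / 2)" using omega_skew[of n n'] by simp
  qed
  have Qpow: "tvar powi (int k * qexponent (c / 2)) = Q ^ k" "tvar powi (- (int k * qexponent (c / 2))) = inverse (Q ^ k)" for k
    by (simp_all add: Q_def qpow_eq power_int_mult power_int_minus mult.commute[of "int k"])
  have uv: "u ^ i * v ^ j = inverse (Q ^ (2 * i * j)) *\<^sub>q
      qmon (int i *s n + int j *s n') (of_nat i * b + of_nat j * b')" for i j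
  proof -
    have "omega (int i *s n) (int j *s n') = - (int (2 * i * j) * qexponent (c / 2))"
      by (simp add: omega_scale_left omega_scale_right omega)
    then have "torus (int i *s n) * torus (int j *s n') = inverse (Q ^ (2 * i * j)) *\<^sub>q torus (int i *s n + int j *s n')"
      by (simp only: torus_mult Qpow)
    then show ?thesis
      unfolding u_v_def qmon_power[OF n b] qmon_power[OF n' b']
      by (simp add: qmon_def fmon_mult scl_fmon scl_mult deg_scale n n' deg_combination qpow_add b b'
          fracs_of_nat_mult) (simp add: mult_ac)
  qed
  \<comment> \<open>Both products are multiples of the monomial of \<open>n + n'\<close>, by q^c and
    by q^(-c); with \<open>Q\<close> for q^(c/2) the ratio is \<open>Q ^ 4\<close>.\<close>
  have vu: "v * u = Q ^ 4 *\<^sub>q (u * v)"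
  proof -
    have "torus n' * torus n = Q ^ 2 *\<^sub>q torus (n + n')"
      using Qpow(1)[of 2] by (simp add: torus_mult omega add.commute)
    moreover have "torus n * torus n' = inverse (Q ^ 2) *\<^sub>q torus (n + n')"
      using Qpow(2)[of 2] by (simp add: torus_mult omega)
    moreover have "Q ^ 4 * inverse (Q ^ 2) = Q ^ 2"
      using Q by (simp add: field_simps flip: power_add)
    ultimately show ?thesis
      by (simp add: u_v_def qmon_def fmon_mult scl_mult scl_fmon add.commute mult_ac)
  qed
  interpret quantum_plane Q u v
    by standard (use Q vu n n' in \<open>auto simp: u_v_def\<close>)
  \<comment> \<open>The Weyl ordering factor cancels the scalar in \<open>uv\<close>, which
    identifies the abstract monomials with those of the torus.\<close>
  have yy: "yy i j = qmon (int i *s n + int j *s n') (of_nat i * b + of_nat j * b')" for i j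
    using Q by (simp add: yy_def uv scl_scl)
  let ?fR = "\<lambda>p. qdilog d (int (p + 1) *s n + int p *s n') (c / 2) (of_nat (p + 1) * b + of_nat p * b')"
  let ?fL = "\<lambda>p. qdilog d (int p *s n + int (p + 1) *s n') (c / 2) (of_nat p * b + of_nat (p + 1) * b')"
  let ?g1 = "\<lambda>p. qdilog d (2 ^ p *s (n + n')) (2 powi (int p - 1) * c) (2 ^ p * (b + b') - 2 powi (int p - 1) * c)"
  let ?g2 = "\<lambda>p. qdilog d (2 ^ p *s (n + n')) (2 powi (int p - 1) * c) (2 ^ p * (b + b') + 2 powi (int p - 1) * c)"
  let ?fM = "\<lambda>p. ?g1 p \<otimes>\<^bsub>qgroup B d\<^esub> ?g2 p"
  let ?w = "yy 1 1"
  have dil: "qdilog d (int i *s n + int j *s n') (c / 2) (of_nat i * b + of_nat j * b') \<in> ghat"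
    "gexp (qdilog d (int i *s n + int j *s n') (c / 2) (of_nat i * b + of_nat j * b')) = Phi Q (yy i j)"
    if "i + j > 0" for i j
    using that n n' b b' c2
    by (simp_all add: qdilog_in_ghat Nplus_combination gexp_qdilog fracs_add fracs_of_nat_mult yy flip: Q_def)
  have fR: "?fR p \<in> ghat" "gexp (?fR p) = Phi Q (yy (p + 1) p)" for p
    by (rule dil; simp)+
  have fL: "?fL p \<in> ghat" "gexp (?fL p) = Phi Q (yy p (p + 1))" for p
    by (rule dil; simp)+
  have w: "?w = qmon (n + n') (b + b')"
    by (simp add: yy)
  have nn': "n + n' \<in> Nplus" using n n' by (rule Nplus_add)
  have bb': "b + b' \<in> fracs d" using b b' by (rule fracs_add)
  have gM: "?g1 p \<in> ghat" "?g2 p \<in> ghat"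
    "gexp (?g1 p) = Phi (Q ^ 2 ^ p) (inverse (Q ^ 2 ^ p) *\<^sub>q ?w ^ 2 ^ p)"
    "gexp (?g2 p) = Phi (Q ^ 2 ^ p) (Q ^ 2 ^ p *\<^sub>q ?w ^ 2 ^ p)" for p
  proof -
    \<comment> \<open>In this form the exponent is visibly a natural multiple of
      \<open>c / 2\<close>, also for \<open>p = 0\<close>, where the power of 2 is 1/2; so its
      q-power is \<open>Q ^ 2 ^ p\<close>.\<close>
    have half: "2 powi (int p - 1) * c = of_nat (2 ^ p) * (c / 2)"
      by (simp add: power_int_diff)
    have scale: "(2 :: int) ^ p = int (2 ^ p)" "(2 :: rat) ^ p = of_nat (2 ^ p)"
      by simp_all
    have N: "int (2 ^ p) *s (n + n') \<in> Nplus"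
      by (rule Nplus_scale[OF nn']) simp
    show "?g1 p \<in> ghat" "?g2 p \<in> ghat"
      unfolding scale by (rule qdilog_in_ghat[OF N])+
    note fr = fracs_of_nat_mult[OF c2, of "2 ^ p"] fracs_of_nat_mult[OF bb', of "2 ^ p"]
    have q: "qpow d (of_nat (2 ^ p) * (c / 2)) = Q ^ 2 ^ p"
      by (simp only: qpow_of_nat_mult[OF c2] Q_def)
    have wp: "?w ^ 2 ^ p = qmon (int (2 ^ p) *s (n + n')) (of_nat (2 ^ p) * (b + b'))"
      unfolding w by (rule qmon_power[OF nn' bb'])
    have "gexp (?g1 p) = Phi (Q ^ 2 ^ p) (qmon (int (2 ^ p) *s (n + n')) (of_nat (2 ^ p) * (b + b') + - (of_nat (2 ^ p) * (c / 2))))"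
      unfolding half scale q[symmetric] unfolding diff_conv_add_uminus
      by (intro gexp_qdilog N fr fracs_add fracs_minus)
    also have "qmon (int (2 ^ p) *s (n + n')) (of_nat (2 ^ p) * (b + b') + - (of_nat (2 ^ p) * (c / 2)))
        = inverse (Q ^ 2 ^ p) *\<^sub>q ?w ^ 2 ^ p"
      unfolding wp qmon_def qpow_add[OF fr(2) fracs_minus[OF fr(1)]] qpow_minus[OF fr(1)] q
      by (simp only: scl_fmon scl_scl mult.commute)
    finally show "gexp (?g1 p) = Phi (Q ^ 2 ^ p) (inverse (Q ^ 2 ^ p) *\<^sub>q ?w ^ 2 ^ p)" .
    have "gexp (?g2 p) = Phi (Q ^ 2 ^ p) (qmon (int (2 ^ p) *s (n + n')) (of_nat (2 ^ p) * (b + b') + of_nat (2 ^ p) * (c / 2)))"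
      unfolding half scale q[symmetric]
      by (intro gexp_qdilog N fr fracs_add)
    also have "qmon (int (2 ^ p) *s (n + n')) (of_nat (2 ^ p) * (b + b') + of_nat (2 ^ p) * (c / 2))
        = Q ^ 2 ^ p *\<^sub>q ?w ^ 2 ^ p"
      unfolding wp qmon_def qpow_add[OF fr(2) fr(1)] q
      by (simp only: scl_fmon scl_scl mult.commute)
    finally show "gexp (?g2 p) = Phi (Q ^ 2 ^ p) (Q ^ 2 ^ p *\<^sub>q ?w ^ 2 ^ p)" .
  qed
  have fM: "?fM p \<in> ghat" "gexp (?fM p) = Phi (Q ^ 2 ^ p) (inverse (Q ^ 2 ^ p) *\<^sub>q ?w ^ 2 ^ p) *
      Phi (Q ^ 2 ^ p) (Q ^ 2 ^ p *\<^sub>q ?w ^ 2 ^ p)" for p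
    using G.m_closed[of "?g1 p" "?g2 p"] gM[of p] by (simp_all add: gexp_mult)
  have order_w: "order_ge (Suc l) (?w ^ 2 ^ p)" if "l \<le> p" for l p
  proof (rule order_ge_mono[OF order_ge_power[OF order_ge_yy_1]])
    have "Suc l \<le> Suc p" using that by simp
    also have "\<dots> \<le> 2 ^ p" by (simp add: Suc_le_eq)
    also have "(2 :: nat) ^ p \<le> (1 + 1) * 2 ^ p" by simp
    finally show "Suc l \<le> (1 + 1) * 2 ^ p" .
  qed
  have order_yy: "fps_cong l (Phi Q (yy i j)) 1" if "l < i + j" for l i j
    by (intro Phi_trivial order_ge_mono[OF order_ge_yy_1]) (use that in simp)
  have trivR: "fps_cong l (gexp (?fR p)) 1" and trivL: "fps_cong l (gexp (?fL p)) 1" if "l \<le> p" for l p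
    unfolding fR fL using that by (auto intro!: order_yy)
  obtain P where P: "P \<in> ghat" "has_prod_right B d ?fR P"
    "\<And>l. fps_cong l (rprod (\<lambda>p. gexp (?fR p)) (Suc l)) (gexp P)"
    using right_product_exists[of ?fR, OF fR(1) trivR] by blast
  obtain R where R: "R \<in> ghat" "has_prod_left B d ?fL R"
    "\<And>l. fps_cong l (lprod (\<lambda>p. gexp (?fL p)) (Suc l)) (gexp R)"
    using left_product_exists[of ?fL, OF fL(1) trivL] by blast
  have triv: "fps_cong l (gexp (?fM p)) 1" if "l \<le> p" for l p
    unfolding fM using fps_cong_mult[OF Phi_trivial Phi_trivial, OF order_ge_scl order_ge_scl, OF order_w order_w, OF that that]
    by simp
  obtain M where M: "M \<in> ghat" "has_prod_right B d ?fM M"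
    "\<And>l. fps_cong l (rprod (\<lambda>p. gexp (?fM p)) (Suc l)) (gexp M)"
    using right_product_exists[of ?fM, OF fM(1) triv] by blast
  have vn: "qdilog d n' (c / 2) b' \<in> ghat" "gexp (qdilog d n' (c / 2) b') = Phi Q v"
    and un: "qdilog d n (c / 2) b \<in> ghat" "gexp (qdilog d n (c / 2) b) = Phi Q u"
    by (simp_all add: qdilog_in_ghat n n' gexp_qdilog b b' c2 u_v_def Q_def)
  have "gexp (qdilog d n' (c / 2) b' \<otimes>\<^bsub>qgroup B d\<^esub> qdilog d n (c / 2) b)
      = gexp (P \<otimes>\<^bsub>qgroup B d\<^esub> M \<otimes>\<^bsub>qgroup B d\<^esub> R)"
  proof (rule fps_cong_all_eq)
    fix l
    let ?K = "Suc l"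
    have "fps_cong l (Phi Q v * Phi Q u)
        (rprod (\<lambda>p. Phi Q (yy (p + 1) p)) ?K * Mid Q ?w * lprod (\<lambda>p. Phi Q (yy p (p + 1))) ?K)"
      by (rule kronecker_factorization) simp
    also have "\<dots> = rprod (\<lambda>p. gexp (?fR p)) ?K * (rprod (\<lambda>p. gexp (?fM p)) ?K * Mid (Q ^ 2 ^ ?K) (?w ^ 2 ^ ?K)) *
        lprod (\<lambda>p. gexp (?fL p)) ?K"
      unfolding fR fL fM by (subst Mid_partial_product[OF Q, of ?w ?K]) simp_all
    \<comment> \<open>The remainder of the central product is a series in the power of
      \<open>?w\<close> with exponent 2^(l+1), whose order exceeds \<open>l\<close>.\<close>
    also have "fps_cong l \<dots> (gexp P * (gexp M * 1) * gexp R)"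
      by (intro fps_cong_mult P R M Mid_trivial order_w) simp
    finally show "fps_cong l (gexp (qdilog d n' (c / 2) b' \<otimes>\<^bsub>qgroup B d\<^esub> qdilog d n (c / 2) b))
        (gexp (P \<otimes>\<^bsub>qgroup B d\<^esub> M \<otimes>\<^bsub>qgroup B d\<^esub> R))"
      by (simp add: gexp_mult vn un mult.assoc)
  qed
  then have "qdilog d n' (c / 2) b' \<otimes>\<^bsub>qgroup B d\<^esub> qdilog d n (c / 2) b = P \<otimes>\<^bsub>qgroup B d\<^esub> M \<otimes>\<^bsub>qgroup B d\<^esub> R"
    using vn(1) un(1) P(1) M(1) R(1) G.m_closed unfolding carrier_qgroup by (intro gexp_inj) auto
  with P M R show ?thesis by blast
qed

end

theorem theoremA4:
  shows
  "(\<forall>(B :: int ^ 'r::finite \<Rightarrow> int ^ 'r \<Rightarrow> rat) d n n' c b b'.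
      fixed_data B d \<and> n \<in> Nplus \<and> n' \<in> Nplus \<and> B n' n = c \<and> c > 0 \<and>
      b \<in> fracs d \<and> b' \<in> fracs d \<and> c / 2 \<in> fracs d \<longrightarrow>
      (\<exists>P Q R.
        has_prod_right B d
          (\<lambda>p. qdilog d (int (p + 1) *s n + int p *s n') (c / 2)
                 (of_nat (p + 1) * b + of_nat p * b')) P \<and>
        has_prod_right B d
          (\<lambda>p. qdilog d (2 ^ p *s (n + n')) (2 powi (int p - 1) * c)
                 (2 ^ p * (b + b') - 2 powi (int p - 1) * c) \<otimes>\<^bsub>qgroup B d\<^esub>
               qdilog d (2 ^ p *s (n + n')) (2 powi (int p - 1) * c)
                 (2 ^ p * (b + b') + 2 powi (int p - 1) * c)) Q \<and>
        has_prod_left B d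
          (\<lambda>p. qdilog d (int p *s n + int (p + 1) *s n') (c / 2)
                 (of_nat p * b + of_nat (p + 1) * b')) R \<and>
        qdilog d n' (c / 2) b' \<otimes>\<^bsub>qgroup B d\<^esub> qdilog d n (c / 2) b
          = P \<otimes>\<^bsub>qgroup B d\<^esub> Q \<otimes>\<^bsub>qgroup B d\<^esub> R))
   \<and>
   (\<forall>(B :: int ^ 2 \<Rightarrow> int ^ 2 \<Rightarrow> rat) d e\<^sub>1 e\<^sub>2.
      fixed_data B d \<and> d 1 = 2 \<and> d 2 = 2 \<and> e\<^sub>1 = axis 1 1 \<and> e\<^sub>2 = axis 2 1 \<and> B e\<^sub>2 e\<^sub>1 = 1 \<longrightarrow>
      (\<exists>P Q R.
        has_prod_right B d
          (\<lambda>p. qdilog d (int (p + 1) *s e\<^sub>1 + int p *s e\<^sub>2) (1 / 2) 0) P \<and>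
        has_prod_right B d
          (\<lambda>j. qdilog d (2 ^ j *s (e\<^sub>1 + e\<^sub>2)) (2 powi (int j - 1)) (- (2 powi (int j - 1)))
               \<otimes>\<^bsub>qgroup B d\<^esub>
               qdilog d (2 ^ j *s (e\<^sub>1 + e\<^sub>2)) (2 powi (int j - 1)) (2 powi (int j - 1))) Q \<and>
        has_prod_left B d
          (\<lambda>p. qdilog d (int p *s e\<^sub>1 + int (p + 1) *s e\<^sub>2) (1 / 2) 0) R \<and>
        qdilog d e\<^sub>2 (1 / 2) 0 \<otimes>\<^bsub>qgroup B d\<^esub> qdilog d e\<^sub>1 (1 / 2) 0
          = P \<otimes>\<^bsub>qgroup B d\<^esub> Q \<otimes>\<^bsub>qgroup B d\<^esub> R))"
proof (intro conjI allI impI; elim conjE)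
  fix B :: "int ^ 'r \<Rightarrow> int ^ 'r \<Rightarrow> rat" and d n n' c b b'
  assume "fixed_data B d" and rest: "n \<in> Nplus" "n' \<in> Nplus" "B n' n = c" "c > 0"
    "b \<in> fracs d" "b' \<in> fracs d" "c / 2 \<in> fracs d"
  then interpret fixed_data B d by simp
  show "\<exists>P Q R.
        has_prod_right B d
          (\<lambda>p. qdilog d (int (p + 1) *s n + int p *s n') (c / 2)
                 (of_nat (p + 1) * b + of_nat p * b')) P \<and>
        has_prod_right B d
          (\<lambda>p. qdilog d (2 ^ p *s (n + n')) (2 powi (int p - 1) * c)
                 (2 ^ p * (b + b') - 2 powi (int p - 1) * c) \<otimes>\<^bsub>qgroup B d\<^esub>
               qdilog d (2 ^ p *s (n + n')) (2 powi (int p - 1) * c)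
                 (2 ^ p * (b + b') + 2 powi (int p - 1) * c)) Q \<and>
        has_prod_left B d
          (\<lambda>p. qdilog d (int p *s n + int (p + 1) *s n') (c / 2)
                 (of_nat p * b + of_nat (p + 1) * b')) R \<and>
        qdilog d n' (c / 2) b' \<otimes>\<^bsub>qgroup B d\<^esub> qdilog d n (c / 2) b
          = P \<otimes>\<^bsub>qgroup B d\<^esub> Q \<otimes>\<^bsub>qgroup B d\<^esub> R"
    using rest by (rule kronecker_factorization)
next
  fix B :: "int ^ 2 \<Rightarrow> int ^ 2 \<Rightarrow> rat" and d and e\<^sub>1 e\<^sub>2 :: "int ^ 2"
  assume "fixed_data B d" and d: "d 1 = 2" "d 2 = 2" and e: "e\<^sub>1 = axis 1 1" "e\<^sub>2 = axis 2 1"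
    and B: "B e\<^sub>2 e\<^sub>1 = 1"
  then interpret fixed_data B d by simp
  have "e\<^sub>1 \<in> Nplus" "e\<^sub>2 \<in> Nplus"
    by (auto simp: e Nplus_def axis_def)
  \<comment> \<open>Hence \<open>delta0 d = 2\<close>, and 1/2 is an admissible exponent.\<close>
  moreover have "range d = {2}"
    by (auto simp: UNIV_2 d)
  then have "1 / 2 \<in> fracs d" "0 \<in> fracs d"
    unfolding fracs_def delta0_def by (auto intro: exI[of _ 1] exI[of _ 0])
  ultimately show "\<exists>P Q R.
        has_prod_right B d
          (\<lambda>p. qdilog d (int (p + 1) *s e\<^sub>1 + int p *s e\<^sub>2) (1 / 2) 0) P \<and>
        has_prod_right B d
          (\<lambda>j. qdilog d (2 ^ j *s (e\<^sub>1 + e\<^sub>2)) (2 powi (int j - 1)) (- (2 powi (int j - 1)))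
               \<otimes>\<^bsub>qgroup B d\<^esub>
               qdilog d (2 ^ j *s (e\<^sub>1 + e\<^sub>2)) (2 powi (int j - 1)) (2 powi (int j - 1))) Q \<and>
        has_prod_left B d
          (\<lambda>p. qdilog d (int p *s e\<^sub>1 + int (p + 1) *s e\<^sub>2) (1 / 2) 0) R \<and>
        qdilog d e\<^sub>2 (1 / 2) 0 \<otimes>\<^bsub>qgroup B d\<^esub> qdilog d e\<^sub>1 (1 / 2) 0
          = P \<otimes>\<^bsub>qgroup B d\<^esub> Q \<otimes>\<^bsub>qgroup B d\<^esub> R"
    using kronecker_factorization[OF _ _ B, of 0 0] by simp
qed

end
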